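(* Let $(T(t))_{t\ge0}$ be a uniformly bounded $C_0$-semigroup on a Banach space $X$ ($\|T(t)\|\le M$ for all $t\ge0$) with infinitesimal generator $(-A,D(A))$. (i) For $n\in\mathbb N\cup\{0\}$ and $\alpha>-1$: $\int_0^\infty\ell_n^{(\alpha)}(t)T(t)x\,dt=A^n(A+1)^{-n-\alpha-1}x$ for all $x\in X$. (ii) For $n\in\mathbb N\cup\{0\}$ and $\alpha>0$: $\int_0^\infty\ell_n^{(\alpha)}(t)(t+A)^{-1}x\,dt=\int_0^\infty\varphi_{n,\alpha}(t)T(t)x\,dt$ for all $x\in X$. (iii) For $x\in D(A)$, $\alpha>-1$ and $t>0$: $T(t)x=\sum_{n=0}^\infty A^n(A+1)^{-n-\alpha-1}x\,L_n^{(\alpha)}(t)$, the series converging in $X$. (iv) For $x\in D(A)$, $\alpha>-1$ and $t>0$: $T(t)x=\big(\tfrac{1-V}{2}\big)^{\alpha+1}\sum_{n=0}^\infty\big(\tfrac{V+1}{2}\big)^n x\,L_n^{(\alpha)}(t)$. (v) For $x\in X$, $\alpha>1$ and $\lambda>0$: $(\lambda+A)^{-1}x=\sum_{n=0}^\infty\Big(\int_0^\infty\varphi_{n,\alpha}(t)T(t)x\,dt\Big)L_n^{(\alpha)}(\lambda)$, the series converging in $X$.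
   Context: $L_n^{(\alpha)}(t)=\sum_{k=0}^n(-1)^k\binom{n+\alpha}{n-k}\frac{t^k}{k!}$ is the generalized Laguerre polynomial; $\ell_n^{(\alpha)}(t):=\frac{n!}{\Gamma(n+\alpha+1)}t^{\alpha}e^{-t}L_n^{(\alpha)}(t)$ for $t>0$; $\varphi_{n,\alpha}(t):=\frac{t^n}{(t+1)^{n+\alpha+1}}$. The generator is defined by $-Ax=\lim_{t\to0^+}\frac{T(t)x-x}{t}$ on the set $D(A)$ where the limit exists. For $\gamma>0$ and $\lambda>0$ the fractional power of the resolvent is $(\lambda+A)^{-\gamma}x:=\frac{1}{\Gamma(\gamma)}\int_0^\infty t^{\gamma-1}e^{-\lambda t}T(t)x\,dt$, $x\in X$. The cogenerator is the bounded operator $V:=(A-1)(A+1)^{-1}$, so that $\frac{1-V}{2}=(A+1)^{-1}$ and $\frac{V+1}{2}=A(A+1)^{-1}$; accordingly $\big(\frac{1-V}{2}\big)^{\alpha+1}$ means $(A+1)^{-\alpha-1}$.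
   Formalization: In (iv) the operator ((1−V)/2)^{α+1} is applied to each term of the series instead of to its sum, because the inner series Σ((V+1)/2)^n x L_n^{(α)}(t) need not converge in X (e.g. translations on L²(ℝ), α=1, x in D(A) but not D(A²)). *)

theory Defs
  imports "HOL-Analysis.Analysis"
begin

definition bounded_c0_semigroup :: "(real \<Rightarrow> ('a::banach \<Rightarrow>\<^sub>L 'a)) \<Rightarrow> real \<Rightarrow> bool" where
  "bounded_c0_semigroup T M \<longleftrightarrow>
     T 0 = id_blinfun \<and>
     (\<forall>s\<ge>0. \<forall>t\<ge>0. T (s + t) = T s o\<^sub>L T t) \<and>
     (\<forall>x. continuous_on {0..} (\<lambda>t. blinfun_apply (T t) x)) \<and>
     (\<forall>t\<ge>0. norm (T t) \<le> M)"

definition gen_dom :: "(real \<Rightarrow> ('a::banach \<Rightarrow>\<^sub>L 'a)) \<Rightarrow> 'a set" where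
  "gen_dom T = {x. \<exists>y. ((\<lambda>h. (1 / h) *\<^sub>R (blinfun_apply (T h) x - x)) \<longlongrightarrow> y) (at_right 0)}"

text \<open>The operator A, where -A is the generator (meaningful on gen_dom T).\<close>
definition genA :: "(real \<Rightarrow> ('a::banach \<Rightarrow>\<^sub>L 'a)) \<Rightarrow> 'a \<Rightarrow> 'a" where
  "genA T x = - Lim (at_right 0) (\<lambda>h. (1 / h) *\<^sub>R (blinfun_apply (T h) x - x))"

definition genA_pow_dom :: "(real \<Rightarrow> ('a::banach \<Rightarrow>\<^sub>L 'a)) \<Rightarrow> nat \<Rightarrow> 'a set" where
  "genA_pow_dom T n = {x. \<forall>k<n. (genA T ^^ k) x \<in> gen_dom T}"

text \<open>Fractional power of the resolvent:
  (lambda + A)^(-gamma) x = 1/Gamma(gamma) * integral_0^infty t^(gamma-1) e^(-lambda t) T(t)x dt.\<close>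
definition frac_res :: "(real \<Rightarrow> ('a::banach \<Rightarrow>\<^sub>L 'a)) \<Rightarrow> real \<Rightarrow> real \<Rightarrow> 'a \<Rightarrow> 'a" where
  "frac_res T lam g x =
     (1 / Gamma g) *\<^sub>R integral {0<..} (\<lambda>t. (t powr (g - 1) * exp (- lam * t)) *\<^sub>R blinfun_apply (T t) x)"

definition cogen :: "(real \<Rightarrow> ('a::banach \<Rightarrow>\<^sub>L 'a)) \<Rightarrow> 'a \<Rightarrow> 'a" where
  "cogen T y = genA T (frac_res T 1 1 y) - frac_res T 1 1 y"

definition laguerre :: "nat \<Rightarrow> real \<Rightarrow> real \<Rightarrow> real" where
  "laguerre n a t = (\<Sum>k\<le>n. (-1) ^ k * ((real n + a) gchoose (n - k)) * t ^ k / fact k)"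

definition laguerre_fn :: "nat \<Rightarrow> real \<Rightarrow> real \<Rightarrow> real" where
  "laguerre_fn n a t = fact n / Gamma (real n + a + 1) * t powr a * exp (- t) * laguerre n a t"

definition phi_fn :: "nat \<Rightarrow> real \<Rightarrow> real \<Rightarrow> real" where
  "phi_fn n a t = t ^ n / (t + 1) powr (real n + a + 1)"

end

theory Submission
  imports Defs "HOL-Real_Asymp.Real_Asymp" "HOL-Computational_Algebra.Polynomial"
begin

text \<open>
  Part (i) is integration by parts: \<open>laguerre_fn n \<alpha>\<close> is the \<open>n\<close>-th derivative of the density
  \<open>t^(n+\<alpha>) e^(-t) / \<Gamma>(n+\<alpha>+1)\<close>, and \<open>A\<close> turns \<open>\<integral> g(t) T(t)x dt\<close> into \<open>\<integral> g'(t) T(t)x dt\<close>.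
  Part (iv) is the same series as (iii), because \<open>(V+1)/2 = 1 - (A+1)^(-1)\<close> raises the index \<open>n\<close>.

  For (iii), the Christoffel--Darboux formula writes the error of the \<open>N\<close>-th partial sum as integrals
  of \<open>L\<^sub>N\<close> against the difference quotient of the orbit. Since \<open>L\<^sub>N(t) = O(N^(\<alpha>/2 - 1/4))\<close> and the
  weighted integrals are of the same order, the error is \<open>O(1)\<close>, and a Riemann--Lebesgue argument
  improves this to \<open>o(1)\<close>. Both bounds come from
  \<open>\<integral> s^\<alpha> e^(-4s/3) L\<^sub>n(s)^2 ds = O(n^(\<alpha> - 1/2))\<close>: rescaling expands \<open>L\<^sub>n(3u/4)\<close> in the orthogonal
  system \<open>L\<^sub>k(u)\<close> with binomial weights, whose maximum is \<open>O(n^(-1/2))\<close>.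

  The scalar case \<open>T(t) = e^(-st)\<close> of (iii) reads \<open>e^(-s\<lambda>) = \<Sum>\<^sub>n \<phi>\<^sub>n(s) L\<^sub>n(\<lambda>)\<close>; integrating it against
  \<open>T(s)x\<close> gives (v). Part (ii) is Fubini's theorem. All vector-valued integrals are Henstock--Kurzweil
  integrals of continuous functions with an integrable majorant, for which Fubini's theorem follows from
  the case of compact rectangles.
\<close>

section \<open>Integrals over the half line\<close>

text \<open>The Christoffel--Darboux kernel carries a factor N + 1. With norms of order N^a and
  Laguerre factors of order N^(a/2 - 1/4), a direct estimate of the error gives only O(N^(1/2)).
  Writing the kernel with L_(N+1) of parameter a - 1, and trading (N + 1) L_(N+1) for -t L_(N-1) of
  parameter a + 1 plus (a - t) L_N of parameter a, gains the missing N^(-1/2); the orders then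
  cancel exactly.

  The natural weight e^(-s) is too weak for the square bounds, since it returns the full norm N^a. A
  weight e^(-c s) with c > 1 gains N^(-1/2); its Cauchy--Schwarz partner is e^(-(2 - c) s), which
  must still decay because orbits are merely bounded. So 1 < c < 2. The choice c = 4/3 rescales by
  3/4, and 1/4 = (1/2)^2 lets two stages of fair coin tossing reduce the maximum of the weights to
  the central binomial coefficient.

  The function f is only once continuously differentiable, so its difference quotient at t is
  continuous there but in general not differentiable; the Riemann--Lebesgue step therefore works
  with regularized quotients.\<close>

lemma FTC_halfline:
  fixes F f :: "real \<Rightarrow> 'a::banach"
  assumes deriv: "\<And>t. t > 0 \<Longrightarrow> (F has_vector_derivative f t) (at t)"
    and lim0: "(F \<longlongrightarrow> A) (at_right 0)" and limtop: "(F \<longlongrightarrow> L) at_top"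
  shows "(f has_integral (L - A)) {0<..}"
proof -
  define g where "g = (\<lambda>x. if x \<in> {0<..} then f x else 0)"
  \<comment> \<open>Freezing the value \<open>A\<close> to the left of 0 makes \<open>G\<close>
    continuous everywhere and differentiable except at 0, so the fundamental theorem applies on
    every compact interval. Integrability of \<open>f\<close> is a conclusion, drawn from the two
    limits.\<close>
  define G where "G = (\<lambda>x. if x \<le> 0 then A else F x)"
  have dG: "(G has_vector_derivative g x) (at x)" if "x \<noteq> 0" for x
  proof (cases "x > 0")
    case True
    have "(F has_vector_derivative g x) (at x)"
      using deriv[OF True] True by (simp add: g_def)
    then show ?thesis
    proof (rule has_vector_derivative_transform_within_open)
      show "open {0::real<..}" "x \<in> {0<..}" using True by auto
    qed (auto simp: G_def)
  next
    case False
    with that have x: "x < 0" by simp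
    have "((\<lambda>_. A) has_vector_derivative g x) (at x)"
      using x by (simp add: g_def)
    then show ?thesis
    proof (rule has_vector_derivative_transform_within_open)
      show "open {..<0::real}" "x \<in> {..<0}" using x by auto
    qed (auto simp: G_def)
  qed
  have contG: "continuous_on S G" for S
  proof -
    have "isCont G x" for x
    proof (cases "x = 0")
      case False
      then show ?thesis using dG has_vector_derivative_continuous by blast
    next
      case True
      have "(G \<longlongrightarrow> A) (at_right 0)"
      proof (rule Lim_transform_eventually[OF lim0])
        show "\<forall>\<^sub>F x in at_right 0. F x = G x"
          by (auto simp: eventually_at_filter G_def)
      qed
      moreover have "(G \<longlongrightarrow> A) (at_left 0)"
      proof (rule Lim_transform_eventually[OF tendsto_const])
        show "\<forall>\<^sub>F x in at_left 0. A = G x"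
          by (auto simp: eventually_at_filter G_def)
      qed
      ultimately have "(G \<longlongrightarrow> A) (at 0)" by (simp add: filterlim_at_split)
      then show ?thesis using True by (simp add: isCont_def G_def)
    qed
    then show ?thesis by (simp add: continuous_at_imp_continuous_on)
  qed
  have int: "(g has_integral (G b - G a)) {a..b}" if "a \<le> b" for a b
    by (rule fundamental_theorem_of_calculus_interior_strong[of "{0}"])
       (use that contG dG in auto)
  show ?thesis
    unfolding has_integral_alt'[of f _ "{0<..}"] g_def[symmetric]
  proof (intro conjI allI impI)
    fix a b :: real
    show "g integrable_on cbox a b"
      by (cases "a \<le> b") (use int[of a b] in \<open>auto simp: integrable_on_def\<close>)
  next
    fix e :: real assume e: "e > 0"
    from tendstoD[OF limtop e] obtain B where B: "\<And>t. t \<ge> B \<Longrightarrow> dist (F t) L < e"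
      by (auto simp: eventually_at_top_linorder)
    show "\<exists>B>0. \<forall>a b. ball 0 B \<subseteq> cbox a b \<longrightarrow> norm (integral (cbox a b) g - (L - A)) < e"
    proof (intro exI[of _ "\<bar>B\<bar> + 1"] conjI allI impI)
      fix a b :: real assume sub: "ball 0 (\<bar>B\<bar> + 1) \<subseteq> cbox a b"
      have "\<bar>B\<bar> + 1/2 \<in> ball 0 (\<bar>B\<bar> + 1)" "- \<bar>B\<bar> - 1/2 \<in> ball 0 (\<bar>B\<bar> + 1)"
        by (auto simp: dist_real_def)
      with sub have "\<bar>B\<bar> + 1/2 \<in> cbox a b" "- \<bar>B\<bar> - 1/2 \<in> cbox a b" by blast+
      then have ab: "a < 0" "b > 0" "b \<ge> B" by auto
      have "integral (cbox a b) g = G b - G a"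
        using int[of a b] ab by (simp add: integral_unique)
      also have "\<dots> = F b - A" using ab by (simp add: G_def)
      finally show "norm (integral (cbox a b) g - (L - A)) < e"
        using B[OF ab(3)] by (simp add: dist_norm)
    qed auto
  qed
qed

text \<open>A Cauchy criterion by comparison: the oscillation of \<open>F\<close> along the filter
  is controlled by that of the convergent scalar function \<open>h\<close>, and completeness
  supplies the limit. It is used with \<open>h\<close> the primitive of a scalar majorant.\<close>

lemma tendsto_of_dist_le:
  fixes F :: "'b \<Rightarrow> 'a::banach" and h :: "'b \<Rightarrow> real"
  assumes h: "(h \<longlongrightarrow> c) X" and X: "X \<noteq> bot" and P: "eventually P X"
    and le: "\<And>a b. P a \<Longrightarrow> P b \<Longrightarrow> norm (F a - F b) \<le> \<bar>h a - h b\<bar>"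
  shows "\<exists>l. (F \<longlongrightarrow> l) X"
proof -
  have "cauchy_filter (filtermap F X)"
    unfolding cauchy_filter_metric_filtermap
  proof (intro allI impI)
    fix e :: real assume "e > 0"
    then have "\<forall>\<^sub>F a in X. dist (h a) c < e / 2" using h by (intro tendstoD) auto
    with P have ev: "\<forall>\<^sub>F a in X. P a \<and> dist (h a) c < e / 2" by (rule eventually_conj)
    show "\<exists>P. eventually P X \<and> (\<forall>x y. P x \<and> P y \<longrightarrow> dist (F x) (F y) < e)"
    proof (intro exI conjI allI impI)
      show "eventually (\<lambda>a. P a \<and> dist (h a) c < e / 2) X" by (rule ev)
      fix x y assume "(P x \<and> dist (h x) c < e / 2) \<and> P y \<and> dist (h y) c < e / 2"
      then have "norm (F x - F y) \<le> \<bar>h x - h y\<bar>" "\<bar>h x - c\<bar> < e / 2" "\<bar>h y - c\<bar> < e / 2"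
        using le by (auto simp: dist_real_def)
      then show "dist (F x) (F y) < e" unfolding dist_norm by linarith
    qed
  qed
  moreover have "filtermap F X \<noteq> bot" using X by (simp add: filtermap_bot_iff)
  moreover have "filtermap F X \<le> principal UNIV" by simp
  ultimately obtain l where "filtermap F X \<le> nhds l"
    using complete_UNIV[where 'a='a] unfolding complete_uniform by blast
  then show ?thesis by (auto simp: filterlim_def)
qed

lemma integrable_on_halfline_Icc:
  fixes g :: "real \<Rightarrow> real"
  assumes "g integrable_on {0<..}" "a > 0"
  shows "g integrable_on {a..b}"
  using assms by (intro integrable_on_subinterval[where S="{0<..}"]) auto

text \<open>The comparison test for functions with values in a Banach space. Increments of a
  primitive \<open>F\<close> of \<open>f\<close> are bounded by increments of the primitive
  \<open>h\<close> of \<open>g\<close>; since \<open>h\<close> converges at 0 and at infinity, so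
  does \<open>F\<close>, and \<open>FTC_halfline\<close> makes \<open>f\<close> integrable.\<close>

lemma dominated_integrable_halfline:
  fixes f :: "real \<Rightarrow> 'a::banach"
  assumes cont: "continuous_on {0<..} f" and g: "g integrable_on {0<..}"
    and le: "\<And>t. t > 0 \<Longrightarrow> norm (f t) \<le> g t"
  shows "f integrable_on {0<..}"
proof -
  define k where "k = (\<lambda>x::real. if x \<in> {0<..} then g x else 0)"
  define h where "h = (\<lambda>t. integral {0..t} k)"
  have kint: "k integrable_on {a..b}" for a b
    using integrable_altD(1)[OF g, of a b] by (simp add: k_def)
  have hdiff: "h b - h a = integral {a..b} g" if "0 < a" "a \<le> b" for a b
  proof -
    have "h a + integral {a..b} k = h b" unfolding h_def
      by (rule Henstock_Kurzweil_Integration.integral_combine) (use that kint in auto)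
    moreover have "integral {a..b} k = integral {a..b} g"
      by (rule integral_cong) (use that in \<open>auto simp: k_def\<close>)
    ultimately show ?thesis by simp
  qed
  have fint: "f integrable_on {a..b}" if "0 < a" for a b
    using that by (intro integrable_continuous_real continuous_on_subset[OF cont]) auto
  \<comment> \<open>The base point is 1, because integrals of \<open>f\<close> reaching down to 0
    are not yet known to exist.\<close>
  define F where "F = (\<lambda>t. if t \<ge> 1 then integral {1..t} f else - integral {t..1} f)"
  have Fdiff: "F b - F a = integral {a..b} f" if "0 < a" "a \<le> b" for a b
  proof -
    consider "a \<ge> 1" | "a < 1" "1 \<le> b" | "b < 1" by linarith
    then show ?thesis
    proof cases
      case 1
      then have "integral {1..a} f + integral {a..b} f = integral {1..b} f"
        by (intro Henstock_Kurzweil_Integration.integral_combine) (use that fint in auto)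
      then show ?thesis using 1 that by (simp add: F_def algebra_simps)
    next
      case 2
      then have "integral {a..1} f + integral {1..b} f = integral {a..b} f"
        by (intro Henstock_Kurzweil_Integration.integral_combine) (use that fint in auto)
      then show ?thesis using 2 that by (simp add: F_def algebra_simps)
    next
      case 3
      then have "integral {a..b} f + integral {b..1} f = integral {a..1} f"
        by (intro Henstock_Kurzweil_Integration.integral_combine) (use that fint in auto)
      then show ?thesis using 3 that by (simp add: F_def algebra_simps)
    qed
  qed
  have dF: "(F has_vector_derivative f t) (at t)" if "t > 0" for t
  proof -
    have "continuous_on {t/2..t+1} f" using that by (intro continuous_on_subset[OF cont]) auto
    then have "((\<lambda>u. integral {t/2..u} f) has_vector_derivative f t) (at t within {t/2..t+1})"
      using that by (intro integral_has_vector_derivative) auto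
    then have "((\<lambda>u. integral {t/2..u} f) has_vector_derivative f t) (at t)"
      using that by (simp add: at_within_Icc_at)
    then have "((\<lambda>u. integral {t/2..u} f + F (t/2)) has_vector_derivative (f t + 0)) (at t)"
      by (intro has_vector_derivative_add has_vector_derivative_const)
    then have "((\<lambda>u. integral {t/2..u} f + F (t/2)) has_vector_derivative f t) (at t)" by simp
    then show ?thesis
    proof (rule has_vector_derivative_transform_within_open)
      show "open {t/2<..}" "t \<in> {t/2<..}" using that by auto
      fix u assume "u \<in> {t/2<..}"
      then show "integral {t/2..u} f + F (t/2) = F u" using Fdiff[of "t/2" u] that by (simp add: algebra_simps)
    qed
  qed
  have Fle: "norm (F a - F b) \<le> \<bar>h a - h b\<bar>" if "0 < a" "0 < b" for a b
  proof -
    have *: "norm (F b - F a) \<le> h b - h a" if "0 < a" "a \<le> b" for a b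
      unfolding Fdiff[OF that] hdiff[OF that]
      by (rule integral_norm_bound_integral)
         (use that le in \<open>auto intro!: fint integrable_on_halfline_Icc[OF g]\<close>)
    show ?thesis using *[of a b] *[of b a] that
      by (cases "a \<le> b") (auto simp: norm_minus_commute)
  qed
  have "continuous_on {0..1} h" unfolding h_def
    by (rule indefinite_integral_continuous_1) (rule kint)
  then have "(h \<longlongrightarrow> h 0) (at 0 within {0..1})" by (auto simp: continuous_on_def)
  then have h0: "(h \<longlongrightarrow> h 0) (at_right 0)"
    by (simp add: at_within_Icc_at_right)
  have htop: "(h \<longlongrightarrow> integral {0<..} g) at_top"
  proof (rule tendstoI)
    fix e :: real assume "e > 0"
    have "(g has_integral integral {0<..} g) {0<..}" using g by (rule integrable_integral)
    then obtain B where "B > 0" and B: "\<And>a b. ball 0 B \<subseteq> cbox a b \<Longrightarrow>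
            norm (integral (cbox a b) k - integral {0<..} g) < e"
      unfolding has_integral_alt'[of g] k_def[symmetric] using \<open>e > 0\<close> by blast
    show "\<forall>\<^sub>F t in at_top. dist (h t) (integral {0<..} g) < e"
      unfolding eventually_at_top_linorder
    proof (intro exI[of _ B] allI impI)
      fix t assume t: "t \<ge> B"
      have "integral {-B..0} k + integral {0..t} k = integral {-B..t} k"
        by (rule Henstock_Kurzweil_Integration.integral_combine) (use kint t \<open>B > 0\<close> in auto)
      moreover have "integral {-B..0} k = integral {-B..0} (\<lambda>_. 0)"
        by (rule integral_cong) (auto simp: k_def)
      ultimately have "h t = integral {-B..t} k" by (simp add: h_def)
      moreover have "ball 0 B \<subseteq> cbox (-B) t" using t by (auto simp: dist_real_def)
      ultimately show "dist (h t) (integral {0<..} g) < e" using B[of "-B" t] by (simp add: dist_norm)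
    qed
  qed
  have "\<exists>A. (F \<longlongrightarrow> A) (at_right 0)"
    by (rule tendsto_of_dist_le[OF h0, of "\<lambda>t. t > 0"]) (auto simp: Fle eventually_at_filter)
  moreover have "\<exists>L. (F \<longlongrightarrow> L) at_top"
    by (rule tendsto_of_dist_le[OF htop, of "\<lambda>t. t > 0"]) (auto simp: Fle eventually_gt_at_top)
  ultimately obtain A L where "(F \<longlongrightarrow> A) (at_right 0)" "(F \<longlongrightarrow> L) at_top" by blast
  from FTC_halfline[OF dF this] show ?thesis by (rule has_integral_integrable)
qed

lemma dominated_integral_bound_halfline:
  fixes f :: "real \<Rightarrow> 'a::banach"
  assumes "continuous_on {0<..} f" and "g integrable_on {0<..}"
    and "\<And>t. t > 0 \<Longrightarrow> norm (f t) \<le> g t"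
  shows "norm (integral {0<..} f) \<le> integral {0<..} g"
  by (rule integral_norm_bound_integral[OF dominated_integrable_halfline[OF assms]]) (use assms in auto)

lemma has_integral_stretch_halfline:
  fixes f :: "real \<Rightarrow> 'a::banach"
  assumes f: "(f has_integral I) {0<..}" and c: "c > 0"
  shows "((\<lambda>t. f (c * t)) has_integral (1 / c) *\<^sub>R I) {0<..}"
proof -
  define k where "k = (\<lambda>x. if x \<in> {0<..} then f x else 0)"
  have k_eq: "(\<lambda>x. if x \<in> {0<..} then f (c * x) else 0) = (\<lambda>x. k (c * x))"
    using c by (auto simp: k_def zero_less_mult_iff)
  from f have kint: "\<And>a b. k integrable_on cbox a b"
    and klim: "\<And>e. e > 0 \<Longrightarrow> \<exists>B>0. \<forall>a b. ball 0 B \<subseteq> cbox a b \<longrightarrow> norm (integral (cbox a b) k - I) < e"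
    unfolding has_integral_alt'[of f] k_def[symmetric] by blast+
  have *: "((\<lambda>x. k (c * x)) has_integral (1 / c) *\<^sub>R integral (cbox (c * a) (c * b)) k) (cbox a b)" for a b
    using has_integral_affinity'[OF integrable_integral[OF kint, of "c * a" "c * b"] c, of 0] c
    by (simp add: divide_inverse mult.assoc[symmetric])
  show ?thesis
    unfolding has_integral_alt'[of "\<lambda>t. f (c * t)"] k_eq
  proof (intro conjI allI impI)
    fix a b show "(\<lambda>x. k (c * x)) integrable_on cbox a b" using * by (rule has_integral_integrable)
  next
    fix e :: real assume "e > 0"
    then obtain B where "B > 0" and B: "\<And>a b. ball 0 B \<subseteq> cbox a b \<Longrightarrow> norm (integral (cbox a b) k - I) < e * c"
      using klim[of "e * c"] c by auto
    show "\<exists>B>0. \<forall>a b. ball 0 B \<subseteq> cbox a b \<longrightarrow>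
        norm (integral (cbox a b) (\<lambda>x. k (c * x)) - (1 / c) *\<^sub>R I) < e"
    proof (intro exI[of _ "B / c"] conjI allI impI)
      show "B / c > 0" using \<open>B > 0\<close> c by simp
      fix a b :: real assume sub: "ball 0 (B / c) \<subseteq> cbox a b"
      have "ball 0 B \<subseteq> cbox (c * a) (c * b)"
      proof
        fix x :: real assume "x \<in> ball 0 B"
        then have "x / c \<in> ball 0 (B / c)" using c by (simp add: divide_strict_right_mono)
        then have "x / c \<in> cbox a b" using sub by blast
        then show "x \<in> cbox (c * a) (c * b)" using c by (simp add: field_simps)
      qed
      from B[OF this] have "norm (integral (cbox (c * a) (c * b)) k - I) / c < e"
        using c by (simp add: field_simps)
      moreover have "integral (cbox a b) (\<lambda>x. k (c * x)) - (1 / c) *\<^sub>R I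
          = (1 / c) *\<^sub>R (integral (cbox (c * a) (c * b)) k - I)"
        using integral_unique[OF *[of a b]] by (simp add: scaleR_diff_right)
      ultimately show "norm (integral (cbox a b) (\<lambda>x. k (c * x)) - (1 / c) *\<^sub>R I) < e"
        using c by simp
    qed
  qed
qed

section \<open>Identities for Laguerre polynomials\<close>

text \<open>As formal polynomials the identities below can be checked coefficient by coefficient,
  with \<open>pderiv\<close> as the derivative.\<close>

definition lag_poly :: "nat \<Rightarrow> real \<Rightarrow> real poly" where
  "lag_poly n a = (\<Sum>k\<le>n. monom ((-1) ^ k * ((real n + a) gchoose (n - k)) / fact k) k)"

lemma coeff_lag_poly:
  "coeff (lag_poly n a) k = (if k \<le> n then (-1) ^ k * ((real n + a) gchoose (n - k)) / fact k else 0)"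
  by (simp add: lag_poly_def coeff_sum if_distrib[of "\<lambda>x. coeff x _"] sum.delta cong: if_cong)

lemma poly_lag_poly: "poly (lag_poly n a) t = laguerre n a t"
  by (simp add: lag_poly_def laguerre_def poly_sum poly_monom mult.commute mult.left_commute)

text \<open>Pascal's rule for generalized binomial coefficients.\<close>

lemma lag_poly_Suc_diff: "lag_poly (Suc n) a = lag_poly (Suc n) (a + 1) - lag_poly n (a + 1)"
proof (rule poly_eqI)
  fix k
  consider "k \<le> n" | "k = Suc n" | "k > Suc n" by linarith
  then show "coeff (lag_poly (Suc n) a) k = coeff (lag_poly (Suc n) (a + 1) - lag_poly n (a + 1)) k"
  proof cases
    case 1
    then have "Suc n - k = Suc (n - k)" by simp
    moreover have "real (Suc n) + (a + 1) = (real n + (a + 1)) + 1" "real (Suc n) + a = real n + (a + 1)" by simp_all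
    ultimately show ?thesis using 1 gbinomial_Suc_Suc[of "real n + (a + 1)" "n - k"]
      by (simp add: coeff_lag_poly field_simps)
  qed (auto simp: coeff_lag_poly)
qed

lemma laguerre_Suc_diff: "laguerre (Suc n) a t = laguerre (Suc n) (a + 1) t - laguerre n (a + 1) t"
  by (simp flip: poly_lag_poly poly_diff lag_poly_Suc_diff)

lemma laguerre_0 [simp]: "laguerre 0 a t = 1"
  by (simp add: laguerre_def)

lemma pderiv_lag_poly: "pderiv (lag_poly (Suc n) a) = - lag_poly n (a + 1)"
proof (rule poly_eqI)
  fix k
  show "coeff (pderiv (lag_poly (Suc n) a)) k = coeff (- lag_poly n (a + 1)) k"
  proof -
    have x: "real (Suc n) + a = real n + (a + 1)" by simp
    show ?thesis unfolding coeff_pderiv coeff_minus coeff_lag_poly x by (auto simp del: of_nat_Suc)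
  qed
qed

lemma pderiv_lag_poly_0 [simp]: "pderiv (lag_poly 0 a) = 0"
  by (simp add: lag_poly_def pderiv_monom)

lemma laguerre_has_real_derivative:
  "(laguerre (Suc n) a has_real_derivative - laguerre n (a + 1) t) (at t)"
  using poly_DERIV[of "lag_poly (Suc n) a" t]
  by (simp add: pderiv_lag_poly poly_lag_poly)

text \<open>One step of the Rodrigues formula: t^a e^(-t) L_n with parameter a has derivative (n +
  1) t^(a-1) e^(-t) L_(n+1) with parameter a - 1. On coefficients it is the absorption rule for
  generalized binomials.\<close>

lemma lag_poly_raise:
  "pCons 0 (pderiv (lag_poly n a)) + smult a (lag_poly n a) - pCons 0 (lag_poly n a)
     = smult (real (Suc n)) (lag_poly (Suc n) (a - 1))"
proof (rule poly_eqI)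
  fix k
  have absorb: "real (Suc j) * (x gchoose Suc j) = (x - real j) * (x gchoose j)" for x j
    using gbinomial_absorb_comp[of x j] gbinomial_absorption[of j x] by simp
  show "coeff (pCons 0 (pderiv (lag_poly n a)) + smult a (lag_poly n a) - pCons 0 (lag_poly n a)) k
     = coeff (smult (real (Suc n)) (lag_poly (Suc n) (a - 1))) k"
  proof (cases k)
    case 0
    then show ?thesis using absorb[of n "real n + a"]
      by (simp add: coeff_lag_poly)
  next
    case (Suc j)
    consider "Suc j \<le> n" | "j = n" | "j > n" by linarith
    then show ?thesis
    proof cases
      case 1
      define m where "m = n - Suc j"
      have nj: "n - j = Suc m" "real n = real m + real j + 1" using 1 by (auto simp: m_def)
      have ab: "real (Suc m) * ((real n + a) gchoose Suc m) = (a + real j + 1) * ((real n + a) gchoose m)"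
        using absorb[of m "real n + a"] nj by (simp add: algebra_simps)
      have x: "real (Suc n) + (a - 1) = real n + a" by simp
      have c: "coeff (lag_poly n a) (Suc j) = (-1) ^ Suc j / fact (Suc j) * ((real n + a) gchoose m)"
        "coeff (lag_poly n a) j = - ((-1) ^ Suc j / fact (Suc j) * (real (Suc j) * ((real n + a) gchoose Suc m)))"
        "coeff (lag_poly (Suc n) (a - 1)) (Suc j) = (-1) ^ Suc j / fact (Suc j) * ((real n + a) gchoose Suc m)"
        using 1 nj unfolding coeff_lag_poly x by (simp_all add: m_def[symmetric] del: of_nat_Suc)
      have "coeff (pCons 0 (pderiv (lag_poly n a)) + smult a (lag_poly n a) - pCons 0 (lag_poly n a)) k
        = (-1) ^ Suc j / fact (Suc j) * ((a + real j + 1) * ((real n + a) gchoose m) + real (Suc j) * ((real n + a) gchoose Suc m))"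
        unfolding Suc coeff_diff coeff_add coeff_smult coeff_pCons_Suc coeff_pderiv c by (simp add: algebra_simps add_divide_distrib)
      also have "\<dots> = (-1) ^ Suc j / fact (Suc j) * (real (Suc n) * ((real n + a) gchoose Suc m))"
      proof -
        have "real (Suc n) = real (Suc m) + real (Suc j)" using nj by simp
        then show ?thesis unfolding ab[symmetric] by (simp only: distrib_right)
      qed
      also have "\<dots> = coeff (smult (real (Suc n)) (lag_poly (Suc n) (a - 1))) k"
        unfolding Suc coeff_smult c by simp
      finally show ?thesis .
    next
      case 2
      then show ?thesis using Suc by (simp add: coeff_lag_poly coeff_pderiv del: of_nat_Suc)
    next
      case 3
      then show ?thesis using Suc by (simp add: coeff_lag_poly coeff_pderiv)
    qed
  qed
qed

lemma laguerre_raise_0: "(a - t) * laguerre 0 a t = laguerre 1 (a - 1) t"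
  using arg_cong[OF lag_poly_raise[of 0 a], of "\<lambda>p. poly p t"]
  by (simp add: poly_lag_poly algebra_simps)

lemma laguerre_raise_Suc:
  "real (Suc (Suc n)) * laguerre (Suc (Suc n)) (a - 1) t
     = - t * laguerre n (a + 1) t + (a - t) * laguerre (Suc n) a t"
  using arg_cong[OF lag_poly_raise[of "Suc n" a], of "\<lambda>p. poly p t"]
  by (simp add: poly_lag_poly pderiv_lag_poly algebra_simps)

text \<open>Absorption again. Together with \<open>lag_poly_raise\<close> it yields the three-term
  recurrence behind Christoffel--Darboux, and on its own the splitting
  \<open>laguerre_fn_split\<close>.\<close>

lemma lag_poly_lower:
  "pCons 0 (lag_poly n (a + 1)) = smult (real n + 1 + a) (lag_poly n a) - smult (real (Suc n)) (lag_poly (Suc n) a)"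
proof (rule poly_eqI)
  fix k
  have absorb: "real (Suc j) * ((x + 1) gchoose Suc j) = (x + 1) * (x gchoose j)" for x j
    using gbinomial_absorption'[of "Suc j" "x + 1"] by (simp add: field_simps)
  consider "k \<le> n" | "k = Suc n" | "k > Suc n" by linarith
  then show "coeff (pCons 0 (lag_poly n (a + 1))) k
      = coeff (smult (real n + 1 + a) (lag_poly n a) - smult (real (Suc n)) (lag_poly (Suc n) a)) k"
  proof cases
    case 1
    define m where "m = n - k"
    have nk: "Suc n - k = Suc m" "real n = real m + real k" using 1 by (auto simp: m_def)
    have x: "real (Suc n) + a = (real n + a) + 1" by simp
    have c: "coeff (lag_poly n a) k = (-1) ^ k * ((real n + a) gchoose m) / fact k"
      "coeff (lag_poly (Suc n) a) k = (-1) ^ k * ((real n + a + 1) gchoose Suc m) / fact k"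
      using 1 nk by (simp_all only: coeff_lag_poly m_def[symmetric] x) auto
    have rhs: "coeff (smult (real n + 1 + a) (lag_poly n a) - smult (real (Suc n)) (lag_poly (Suc n) a)) k
      = (-1) ^ k / fact k * ((real n + a + 1) * ((real n + a) gchoose m) - real (Suc n) * ((real n + a + 1) gchoose Suc m))"
      unfolding coeff_diff coeff_smult c by (simp add: field_simps)
    also have "\<dots> = (-1) ^ k / fact k * ((real (Suc m) - real (Suc n)) * ((real n + a + 1) gchoose Suc m))"
      unfolding absorb[symmetric] by (simp add: algebra_simps)
    also have "\<dots> = coeff (pCons 0 (lag_poly n (a + 1))) k"
    proof (cases k)
      case 0
      then show ?thesis using nk by simp
    next
      case (Suc j)
      then have "n - j = Suc m" using 1 by (simp add: m_def)
      moreover have "real (Suc m) - real (Suc n) = - real (Suc j)" using nk Suc by simp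
      ultimately show ?thesis using Suc 1 by (simp add: coeff_lag_poly add.assoc del: of_nat_Suc)
    qed
    finally show ?thesis by simp
  next
    case 2
    then show ?thesis by (simp add: coeff_lag_poly divide_simps del: of_nat_Suc) 
  next
    case 3
    then obtain j where "k = Suc j" "j > n" by (cases k) auto
    then show ?thesis by (simp add: coeff_lag_poly)
  qed
qed

lemma laguerre_lower:
  "t * laguerre n (a + 1) t = (real n + 1 + a) * laguerre n a t - real (Suc n) * laguerre (Suc n) a t"
  using arg_cong[OF lag_poly_lower[of n a], of "\<lambda>p. poly p t"]
  by (simp add: poly_lag_poly)

text \<open>The multiplication theorem for Laguerre polynomials. The coefficient of each power u^i
  collapses, by trinomial revision, to a multiple of the binomial expansion of (l + (1 - l))^(n -
  i).\<close>

lemma lag_poly_scale: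
  "pcompose (lag_poly n a) [:0, l:] =
    (\<Sum>k\<le>n. smult (((real n + a) gchoose (n - k)) * l ^ k * (1 - l) ^ (n - k)) (lag_poly k a))"
proof (rule poly_eqI)
  fix i
  have comp: "coeff (pcompose p [:0, l:]) i = coeff p i * l ^ i" for p :: "real poly"
    by (induction p arbitrary: i) (auto simp: pcompose_pCons coeff_pCons split: nat.splits)
  \<comment> \<open>Trinomial revision: the two factors on the left are Pochhammer symbols, starting
    at k + a + 1 and at i + a + 1, and they join to a single one starting at i + a + 1.\<close>
  have bin: "((real n + a) gchoose (n - k)) * ((real k + a) gchoose (k - i))
       = ((real n + a) gchoose (n - i)) * real ((n - i) choose (k - i))" if "i \<le> k" "k \<le> n" for k
  proof -
    have "pochhammer (real i + a + 1) (n - i) =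
       pochhammer (real i + a + 1) (k - i) * pochhammer (real i + a + 1 + real (k - i)) (n - i - (k - i))"
      by (rule pochhammer_product) (use that in auto)
    moreover have "n - i - (k - i) = n - k" "real (k - i) = real k - real i" using that by auto
    moreover have "real ((n - i) choose (k - i)) = fact (n - i) / (fact (k - i) * fact (n - k))"
      using that by (subst binomial_fact) auto
    ultimately show ?thesis using that
      by (simp add: gbinomial_pochhammer' of_nat_diff field_simps)
  qed
  show "coeff (pcompose (lag_poly n a) [:0, l:]) i = coeff (\<Sum>k\<le>n. smult (((real n + a) gchoose (n - k)) * l ^ k * (1 - l) ^ (n - k)) (lag_poly k a)) i"
  proof (cases "i \<le> n")
    case False
    then show ?thesis by (auto simp: comp coeff_lag_poly coeff_sum intro!: sum.neutral)
  next
    case True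
    have "coeff (\<Sum>k\<le>n. smult (((real n + a) gchoose (n - k)) * l ^ k * (1 - l) ^ (n - k)) (lag_poly k a)) i
       = (\<Sum>k\<le>n. if i \<le> k then ((real n + a) gchoose (n - k)) * l ^ k * (1 - l) ^ (n - k) * ((-1) ^ i * ((real k + a) gchoose (k - i)) / fact i) else 0)"
      by (simp add: coeff_sum coeff_lag_poly if_distrib cong: if_cong)
    also have "\<dots> = (\<Sum>k=i..n. ((real n + a) gchoose (n - k)) * l ^ k * (1 - l) ^ (n - k) * ((-1) ^ i * ((real k + a) gchoose (k - i)) / fact i))"
      by (rule sum.mono_neutral_cong_right) auto
    also have "\<dots> = (\<Sum>k=i..n. (-1) ^ i * ((real n + a) gchoose (n - i)) / fact i * (real ((n - i) choose (k - i)) * l ^ k * (1 - l) ^ (n - k)))"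
    proof (rule sum.cong)
      fix k assume "k \<in> {i..n}"
      then show "((real n + a) gchoose (n - k)) * l ^ k * (1 - l) ^ (n - k) * ((-1) ^ i * ((real k + a) gchoose (k - i)) / fact i)
        = (-1) ^ i * ((real n + a) gchoose (n - i)) / fact i * (real ((n - i) choose (k - i)) * l ^ k * (1 - l) ^ (n - k))"
        using bin[of k] by (simp add: mult_ac)
    qed simp
    also have "\<dots> = (-1) ^ i * ((real n + a) gchoose (n - i)) / fact i * (\<Sum>k=i..n. real ((n - i) choose (k - i)) * l ^ k * (1 - l) ^ (n - k))"
      by (simp add: sum_distrib_left)
    also have "(\<Sum>k=i..n. real ((n - i) choose (k - i)) * l ^ k * (1 - l) ^ (n - k))
      = (\<Sum>j\<le>n - i. real ((n - i) choose j) * l ^ (j + i) * (1 - l) ^ (n - i - j))"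
      by (rule sum.reindex_bij_witness[of _ "\<lambda>j. j + i" "\<lambda>k. k - i"]) (use True in auto)
    also have "\<dots> = l ^ i * (l + (1 - l)) ^ (n - i)"
      by (subst binomial_ring) (simp add: sum_distrib_left power_add mult_ac)
    also have "\<dots> = l ^ i" by simp
    finally show ?thesis using True by (simp add: comp coeff_lag_poly)
  qed
qed

lemma laguerre_scale:
  "laguerre n a (l * u) = (\<Sum>k\<le>n. ((real n + a) gchoose (n - k)) * l ^ k * (1 - l) ^ (n - k) * laguerre k a u)"
  using arg_cong[OF lag_poly_scale[of n a l], of "\<lambda>p. poly p u"]
  by (simp add: poly_pcompose poly_sum poly_lag_poly mult.commute)

text \<open>The sum \<open>real n + b\<close> is the same for (n, b) and (n + 1, b - 1), so the
  Gamma factor stays, and the factor n + 1 from \<open>lag_poly_raise\<close> turns n! into (n +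
  1)!. In this normalization differentiation acts on the family without constants.\<close>

lemma laguerre_fn_has_real_derivative:
  assumes "t > 0"
  shows "(laguerre_fn n b has_real_derivative laguerre_fn (Suc n) (b - 1) t) (at t)"
proof -
  let ?p = "lag_poly n b"
  have raise: "t * poly (pderiv ?p) t + (b - t) * poly ?p t = real (Suc n) * laguerre (Suc n) (b - 1) t"
    using arg_cong[OF lag_poly_raise[of n b], of "\<lambda>p. poly p t"]
    by (simp add: poly_lag_poly algebra_simps)
  have "((\<lambda>t. c * t powr b * exp (- t) * poly ?p t) has_real_derivative
      c * (t powr (b - 1) * exp (- t) * (t * poly (pderiv ?p) t + (b - t) * poly ?p t))) (at t)" for c
    using assms
    by (auto intro!: derivative_eq_intros poly_DERIV simp: powr_diff field_simps)
  from this[of "fact n / Gamma (real n + b + 1)"] show ?thesis unfolding raise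
    by (simp add: laguerre_fn_def[abs_def] poly_lag_poly algebra_simps add_divide_distrib)
qed

text \<open>The kernel version of A^n (A+1)^(-n-a-1) = A^n (A+1)^(-n-a-2) + A^(n+1) (A+1)^(-n-a-2);
  it is what connects the kernels with the cogenerator.\<close>

lemma laguerre_fn_split:
  assumes "a > -1" "t > 0"
  shows "laguerre_fn n a t = laguerre_fn n (a + 1) t + laguerre_fn (Suc n) a t"
proof -
  have G: "Gamma (real n + a + 1 + 1) = (real n + a + 1) * Gamma (real n + a + 1)"
    using assms by (intro Gamma_plus1) (auto simp: nonpos_Ints_def)
  have pos: "Gamma (real n + a + 1) > 0" using assms by (intro Gamma_real_pos) auto
  have pos1: "real n + a + 1 > 0" using assms by auto
  have G1: "Gamma (real n + (a + 1) + 1) = (real n + a + 1) * Gamma (real n + a + 1)"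
    "Gamma (real (Suc n) + a + 1) = (real n + a + 1) * Gamma (real n + a + 1)"
    using G by (simp_all add: add_ac)
  have "laguerre_fn n (a + 1) t + laguerre_fn (Suc n) a t
    = fact n / ((real n + a + 1) * Gamma (real n + a + 1)) * t powr a * exp (- t) *
       (t * laguerre n (a + 1) t + real (Suc n) * laguerre (Suc n) a t)"
    using assms unfolding laguerre_fn_def G1 by (simp add: powr_add algebra_simps add_divide_distrib)
  also have "\<dots> = fact n / ((real n + a + 1) * Gamma (real n + a + 1)) * t powr a * exp (- t) * ((real n + a + 1) * laguerre n a t)"
    unfolding laguerre_lower by (simp add: algebra_simps)
  also have "\<dots> = laguerre_fn n a t" using pos1 unfolding laguerre_fn_def by (simp add: divide_simps)
  finally show ?thesis by simp
qed

text \<open>The usual kernel has L_(N+1) of parameter a. Passing to a - 1 subtracts L_N(t) L_N(s)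
  from both products, so their difference is the same. In this form
  \<open>laguerre_raise_Suc\<close> can absorb the growing factor N + 1.\<close>

lemma christoffel_darboux:
  assumes a: "a > -1"
  shows "(t - s) * (\<Sum>n\<le>N. fact n / Gamma (real n + a + 1) * laguerre n a t * laguerre n a s)
    = fact (Suc N) / Gamma (real N + a + 1) *
       (laguerre N a t * laguerre (Suc N) (a - 1) s - laguerre (Suc N) (a - 1) t * laguerre N a s)"
proof -
  have diff: "laguerre (Suc N) (a - 1) t = laguerre (Suc N) a t - laguerre N a t" for N t
    using laguerre_Suc_diff[of N "a - 1" t] by simp
  \<comment> \<open>Eliminating t L_n of parameter a + 1 between \<open>laguerre_raise_Suc\<close>
    and \<open>laguerre_lower\<close> leaves the three-term recurrence within a single
    parameter.\<close>
  have rec: "real (Suc (Suc n)) * laguerre (Suc (Suc n)) a t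
     = (2 * real n + 3 + a - t) * laguerre (Suc n) a t - (real n + 1 + a) * laguerre n a t" for n t
    using laguerre_raise_Suc[of n a t] laguerre_lower[of t n a] unfolding diff by (simp add: algebra_simps)
  have "(t - s) * (\<Sum>n\<le>N. fact n / Gamma (real n + a + 1) * laguerre n a t * laguerre n a s)
    = fact (Suc N) / Gamma (real N + a + 1) *
       (laguerre N a t * laguerre (Suc N) a s - laguerre (Suc N) a t * laguerre N a s)"
  proof (induction N)
    case 0
    have l1: "laguerre (Suc 0) a t = 1 + a - t" for t
      using laguerre_raise_0[of a t] diff[of 0 t] by simp
    show ?case unfolding l1 by simp
  next
    case (Suc N)
    define g where "g = Gamma (real N + a + 1)"
    have pos1: "real N + a + 1 > 0" using assms by auto
    have g: "g > 0" unfolding g_def using pos1 by (intro Gamma_real_pos) auto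
    have G: "Gamma (real (Suc N) + a + 1) = (real N + a + 1) * g"
      using Gamma_plus1[of "real N + a + 1"] pos1 by (auto simp: g_def add_ac nonpos_Ints_def)
    let ?x = "laguerre N a t" and ?y = "laguerre (Suc N) a t" and ?z = "laguerre (Suc (Suc N)) a t"
    let ?x' = "laguerre N a s" and ?y' = "laguerre (Suc N) a s" and ?z' = "laguerre (Suc (Suc N)) a s"
    have "(real N + a + 1) * (?x * ?y' - ?y * ?x') + (t - s) * ?y * ?y' = ?y * (real (Suc (Suc N)) * ?z') - (real (Suc (Suc N)) * ?z) * ?y'"
      unfolding rec by (simp add: algebra_simps)
    then have key: "(real N + a + 1) * (?x * ?y' - ?y * ?x') + (t - s) * ?y * ?y' = real (Suc (Suc N)) * (?y * ?z' - ?z * ?y')"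
      by (simp add: algebra_simps)
    have "(t - s) * (\<Sum>n\<le>Suc N. fact n / Gamma (real n + a + 1) * laguerre n a t * laguerre n a s)
       = fact (Suc N) / g * (?x * ?y' - ?y * ?x') + (t - s) * (fact (Suc N) / ((real N + a + 1) * g) * ?y * ?y')"
      unfolding sum.atMost_Suc distrib_left Suc.IH G[symmetric] by (simp add: g_def)
    also have "\<dots> = fact (Suc N) / ((real N + a + 1) * g) * ((real N + a + 1) * (?x * ?y' - ?y * ?x') + (t - s) * ?y * ?y')"
      using pos1 g by (simp add: divide_simps) (simp add: algebra_simps)
    also have "\<dots> = fact (Suc (Suc N)) / ((real N + a + 1) * g) * (?y * ?z' - ?z * ?y')"
      unfolding key by simp
    finally show ?case unfolding G .
  qed
  then show ?thesis unfolding diff by (simp add: algebra_simps)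
qed

section \<open>Orthogonality and weighted square bounds\<close>

lemma has_integral_powr_exp:
  fixes b c :: real
  assumes "b > -1" "c > 0"
  shows "((\<lambda>t. t powr b * exp (- c * t)) has_integral Gamma (b + 1) / c powr (b + 1)) {0<..}"
proof -
  have "((\<lambda>t. t powr b / exp t) has_integral Gamma (b + 1)) {0..}"
    using Gamma_integral_real[of "b + 1"] assms by simp
  also have "?this \<longleftrightarrow> ((\<lambda>t. t powr b / exp t) has_integral Gamma (b + 1)) {0<..}"
    by (rule has_integral_spike_set_eq) (auto intro: negligible_subset[of "{0::real}"])
  finally have "((\<lambda>t. t powr b / exp t) has_integral Gamma (b + 1)) {0<..}" .
  from has_integral_stretch_halfline[OF this assms(2)]
  have "((\<lambda>t. (c * t) powr b / exp (c * t)) has_integral Gamma (b + 1) / c) {0<..}" by simp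
  then have "((\<lambda>t. c powr (- b) * ((c * t) powr b / exp (c * t))) has_integral c powr (- b) * (Gamma (b + 1) / c)) {0<..}"
    by (rule has_integral_mult_right)
  moreover have "c powr (- b) * (Gamma (b + 1) / c) = Gamma (b + 1) / c powr (b + 1)"
    using assms by (simp add: powr_add powr_minus field_simps)
  moreover have "((\<lambda>t. c powr (- b) * ((c * t) powr b / exp (c * t))) has_integral I) {0<..} \<longleftrightarrow>
      ((\<lambda>t. t powr b * exp (- c * t)) has_integral I) {0<..}" for I
    by (rule has_integral_cong) (use assms in \<open>auto simp: powr_mult powr_minus exp_minus field_simps\<close>)
  ultimately show ?thesis by simp
qed

lemma integrable_powr_exp:
  fixes b c :: real
  assumes "b > -1" "c > 0"
  shows "(\<lambda>t. t powr b * exp (- c * t)) integrable_on {0<..}"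
  using has_integral_powr_exp[OF assms] by (rule has_integral_integrable)

lemma powr_exp_poly:
  assumes "t > 0"
  shows "t powr b * exp (- c * t) * poly p t = (\<Sum>i\<le>degree p. coeff p i * (t powr (b + real i) * exp (- c * t)))"
  using assms by (simp add: poly_altdef powr_add powr_realpow sum_distrib_left sum_distrib_right mult_ac)

lemma continuous_powr_exp_poly [continuous_intros]:
  "continuous_on {0<..} (\<lambda>t. t powr b * exp (- c * t) * poly p t)" for c :: real
  by (intro continuous_intros) auto

lemma integrable_powr_exp_abs_poly:
  fixes b c :: real
  assumes "b > -1" "c > 0"
  shows "(\<lambda>t. t powr b * exp (- c * t) * \<bar>poly p t\<bar>) integrable_on {0<..}"
proof (rule dominated_integrable_halfline)
  show "continuous_on {0<..} (\<lambda>t. t powr b * exp (- c * t) * \<bar>poly p t\<bar>)"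
    by (intro continuous_intros) auto
  show "(\<lambda>t. \<Sum>i\<le>degree p. \<bar>coeff p i\<bar> * (t powr (b + real i) * exp (- c * t))) integrable_on {0<..}"
  proof (rule integrable_sum)
    fix i
    show "(\<lambda>t. \<bar>coeff p i\<bar> * (t powr (b + real i) * exp (- c * t))) integrable_on {0<..}"
      using assms by (intro integrable_on_mult_right integrable_powr_exp) auto
  qed simp
  fix t :: real assume t: "t > 0"
  have "norm (t powr b * exp (- c * t) * \<bar>poly p t\<bar>) = \<bar>t powr b * exp (- c * t) * poly p t\<bar>"
    by (simp add: abs_mult)
  also have "\<dots> \<le> (\<Sum>i\<le>degree p. \<bar>coeff p i * (t powr (b + real i) * exp (- c * t))\<bar>)"
    unfolding powr_exp_poly[OF t] by (rule sum_abs)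
  finally show "norm (t powr b * exp (- c * t) * \<bar>poly p t\<bar>)
      \<le> (\<Sum>i\<le>degree p. \<bar>coeff p i\<bar> * (t powr (b + real i) * exp (- c * t)))"
    by (simp add: abs_mult)
qed

lemma integrable_powr_exp_poly:
  fixes b c :: real
  assumes "b > -1" "c > 0"
  shows "(\<lambda>t. t powr b * exp (- c * t) * poly p t) integrable_on {0<..}"
  by (rule dominated_integrable_halfline[OF continuous_powr_exp_poly integrable_powr_exp_abs_poly[OF assms, of p]])
     (simp add: abs_mult)

lemma powr_exp_poly_tendsto_0:
  fixes b c :: real
  assumes "b > 0" "c > 0"
  shows "((\<lambda>t. t powr b * exp (- c * t) * poly p t) \<longlongrightarrow> 0) (at_right 0)"
proof -
  have "((\<lambda>t. \<Sum>i\<le>degree p. coeff p i * (t powr (b + real i) * exp (- c * t))) \<longlongrightarrow> (\<Sum>i\<le>degree p. coeff p i * 0)) (at_right 0)"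
  proof (intro tendsto_intros)
    fix i
    have "b + real i > 0" using assms by simp
    then show "((\<lambda>t. t powr (b + real i) * exp (- c * t)) \<longlongrightarrow> 0) (at_right 0)"
      using assms by real_asymp
  qed
  then have "((\<lambda>t. \<Sum>i\<le>degree p. coeff p i * (t powr (b + real i) * exp (- c * t))) \<longlongrightarrow> 0) (at_right 0)"
    by simp
  then show ?thesis
    by (rule Lim_transform_eventually)
       (rule eventually_mono[OF eventually_at_right_less[of 0]], simp only: powr_exp_poly)
qed

lemma powr_exp_poly_tendsto_top:
  fixes b c :: real
  assumes "c > 0"
  shows "((\<lambda>t. t powr b * exp (- c * t) * poly p t) \<longlongrightarrow> 0) at_top"
proof -
  have "((\<lambda>t. \<Sum>i\<le>degree p. coeff p i * (t powr (b + real i) * exp (- c * t))) \<longlongrightarrow> (\<Sum>i\<le>degree p. coeff p i * 0)) at_top"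
  proof (intro tendsto_intros)
    fix i
    show "((\<lambda>t. t powr (b + real i) * exp (- c * t)) \<longlongrightarrow> 0) at_top"
      using assms by real_asymp
  qed
  then have "((\<lambda>t. \<Sum>i\<le>degree p. coeff p i * (t powr (b + real i) * exp (- c * t))) \<longlongrightarrow> 0) at_top"
    by simp
  then show ?thesis
    by (rule Lim_transform_eventually)
       (rule eventually_mono[OF eventually_gt_at_top[of 0]], simp only: powr_exp_poly)
qed

lemma laguerre_fn_poly:
  "laguerre_fn n a t = fact n / Gamma (real n + a + 1) * (t powr a * exp (- 1 * t) * poly (lag_poly n a) t)"
  by (simp add: laguerre_fn_def poly_lag_poly)

lemma laguerre_fn_mult_poly:
  "laguerre_fn n a t * poly p t = fact n / Gamma (real n + a + 1) * (t powr a * exp (- 1 * t) * poly (lag_poly n a * p) t)"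
  by (simp add: laguerre_fn_def poly_lag_poly)

lemma continuous_laguerre_fn [continuous_intros]: "continuous_on {0<..} (laguerre_fn n a)"
  unfolding laguerre_fn_poly[abs_def] by (intro continuous_intros) auto

lemma laguerre_fn_mult_poly_tendsto_0:
  assumes "a > 0"
  shows "((\<lambda>t. laguerre_fn n a t * poly p t) \<longlongrightarrow> 0) (at_right 0)"
  using tendsto_mult_right_zero[OF powr_exp_poly_tendsto_0[OF assms zero_less_one]]
  unfolding laguerre_fn_mult_poly .

lemma laguerre_fn_mult_poly_tendsto_top:
  "((\<lambda>t. laguerre_fn n a t * poly p t) \<longlongrightarrow> 0) at_top"
  using tendsto_mult_right_zero[OF powr_exp_poly_tendsto_top[OF zero_less_one]]
  unfolding laguerre_fn_mult_poly .

lemma integrable_abs_laguerre_fn: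
  assumes "a > -1"
  shows "(\<lambda>t. \<bar>laguerre_fn n a t\<bar>) integrable_on {0<..}"
proof -
  have "(\<lambda>t. \<bar>fact n / Gamma (real n + a + 1)\<bar> * (t powr a * exp (- 1 * t) * \<bar>poly (lag_poly n a) t\<bar>)) integrable_on {0<..}"
    by (intro integrable_on_mult_right integrable_powr_exp_abs_poly assms) simp
  then show ?thesis by (simp add: laguerre_fn_poly abs_mult)
qed

text \<open>\<open>laguerre_fn (Suc k) a\<close> is the derivative of
  \<open>laguerre_fn k (a + 1)\<close>, and L_j differentiates to -L_(j-1) with parameter a + 1.
  Integration by parts thus lowers both indices and raises the parameter, hence the generalization
  over \<open>a\<close> and \<open>j\<close>.\<close>

lemma laguerre_orthogonal:
  assumes "a > -1"
  shows "((\<lambda>t. laguerre_fn k a t * laguerre j a t) has_integral (if k = j then 1 else 0)) {0<..}"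
  using assms
proof (induction k arbitrary: a j)
  case (Suc k)
  show ?case
  proof (cases j)
    case 0
    have "((\<lambda>t. laguerre_fn (Suc k) a t) has_integral (0 - 0)) {0<..}"
    proof (rule FTC_halfline[where F = "laguerre_fn k (a + 1)"])
      fix t :: real assume "t > 0"
      from laguerre_fn_has_real_derivative[OF this, of k "a + 1"]
      show "(laguerre_fn k (a + 1) has_vector_derivative laguerre_fn (Suc k) a t) (at t)"
        by (simp add: has_real_derivative_iff_has_vector_derivative)
    qed (use laguerre_fn_mult_poly_tendsto_0[of "a + 1" k 1] laguerre_fn_mult_poly_tendsto_top[of k "a + 1" 1] Suc.prems in auto)
    then show ?thesis using 0 by simp
  next
    case (Suc i)
    have "((\<lambda>t. laguerre_fn (Suc k) a t * laguerre (Suc i) a t - laguerre_fn k (a + 1) t * laguerre i (a + 1) t)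
       has_integral (0 - 0)) {0<..}"
    proof (rule FTC_halfline[where F = "\<lambda>t. laguerre_fn k (a + 1) t * laguerre (Suc i) a t"])
      fix t :: real assume "t > 0"
      from laguerre_fn_has_real_derivative[OF this, of k "a + 1"]
      have "(laguerre_fn k (a + 1) has_real_derivative laguerre_fn (Suc k) a t) (at t)" by simp
      from DERIV_mult[OF this laguerre_has_real_derivative[of i a t]]
      show "((\<lambda>t. laguerre_fn k (a + 1) t * laguerre (Suc i) a t) has_vector_derivative
          laguerre_fn (Suc k) a t * laguerre (Suc i) a t - laguerre_fn k (a + 1) t * laguerre i (a + 1) t) (at t)"
        by (simp add: has_real_derivative_iff_has_vector_derivative[symmetric] mult.commute)
    qed (use laguerre_fn_mult_poly_tendsto_0[of "a + 1" k] laguerre_fn_mult_poly_tendsto_top[of k "a + 1"] Suc.prems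
          in \<open>auto simp flip: poly_lag_poly\<close>)
    from has_integral_add[OF this Suc.IH[of "a + 1" i]] show ?thesis
      using Suc Suc.prems by simp
  qed
next
  case (0 a j)
  have G: "Gamma (a + 1) > 0" using 0 by (intro Gamma_real_pos) auto
  show ?case
  proof (cases j)
    case 0
    have "((\<lambda>t. 1 / Gamma (a + 1) * (t powr a * exp (- 1 * t))) has_integral 1 / Gamma (a + 1) * (Gamma (a + 1) / 1 powr (a + 1))) {0<..}"
      by (intro has_integral_mult_right has_integral_powr_exp \<open>a > -1\<close>) simp
    then show ?thesis using 0 G by (simp add: laguerre_fn_def)
  next
    case (Suc i)
    have G2: "Gamma (real (Suc i) + a + 1) > 0" using \<open>a > -1\<close> by (intro Gamma_real_pos) auto
    \<comment> \<open>For k = 0 the roles are exchanged: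
      \<open>laguerre_fn 0 a t * laguerre (Suc i) a t\<close> is a constant multiple of
      \<open>laguerre_fn (Suc i) a t\<close>, an exact derivative with vanishing boundary
      values.\<close>
    have "((\<lambda>t. laguerre_fn (Suc i) a t) has_integral (0 - 0)) {0<..}"
    proof (rule FTC_halfline[where F = "laguerre_fn i (a + 1)"])
      fix t :: real assume "t > 0"
      from laguerre_fn_has_real_derivative[OF this, of i "a + 1"]
      show "(laguerre_fn i (a + 1) has_vector_derivative laguerre_fn (Suc i) a t) (at t)"
        by (simp add: has_real_derivative_iff_has_vector_derivative)
    qed (use laguerre_fn_mult_poly_tendsto_0[of "a + 1" i 1] laguerre_fn_mult_poly_tendsto_top[of i "a + 1" 1] \<open>a > -1\<close> in auto)
    from has_integral_mult_right[OF this, of "Gamma (real (Suc i) + a + 1) / (fact (Suc i) * Gamma (a + 1))"]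
    have "((\<lambda>t. Gamma (real (Suc i) + a + 1) / (fact (Suc i) * Gamma (a + 1)) * laguerre_fn (Suc i) a t) has_integral 0) {0<..}"
      by simp
    moreover have "Gamma (real (Suc i) + a + 1) / (fact (Suc i) * Gamma (a + 1)) * laguerre_fn (Suc i) a t
      = laguerre_fn 0 a t * laguerre j a t" for t
      using G2 G unfolding laguerre_fn_def Suc by (simp add: divide_simps del: fact_Suc of_nat_Suc)
    ultimately show ?thesis using Suc by simp
  qed
qed

text \<open>The squared norm of \<open>laguerre n a\<close> for the weight t^a e^(-t); it grows like
  n^a.\<close>

definition lag_norm :: "nat \<Rightarrow> real \<Rightarrow> real" where
  "lag_norm n a = Gamma (real n + a + 1) / fact n"

lemma lag_norm_pos: "a > -1 \<Longrightarrow> lag_norm n a > 0"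
  unfolding lag_norm_def by (intro divide_pos_pos Gamma_real_pos) auto

lemma laguerre_fn_eq: "laguerre_fn n a t = t powr a * exp (- t) * laguerre n a t / lag_norm n a"
  by (simp add: laguerre_fn_def lag_norm_def)

lemma laguerre_orthogonal':
  assumes "a > -1"
  shows "((\<lambda>t. t powr a * exp (- t) * laguerre k a t * laguerre j a t) has_integral (if k = j then lag_norm k a else 0)) {0<..}"
proof -
  have "((\<lambda>t. lag_norm k a * (laguerre_fn k a t * laguerre j a t)) has_integral lag_norm k a * (if k = j then 1 else 0)) {0<..}"
    by (intro has_integral_mult_right laguerre_orthogonal assms)
  moreover have "lag_norm k a * (laguerre_fn k a t * laguerre j a t) = t powr a * exp (- t) * laguerre k a t * laguerre j a t" for t
    using lag_norm_pos[OF assms, of k] by (simp add: laguerre_fn_eq)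
  ultimately show ?thesis by (simp only:) (simp split: if_splits)
qed

text \<open>Rewrites the coefficients of the rescaling formula with ordinary binomial coefficients,
  so that bounds on binomial probabilities apply. The price is a ratio of norms, controlled by
  powers of (n+1)/(k+1).\<close>

lemma gchoose_eq_lag_norm:
  assumes "a > -1" "k \<le> n"
  shows "(real n + a) gchoose (n - k) = real (n choose k) * lag_norm n a / lag_norm k a"
proof -
  have pos: "real k + a + 1 > 0" using assms by simp
  then have "pochhammer (real k + a + 1) (n - k) = Gamma (real k + a + 1 + real (n - k)) / Gamma (real k + a + 1)"
    by (intro pochhammer_Gamma) (auto simp: nonpos_Ints_def)
  then have "pochhammer (real k + a + 1) (n - k) = Gamma (real n + a + 1) / Gamma (real k + a + 1)"
    using assms by (simp add: of_nat_diff algebra_simps)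
  moreover have "(real n + a) gchoose (n - k) = pochhammer (real k + a + 1) (n - k) / fact (n - k)"
    using assms by (simp add: gbinomial_pochhammer' of_nat_diff add.commute)
  moreover have "Gamma (real k + a + 1) > 0" using pos by (intro Gamma_real_pos)
  ultimately show ?thesis
    using assms by (simp add: lag_norm_def binomial_fact[of k n, where 'a=real])
qed

section \<open>Binomial weights: maximum and negative moments\<close>

lemma central_binomial_bound: "real ((2 * i) choose i) ^ 2 * (2 * real i + 1) \<le> 16 ^ i"
proof (induction i)
  case (Suc i)
  let ?c = "real ((2 * i) choose i)" and ?d = "real ((2 * Suc i) choose (Suc i))"
  have rec: "real (Suc i) * ?d = 2 * (2 * real i + 1) * ?c"
  proof -
    have "Suc i * ((2 * Suc i) choose (Suc i)) = (2 * Suc i) * ((2 * i + 1) choose i)"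
      using Suc_times_binomial_eq[of "2 * i + 1" i] by (simp add: algebra_simps)
    moreover have "Suc i * ((2 * i + 1) choose i) = (2 * i + 1) * ((2 * i) choose i)"
      using binomial_absorb_comp[of "2 * i + 1" i] by simp
    ultimately have "Suc i * (Suc i * ((2 * Suc i) choose (Suc i))) = (2 * Suc i) * ((2 * i + 1) * ((2 * i) choose i))"
      by (metis mult.left_commute)
    then have "Suc i * ((2 * Suc i) choose (Suc i)) = 2 * ((2 * i + 1) * ((2 * i) choose i))"
      by (simp only: mult.assoc mult.left_commute[of 2 "Suc i"] mult_cancel1) simp
    then have "real (Suc i * ((2 * Suc i) choose (Suc i))) = real (2 * ((2 * i + 1) * ((2 * i) choose i)))"
      by (rule arg_cong)
    then show ?thesis by (simp only: of_nat_mult of_nat_add of_nat_numeral of_nat_1 mult.assoc)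
  qed
  have "real (Suc i) ^ 2 * (?d ^ 2 * (2 * real (Suc i) + 1)) = (real (Suc i) * ?d) ^ 2 * (2 * real (Suc i) + 1)"
    by (simp add: power_mult_distrib)
  also have "\<dots> = 4 * ((2 * real i + 1) * (2 * real i + 3)) * (?c ^ 2 * (2 * real i + 1))"
    unfolding rec by (simp add: power2_eq_square algebra_simps)
  \<comment> \<open>The factor 2i + 1 in the claim is what closes the induction: (2i + 1)(2i + 3) is
    at most (2i + 2)^2, so the left-hand side divided by 16^i never increases.\<close>
  also have "\<dots> \<le> 4 * (4 * real (Suc i) ^ 2) * 16 ^ i"
  proof -
    have "(2 * real i + 1) * (2 * real i + 3) \<le> 4 * real (Suc i) ^ 2"
      by (simp add: power2_eq_square algebra_simps)
    then have "4 * ((2 * real i + 1) * (2 * real i + 3)) \<le> 4 * (4 * real (Suc i) ^ 2)" by simp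
    from mult_mono[OF this Suc.IH] show ?thesis by simp
  qed
  also have "\<dots> = real (Suc i) ^ 2 * 16 ^ Suc i" by simp
  finally show ?case by (subst (asm) mult_le_cancel_left_pos) auto
qed simp

lemma binomial_half_bound: "real (m choose j) / 2 ^ m \<le> 1 / sqrt (real m + 1)"
proof -
  have "real (m choose j) ^ 2 * (real m + 1) \<le> 4 ^ m"
  proof (cases "even m")
    case True
    then obtain i where i: "m = 2 * i" by blast
    have "real (m choose j) \<le> real (m choose i)" using binomial_maximum[of m j] i by simp
    then have "real (m choose j) ^ 2 * (real m + 1) \<le> real (m choose i) ^ 2 * (real m + 1)"
      by (intro mult_right_mono power_mono) auto
    also have "\<dots> \<le> 16 ^ i" using central_binomial_bound[of i] i by simp
    also have "\<dots> = 4 ^ m" unfolding i power_mult by simp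
    finally show ?thesis .
  next
    case False
    then obtain i where i: "m = 2 * i + 1" using oddE by blast
    have "real (m choose j) \<le> real (m choose i)" using binomial_maximum[of m j] i by simp
    \<comment> \<open>An odd row has two equal central entries whose sum is the central entry of the
      next row; this reduces the odd case to \<open>central_binomial_bound\<close>.\<close>
    moreover have "2 * real (m choose i) = real ((2 * Suc i) choose Suc i)"
    proof -
      have "Suc i * ((2 * Suc i) choose (Suc i)) = (2 * Suc i) * (m choose i)"
        using Suc_times_binomial_eq[of "2 * i + 1" i] i by (simp add: algebra_simps)
      then have "(2 * Suc i) choose (Suc i) = 2 * (m choose i)"
        by (simp only: mult.assoc mult.left_commute[of 2 "Suc i"] mult_cancel1) simp
      then show ?thesis by simp
    qed
    ultimately have "2 * real (m choose j) \<le> real ((2 * Suc i) choose Suc i)" by linarith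
    then have "(2 * real (m choose j)) ^ 2 * (2 * real (Suc i) + 1) \<le> real ((2 * Suc i) choose Suc i) ^ 2 * (2 * real (Suc i) + 1)"
      by (intro mult_right_mono power_mono) auto
    also have "\<dots> \<le> 16 ^ Suc i" by (rule central_binomial_bound)
    also have "16 ^ Suc i = (4::real) * 4 ^ m" unfolding i by (simp add: power_mult)
    finally have "real (m choose j) ^ 2 * (2 * real (Suc i) + 1) \<le> 4 ^ m" by simp
    moreover have "real (m choose j) ^ 2 * (real m + 1) \<le> real (m choose j) ^ 2 * (2 * real (Suc i) + 1)"
      using i by (intro mult_left_mono) auto
    ultimately show ?thesis by linarith
  qed
  then have "sqrt (real (m choose j) ^ 2 * (real m + 1)) \<le> sqrt (4 ^ m)" by (rule real_sqrt_le_mono)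
  moreover have "sqrt (4 ^ m) = 2 ^ m" by (simp add: real_sqrt_power)
  ultimately have "real (m choose j) * sqrt (real m + 1) \<le> 2 ^ m"
    by (simp add: real_sqrt_mult)
  then show ?thesis by (simp add: field_simps)
qed

text \<open>A binomial variable with parameter 3/4 is a mixture of shifted binomial variables with parameter 1/2.\<close>
lemma binomial_three_quarters_mixture:
  assumes "k \<le> n"
  shows "real (n choose k) * (3/4) ^ k * (1/4) ^ (n - k)
     = (\<Sum>m\<le>n. real (n choose m) / 2 ^ n * (real (m choose (n - k)) / 2 ^ m))"
proof -
  define j where "j = n - k"
  have j: "j \<le> n" "n - j = k" "n choose k = n choose j" using assms by (auto simp: j_def binomial_symmetric[of k n])
  have "(\<Sum>m\<le>n. real (n choose m) / 2 ^ n * (real (m choose j) / 2 ^ m))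
     = (\<Sum>m=j..n. real (n choose m) / 2 ^ n * (real (m choose j) / 2 ^ m))"
    by (rule sum.mono_neutral_right) (auto simp: binomial_eq_0)
  also have "\<dots> = (\<Sum>m=j..n. real (n choose j) / 2 ^ n * (real (k choose (m - j)) / 2 ^ m))"
  proof (rule sum.cong)
    fix m assume "m \<in> {j..n}"
    then have "(n choose m) * (m choose j) = (n choose j) * (k choose (m - j))"
      using choose_mult[of j m n] j by simp
    then have "real (n choose m) * real (m choose j) = real (n choose j) * real (k choose (m - j))"
      by (metis of_nat_mult)
    then show "real (n choose m) / 2 ^ n * (real (m choose j) / 2 ^ m) = real (n choose j) / 2 ^ n * (real (k choose (m - j)) / 2 ^ m)"
      by (simp add: field_simps)
  qed simp
  also have "\<dots> = (\<Sum>i\<le>k. real (n choose j) / 2 ^ n * (real (k choose i) / 2 ^ (i + j)))"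
    by (rule sum.reindex_bij_witness[of _ "\<lambda>i. i + j" "\<lambda>m. m - j"]) (use j in auto)
  also have "\<dots> = real (n choose j) / 2 ^ n / 2 ^ j * (\<Sum>i\<le>k. real (k choose i) * (1/2) ^ i * 1 ^ (k - i))"
    by (simp add: sum_distrib_left power_add field_simps)
  also have "(\<Sum>i\<le>k. real (k choose i) * (1/2) ^ i * 1 ^ (k - i)) = (1/2 + 1) ^ k"
    by (subst binomial_ring) simp
  also have "real (n choose j) / 2 ^ n / 2 ^ j * (1/2 + 1) ^ k = real (n choose k) * (3/4) ^ k * (1/4) ^ j"
  proof -
    have n: "n = k + j" using assms by (simp add: j_def)
    have "(4::real) ^ i = 2 ^ i * 2 ^ i" for i
      using power_mult_distrib[of "2::real" 2 i] by simp
    then show ?thesis unfolding j(3) by (simp add: n power_add power_divide field_simps)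
  qed
  finally show ?thesis unfolding j_def by simp
qed

text \<open>Averages \<open>binomial_half_bound\<close> over the mixture. With s = sqrt (n + 1), the
  quantity 1/sqrt (m + 1) is first replaced by the larger (1/s + s/(m + 1))/2, because the mean of
  1/(m + 1) can be computed. The constant is 1/2 + 1.\<close>

lemma binomial_three_quarters_bound:
  assumes "k \<le> n"
  shows "real (n choose k) * (3/4) ^ k * (1/4) ^ (n - k) \<le> 3/2 / sqrt (real n + 1)"
proof -
  define s where "s = sqrt (real n + 1)"
  have s: "s > 0" "s ^ 2 = real n + 1" by (auto simp: s_def)
  have sum1: "(\<Sum>m\<le>n. real (n choose m) / 2 ^ n) = 1"
    using choose_row_sum[of n] by (simp flip: sum_divide_distrib of_nat_sum)
  have sum2: "(\<Sum>m\<le>n. real (n choose m) / 2 ^ n / (real m + 1)) \<le> 2 / (real n + 1)"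
  proof -
    \<comment> \<open>The denominator m + 1 is absorbed into the binomial coefficient, moving to row
      n + 1, whose sum 2^(n+1) accounts for the factor 2.\<close>
    have "real (n choose m) / (real m + 1) = real (Suc n choose Suc m) / (real n + 1)" for m
    proof -
      have "real (Suc m * (Suc n choose Suc m)) = real (Suc n * (n choose m))"
        using Suc_times_binomial_eq[of n m] by (metis mult.commute)
      then show ?thesis by (simp add: field_simps del: binomial_Suc_Suc)
    qed
    then have "(\<Sum>m\<le>n. real (n choose m) / (real m + 1) / 2 ^ n) = (\<Sum>m\<le>n. real (Suc n choose Suc m) / (real n + 1) / 2 ^ n)"
      by (simp only:)
    then have "(\<Sum>m\<le>n. real (n choose m) / 2 ^ n / (real m + 1)) = (\<Sum>m\<le>n. real (Suc n choose Suc m)) / (2 ^ n * (real n + 1))"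
      by (simp only: sum_divide_distrib divide_divide_eq_left mult.commute)
    also have "(\<Sum>m\<le>n. real (Suc n choose Suc m)) \<le> (\<Sum>m\<le>Suc n. real (Suc n choose m))"
      using sum.atMost_Suc_shift[of "\<lambda>m. real (Suc n choose m)" n] by (simp del: binomial_Suc_Suc)
    also have "(\<Sum>m\<le>Suc n. real (Suc n choose m)) = 2 ^ Suc n"
      using choose_row_sum[of "Suc n"] by (simp only: flip: of_nat_sum) simp
    finally show ?thesis by (simp add: divide_right_mono)
  qed
  have "real (n choose k) * (3/4) ^ k * (1/4) ^ (n - k)
     = (\<Sum>m\<le>n. real (n choose m) / 2 ^ n * (real (m choose (n - k)) / 2 ^ m))"
    by (rule binomial_three_quarters_mixture[OF assms])
  also have "\<dots> \<le> (\<Sum>m\<le>n. real (n choose m) / 2 ^ n * (1/2 * (1 / s + s / (real m + 1))))"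
  proof (intro sum_mono mult_left_mono)
    fix m
    define r where "r = sqrt (real m + 1)"
    have r: "r > 0" "r ^ 2 = real m + 1" by (auto simp: r_def)
    have "0 \<le> (r - s) ^ 2 / (2 * s * r ^ 2)" using r s by simp
    also have "\<dots> = 1/2 * (1 / s + s / r ^ 2) - 1 / r"
      using r(1) s(1) by (simp add: field_simps power2_eq_square)
    finally have "1 / r \<le> 1/2 * (1 / s + s / r ^ 2)" by simp
    moreover have "real (m choose (n - k)) / 2 ^ m \<le> 1 / r" unfolding r_def by (rule binomial_half_bound)
    ultimately show "real (m choose (n - k)) / 2 ^ m \<le> 1/2 * (1 / s + s / (real m + 1))"
      unfolding r(2) by linarith
  qed auto
  also have "\<dots> = 1/2 * (1 / s) * (\<Sum>m\<le>n. real (n choose m) / 2 ^ n) + 1/2 * s * (\<Sum>m\<le>n. real (n choose m) / 2 ^ n / (real m + 1))"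
    by (simp add: sum_distrib_left sum.distrib[symmetric] algebra_simps)
  also have "\<dots> \<le> 1/2 * (1 / s) * 1 + 1/2 * s * (2 / (real n + 1))"
    unfolding sum1 using s by (intro add_left_mono mult_left_mono sum2) auto
  also have "\<dots> = 3/2 / s" unfolding s(2)[symmetric] using s(1) by (simp add: field_simps power2_eq_square)
  finally show ?thesis unfolding s_def .
qed

text \<open>Absorption turns one factor (n+1)/(k+1) into a step to row n + 1 and entry k + 1, so the
  induction on m must hold for all rows with one constant. The factor 4/3 compensates for one extra
  power of 3/4, and 2^m comes from k + 2 <= 2 (k + 1).\<close>

lemma binomial_moment_bound:
  "\<exists>C. \<forall>n. (\<Sum>k\<le>n. real (n choose k) * (3/4) ^ k * (1/4) ^ (n - k) * ((real n + 1) / (real k + 1)) ^ m) \<le> C"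
proof (induction m)
  case 0
  have "(\<Sum>k\<le>n. real (n choose k) * (3/4) ^ k * (1/4) ^ (n - k)) = 1" for n
    using binomial_ring[of "3/4::real" "1/4" n] by simp
  then show ?case by auto
next
  case (Suc m)
  then obtain C where C: "\<And>n. (\<Sum>k\<le>n. real (n choose k) * (3/4) ^ k * (1/4) ^ (n - k) * ((real n + 1) / (real k + 1)) ^ m) \<le> C" by blast
  have "(\<Sum>k\<le>n. real (n choose k) * (3/4) ^ k * (1/4) ^ (n - k) * ((real n + 1) / (real k + 1)) ^ Suc m) \<le> 4/3 * 2 ^ m * C" for n
  proof -
    let ?f = "\<lambda>k. real (Suc n choose k) * (3/4) ^ k * (1/4) ^ (Suc n - k) * ((real (Suc n) + 1) / (real k + 1)) ^ m"
    have "real (n choose k) * (3/4) ^ k * (1/4) ^ (n - k) * ((real n + 1) / (real k + 1)) ^ Suc m \<le> 4/3 * 2 ^ m * ?f (Suc k)" for k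
    proof -
      have "real (Suc k * (Suc n choose Suc k)) = real (Suc n * (n choose k))"
        using Suc_times_binomial_eq[of n k] by (metis mult.commute)
      then have b: "real (n choose k) * ((real n + 1) / (real k + 1)) = real (Suc n choose Suc k)"
        by (simp add: field_simps del: binomial_Suc_Suc)
      have q: "(real n + 1) / (real k + 1) \<le> 2 * ((real (Suc n) + 1) / (real (Suc k) + 1))"
        by (simp add: divide_simps) (simp add: algebra_simps)
      have "real (n choose k) * (3/4) ^ k * (1/4) ^ (n - k) * ((real n + 1) / (real k + 1)) ^ Suc m
        = real (Suc n choose Suc k) * (3/4) ^ k * (1/4) ^ (n - k) * ((real n + 1) / (real k + 1)) ^ m"
        unfolding b[symmetric] by (simp add: mult_ac)
      also have "\<dots> \<le> real (Suc n choose Suc k) * (3/4) ^ k * (1/4) ^ (n - k) * (2 * ((real (Suc n) + 1) / (real (Suc k) + 1))) ^ m"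
        by (intro mult_left_mono power_mono q) auto
      also have "\<dots> = 4/3 * 2 ^ m * ?f (Suc k)" unfolding power_mult_distrib by (simp add: mult_ac del: binomial_Suc_Suc of_nat_Suc)
      finally show ?thesis .
    qed
    then have "(\<Sum>k\<le>n. real (n choose k) * (3/4) ^ k * (1/4) ^ (n - k) * ((real n + 1) / (real k + 1)) ^ Suc m)
       \<le> (\<Sum>k\<le>n. 4/3 * 2 ^ m * ?f (Suc k))" by (intro sum_mono)
    also have "\<dots> = 4/3 * 2 ^ m * (\<Sum>k\<le>n. ?f (Suc k))" by (simp only: sum_distrib_left)
    also have "\<dots> \<le> 4/3 * 2 ^ m * (\<Sum>k\<le>Suc n. ?f k)"
    proof -
      have "?f 0 \<ge> 0" by simp
      then show ?thesis using sum.atMost_Suc_shift[of ?f n] by (intro mult_left_mono) (linarith, simp)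
    qed
    also have "\<dots> \<le> 4/3 * 2 ^ m * C" by (intro mult_left_mono C) auto
    finally show ?thesis .
  qed
  then show ?case by blast
qed

section \<open>Growth of the norms and the weighted square integral\<close>

lemma lag_norm_asymp:
  assumes a: "a > -1"
  shows "(\<lambda>n. (real n + 1) powr a / lag_norm n a) \<longlonglongrightarrow> 1"
proof -
  have Gpos: "Gamma (a + 1) > 0" using a by (intro Gamma_real_pos) auto
  \<comment> \<open>Euler's limit formula for the Gamma function; up to an elementary factor tending
    to 1, its terms are the quotients in question.\<close>
  have "(\<lambda>n. Gamma_series (a + 1) n / Gamma (a + 1)) \<longlonglongrightarrow> Gamma (a + 1) / Gamma (a + 1)"
    using Gpos by (intro tendsto_divide Gamma_series_LIMSEQ tendsto_const) auto
  then have lim1: "(\<lambda>n. Gamma_series (a + 1) n / Gamma (a + 1)) \<longlonglongrightarrow> 1" using Gpos by simp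
  have lim2: "(\<lambda>n. (real n + 1) powr a * (real n + a + 1) / real n powr (a + 1)) \<longlonglongrightarrow> 1"
    by real_asymp
  have "(\<lambda>n. Gamma_series (a + 1) n / Gamma (a + 1) * ((real n + 1) powr a * (real n + a + 1) / real n powr (a + 1))) \<longlonglongrightarrow> 1 * 1"
    by (intro tendsto_mult lim1 lim2)
  then have "(\<lambda>n. Gamma_series (a + 1) n / Gamma (a + 1) * ((real n + 1) powr a * (real n + a + 1) / real n powr (a + 1))) \<longlonglongrightarrow> 1" by simp
  then show ?thesis
  proof (rule Lim_transform_eventually)
    show "\<forall>\<^sub>F n in sequentially. Gamma_series (a + 1) n / Gamma (a + 1) * ((real n + 1) powr a * (real n + a + 1) / real n powr (a + 1))
       = (real n + 1) powr a / lag_norm n a"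
    proof (rule eventually_sequentiallyI[of 1])
      fix n :: nat assume n: "n \<ge> 1"
      have pos: "real n + a + 1 > 0" using a by simp
      have "pochhammer (a + 1) (n + 1) = Gamma (a + 1 + real (n + 1)) / Gamma (a + 1)"
        using a by (intro pochhammer_Gamma) (auto simp: nonpos_Ints_def)
      also have "a + 1 + real (n + 1) = (real n + a + 1) + 1" by simp
      also have "Gamma \<dots> = (real n + a + 1) * Gamma (real n + a + 1)"
        using pos by (intro Gamma_plus1) (auto simp: nonpos_Ints_def)
      finally have p: "pochhammer (a + 1) (n + 1) = (real n + a + 1) * Gamma (real n + a + 1) / Gamma (a + 1)" .
      have e: "exp ((a + 1) * of_real (ln (of_nat n))) = real n powr (a + 1)"
        using n by (simp add: powr_def)
      have "Gamma (real n + a + 1) > 0" using pos by (intro Gamma_real_pos)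
      then show "Gamma_series (a + 1) n / Gamma (a + 1) * ((real n + 1) powr a * (real n + a + 1) / real n powr (a + 1))
       = (real n + 1) powr a / lag_norm n a"
        using Gpos pos n unfolding Gamma_series_def p e lag_norm_def
        by (simp add: divide_simps)
    qed
  qed
qed

text \<open>The base is \<open>real n + 1\<close> so that the bounds include n = 0, where
  \<open>real n powr a\<close> would be 0.\<close>

lemma lag_norm_bounds:
  assumes a: "a > -1"
  obtains c C where "c > 0" "C > 0" "\<And>n. lag_norm n a \<le> C * (real n + 1) powr a"
    "\<And>n. (real n + 1) powr a \<le> c * lag_norm n a"
proof -
  let ?X = "\<lambda>n. (real n + 1) powr a / lag_norm n a"
  note lim = lag_norm_asymp[OF a]
  have "Bseq ?X" using lim by (intro convergent_imp_Bseq) (auto simp: convergent_def)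
  then obtain c where c: "c > 0" "\<And>n. norm (?X n) \<le> c" by (auto simp: Bseq_def)
  have "Bseq (\<lambda>n. inverse (?X n))" using tendsto_inverse[OF lim] by (intro convergent_imp_Bseq) (auto simp: convergent_def)
  then obtain C where C: "C > 0" "\<And>n. norm (inverse (?X n)) \<le> C" by (auto simp: Bseq_def)
  show ?thesis
  proof (rule that[OF c(1) C(1)])
    fix n
    have p: "lag_norm n a > 0" "(real n + 1) powr a > 0" using lag_norm_pos[OF a] by auto
    show "(real n + 1) powr a \<le> c * lag_norm n a" using c(2)[of n] p by (simp add: divide_simps)
    show "lag_norm n a \<le> C * (real n + 1) powr a" using C(2)[of n] p by (simp add: divide_simps)
  qed
qed

text \<open>Parseval for the rescaled expansion; the substitution s = 3u/4 produces the factor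
  (3/4)^(a+1).\<close>

lemma has_integral_laguerre_square:
  assumes a: "a > -1"
  shows "((\<lambda>s. s powr a * exp (- (4/3) * s) * laguerre n a s ^ 2) has_integral
     (3/4) powr (a + 1) * (\<Sum>k\<le>n. (((real n + a) gchoose (n - k)) * (3/4) ^ k * (1/4) ^ (n - k)) ^ 2 * lag_norm k a)) {0<..}"
proof -
  define b where "b = (\<lambda>k. ((real n + a) gchoose (n - k)) * (3/4) ^ k * (1/4) ^ (n - k))"
  have "((\<lambda>u. \<Sum>k\<le>n. \<Sum>j\<le>n. b k * b j * (u powr a * exp (- u) * laguerre k a u * laguerre j a u)) has_integral
      (\<Sum>k\<le>n. \<Sum>j\<le>n. b k * b j * (if k = j then lag_norm k a else 0))) {0<..}"
    by (intro has_integral_sum has_integral_mult_right laguerre_orthogonal' a) auto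
  moreover have "(\<Sum>k\<le>n. \<Sum>j\<le>n. b k * b j * (if k = j then lag_norm k a else 0)) = (\<Sum>k\<le>n. b k ^ 2 * lag_norm k a)"
    by (intro sum.cong) (auto simp: if_distrib power2_eq_square sum.delta' cong: if_cong)
  moreover have "(\<Sum>k\<le>n. \<Sum>j\<le>n. b k * b j * (u powr a * exp (- u) * laguerre k a u * laguerre j a u))
      = u powr a * exp (- u) * laguerre n a (3/4 * u) ^ 2" for u
  proof -
    have "laguerre n a (3/4 * u) = (\<Sum>k\<le>n. b k * laguerre k a u)"
      using laguerre_scale[of n a "3/4" u] by (simp add: b_def)
    then show ?thesis by (simp add: power2_eq_square sum_product sum_distrib_left mult_ac)
  qed
  ultimately have "((\<lambda>u. u powr a * exp (- u) * laguerre n a (3/4 * u) ^ 2) has_integral (\<Sum>k\<le>n. b k ^ 2 * lag_norm k a)) {0<..}"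
    by simp
  from has_integral_mult_right[OF has_integral_stretch_halfline[OF this, of "4/3"], of "(3/4) powr a"]
  have "((\<lambda>s. (3/4) powr a * ((4/3 * s) powr a * exp (- (4/3 * s)) * laguerre n a (3/4 * (4/3 * s)) ^ 2)) has_integral
     (3/4) powr a * (3/4 * (\<Sum>k\<le>n. b k ^ 2 * lag_norm k a))) {0<..}" by simp
  moreover have "(3/4) powr a * (3/4 * (\<Sum>k\<le>n. b k ^ 2 * lag_norm k a)) = (3/4) powr (a + 1) * (\<Sum>k\<le>n. b k ^ 2 * lag_norm k a)"
    by (simp add: powr_add)
  moreover have "((\<lambda>s. (3/4) powr a * ((4/3 * s) powr a * exp (- (4/3 * s)) * laguerre n a (3/4 * (4/3 * s)) ^ 2)) has_integral I) {0<..}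
     \<longleftrightarrow> ((\<lambda>s. s powr a * exp (- (4/3) * s) * laguerre n a s ^ 2) has_integral I) {0<..}" for I
  proof (rule has_integral_cong)
    fix s :: real assume "s \<in> {0<..}"
    have "(3/4) powr a * (4/3 * s) powr a = (3/4 * (4/3 * s)) powr a" by (rule powr_mult[symmetric])
    then have "(3/4) powr a * (4/3 * s) powr a = s powr a" by simp
    then show "(3/4) powr a * ((4/3 * s) powr a * exp (- (4/3 * s)) * laguerre n a (3/4 * (4/3 * s)) ^ 2) = s powr a * exp (- (4/3) * s) * laguerre n a s ^ 2"
      by (simp add: mult.assoc[symmetric])
  qed
  ultimately show ?thesis unfolding b_def by (simp only:)
qed

lemma integrable_laguerre_square:
  "a > -1 \<Longrightarrow> (\<lambda>s. s powr a * exp (- (4/3) * s) * laguerre n a s ^ 2) integrable_on {0<..}"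
  by (rule has_integral_integrable[OF has_integral_laguerre_square])

lemma laguerre_square_bound:
  assumes a: "a > -1"
  obtains C where "C > 0" "\<And>n. integral {0<..} (\<lambda>s. s powr a * exp (- (4/3) * s) * laguerre n a s ^ 2) \<le> C * (real n + 1) powr (a - 1/2)"
proof -
  obtain c D where cD: "c > 0" "D > 0" "\<And>n. lag_norm n a \<le> D * (real n + 1) powr a"
    "\<And>n. (real n + 1) powr a \<le> c * lag_norm n a"
    by (rule lag_norm_bounds[OF a]) blast
  \<comment> \<open>An integer exponent at least a, as \<open>binomial_moment_bound\<close>
    requires; for -1 < a <= 0 it is 0.\<close>
  define m where "m = nat \<lceil>a\<rceil>"
  obtain K where K: "\<And>n. (\<Sum>k\<le>n. real (n choose k) * (3/4) ^ k * (1/4) ^ (n - k) * ((real n + 1) / (real k + 1)) ^ m) \<le> K"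
    using binomial_moment_bound by blast
  have ratio: "lag_norm n a / lag_norm k a \<le> D * c * ((real n + 1) / (real k + 1)) ^ m" if "k \<le> n" for n k
  proof -
    have "lag_norm n a / lag_norm k a \<le> (D * (real n + 1) powr a) / ((real k + 1) powr a / c)"
      using cD lag_norm_pos[OF a] by (intro frac_le) (auto simp: field_simps)
    also have "\<dots> = D * c * ((real n + 1) / (real k + 1)) powr a"
      by (simp add: powr_divide)
    also have "((real n + 1) / (real k + 1)) powr a \<le> ((real n + 1) / (real k + 1)) powr (real m)"
      using that by (intro powr_mono) (auto simp: m_def real_nat_ceiling_ge)
    also have "\<dots> = ((real n + 1) / (real k + 1)) ^ m" by (simp add: powr_realpow)
    finally show ?thesis using cD by simp
  qed
  define C where "C = (3/4) powr (a + 1) * (D * (3/2 * (D * c * (\<bar>K\<bar> + 1))))"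
  show ?thesis
  proof (rule that)
    show "C > 0" unfolding C_def using cD by (intro mult_pos_pos) auto
    fix n
    define q where "q = (\<lambda>k. real (n choose k) * (3/4) ^ k * (1/4) ^ (n - k))"
    have q0: "q k \<ge> 0" for k by (simp add: q_def)
    \<comment> \<open>Of the two factors \<open>q k\<close>, one is bounded by its maximum
      O(n^(-1/2)); the other is kept as a probability weight against which the norm ratio is
      averaged.\<close>
    have summand: "(((real n + a) gchoose (n - k)) * (3/4) ^ k * (1/4) ^ (n - k)) ^ 2 * lag_norm k a
       \<le> lag_norm n a * (3/2 / sqrt (real n + 1) * (D * c * (q k * ((real n + 1) / (real k + 1)) ^ m)))" if "k \<le> n" for k
    proof -
      have "(((real n + a) gchoose (n - k)) * (3/4) ^ k * (1/4) ^ (n - k)) ^ 2 * lag_norm k a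
          = lag_norm n a * (q k * (q k * (lag_norm n a / lag_norm k a)))"
        using lag_norm_pos[OF a, of k] gchoose_eq_lag_norm[OF a that]
        by (simp add: q_def power2_eq_square)
      also have "\<dots> \<le> lag_norm n a * (3/2 / sqrt (real n + 1) * (q k * (D * c * ((real n + 1) / (real k + 1)) ^ m)))"
        using lag_norm_pos[OF a] cD q0 binomial_three_quarters_bound[OF that, folded q_def] ratio[OF that]
        by (intro mult_left_mono mult_mono) (auto simp: less_imp_le q_def)
      finally show ?thesis by (simp add: mult_ac)
    qed
    have "integral {0<..} (\<lambda>s. s powr a * exp (- (4/3) * s) * laguerre n a s ^ 2)
       = (3/4) powr (a + 1) * (\<Sum>k\<le>n. (((real n + a) gchoose (n - k)) * (3/4) ^ k * (1/4) ^ (n - k)) ^ 2 * lag_norm k a)"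
      by (rule integral_unique[OF has_integral_laguerre_square[OF a]])
    also have "\<dots> \<le> (3/4) powr (a + 1) * (\<Sum>k\<le>n. lag_norm n a * (3/2 / sqrt (real n + 1) * (D * c * (q k * ((real n + 1) / (real k + 1)) ^ m))))"
      using summand by (intro mult_left_mono sum_mono) auto
    also have "\<dots> = (3/4) powr (a + 1) * (lag_norm n a * (3/2 / sqrt (real n + 1) * (D * c * (\<Sum>k\<le>n. q k * ((real n + 1) / (real k + 1)) ^ m))))"
      by (simp only: sum_distrib_left)
    also have "\<dots> \<le> (3/4) powr (a + 1) * (D * (real n + 1) powr a * (3/2 / sqrt (real n + 1) * (D * c * (\<bar>K\<bar> + 1))))"
    proof -
      have "(\<Sum>k\<le>n. q k * ((real n + 1) / (real k + 1)) ^ m) \<le> \<bar>K\<bar> + 1"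
        using K[of n] unfolding q_def by linarith
      moreover have "(\<Sum>k\<le>n. q k * ((real n + 1) / (real k + 1)) ^ m) \<ge> 0" using q0 by (intro sum_nonneg) simp
      ultimately show ?thesis using cD lag_norm_pos[OF a, of n]
        by (intro mult_left_mono mult_mono cD(3)) (auto intro!: mult_nonneg_nonneg divide_nonneg_nonneg)
    qed
    also have "\<dots> = C * (real n + 1) powr (a - 1/2)"
      by (simp add: C_def powr_diff powr_half_sqrt)
    finally show "integral {0<..} (\<lambda>s. s powr a * exp (- (4/3) * s) * laguerre n a s ^ 2) \<le> C * (real n + 1) powr (a - 1/2)" .
  qed
qed

section \<open>Pointwise and weighted bounds\<close>

lemma powr_shift_le:
  fixes e :: real
  assumes "n \<ge> 1"
  shows "real n powr e \<le> 2 powr \<bar>e\<bar> * (real n + 1) powr e"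
proof (cases "e \<ge> 0")
  case True
  then have "real n powr e \<le> 1 * (real n + 1) powr e" by (simp add: powr_mono2)
  also have "\<dots> \<le> 2 powr \<bar>e\<bar> * (real n + 1) powr e"
    by (intro mult_right_mono) (auto intro: ge_one_powr_ge_zero)
  finally show ?thesis .
next
  case False
  have "real n powr e = 2 powr \<bar>e\<bar> * (2 * real n) powr e"
    using False assms by (simp add: powr_mult powr_minus)
  also have "\<dots> \<le> 2 powr \<bar>e\<bar> * (real n + 1) powr e"
    using False assms by (intro mult_left_mono powr_mono2') auto
  finally show ?thesis .
qed

text \<open>The energy \<open>s y'\<^sup>2 + n y\<^sup>2\<close> of the Laguerre equation varies slowly; comparing its value at
  \<open>t\<close> with its mean over \<open>[t, t + 1]\<close> turns the weighted square bound into a pointwise one.\<close>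
lemma laguerre_pointwise_bound:
  assumes a: "a > -1" and t: "t > 0"
  obtains C where "C > 0" "\<And>n. \<bar>laguerre n a t\<bar> \<le> C * (real n + 1) powr (a/2 - 1/4)"
proof -
  obtain C1 where C1: "C1 > 0" "\<And>n. integral {0<..} (\<lambda>s. s powr a * exp (- (4/3) * s) * laguerre n a s ^ 2) \<le> C1 * (real n + 1) powr (a - 1/2)"
    by (rule laguerre_square_bound[OF a]) blast
  have a1: "a + 1 > -1" using a by simp
  obtain C2 where C2: "C2 > 0" "\<And>n. integral {0<..} (\<lambda>s. s powr (a + 1) * exp (- (4/3) * s) * laguerre n (a + 1) s ^ 2) \<le> C2 * (real n + 1) powr (a + 1 - 1/2)"
    by (rule laguerre_square_bound[OF a1]) blast
  have "continuous_on {t..t+1} (\<lambda>s. s powr (- a) * exp ((4/3) * s))"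
    using t by (intro continuous_intros) auto
  then obtain x where x: "\<And>s. s \<in> {t..t+1} \<Longrightarrow> s powr (- a) * exp ((4/3) * s) \<le> x powr (- a) * exp ((4/3) * x)"
    using continuous_attains_sup[of "{t..t+1}" "\<lambda>s. s powr (- a) * exp ((4/3) * s)"] by (auto simp: Ball_def)
  \<comment> \<open>An upper bound for the reciprocal weight on the compact interval [t, t + 1],
    enlarged by 1 to be visibly positive.\<close>
  define c0 where "c0 = x powr (- a) * exp ((4/3) * x) + 1"
  have c0: "c0 > 0" unfolding c0_def by (intro add_nonneg_pos) auto
  have wt: "1 \<le> c0 * (s powr a * exp (- (4/3) * s))" if "s \<in> {t..t+1}" for s
  proof -
    have "1 = (s powr (- a) * exp ((4/3) * s)) * (s powr a * exp (- (4/3) * s))"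
      using that t by (simp add: powr_minus exp_minus field_simps)
    also have "\<dots> \<le> c0 * (s powr a * exp (- (4/3) * s))"
      using x[OF that] by (intro mult_right_mono) (auto simp: c0_def)
    finally show ?thesis .
  qed
  \<comment> \<open>Chosen so that K s >= |2a + 1| for s >= t, which makes E(s) e^(K s)
    nondecreasing from t on.\<close>
  define K where "K = \<bar>2 * a + 1\<bar> / t"
  have K0: "K \<ge> 0" using t by (simp add: K_def)
  define D where "D = 2 * exp K * c0 * (C2 * 2 powr \<bar>a + 1/2\<bar> + C1) + 1"
  have D: "D > 0" unfolding D_def using c0 C1 C2 by (intro add_nonneg_pos mult_nonneg_nonneg) auto
  have main: "laguerre (Suc m) a t ^ 2 \<le> D * (real (Suc m) + 1) powr (a - 1/2)" for m
  proof -
    define n where "n = real (Suc m)"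
    have n: "n \<ge> 1" by (simp add: n_def)
    \<comment> \<open>Here y is L_n with n = m + 1, and y' is -L_m with parameter a + 1.\<close>
    define E where "E = (\<lambda>s. s * laguerre m (a + 1) s ^ 2 + n * laguerre (Suc m) a s ^ 2)"
    have dE: "(E has_real_derivative (2 * s - 2 * a - 1) * laguerre m (a + 1) s ^ 2) (at s)" for s
    proof -
      let ?z' = "poly (pderiv (lag_poly m (a + 1))) s"
      have dz: "(laguerre m (a + 1) has_real_derivative ?z') (at s)"
        using poly_DERIV[of "lag_poly m (a + 1)" s] by (simp add: poly_lag_poly)
      \<comment> \<open>Laguerre's equation for y in first-order form. Inserting it into E' cancels
        the terms with the second derivative and leaves a multiple of y'^2.\<close>
      have ode: "s * ?z' + (a + 1 - s) * laguerre m (a + 1) s = n * laguerre (Suc m) a s"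
        using arg_cong[OF lag_poly_raise[of m "a + 1"], of "\<lambda>p. poly p s"]
        by (simp add: poly_lag_poly n_def algebra_simps)
      have "(E has_real_derivative (laguerre m (a + 1) s ^ 2 + 2 * laguerre m (a + 1) s * (s * ?z')
          - 2 * laguerre m (a + 1) s * (n * laguerre (Suc m) a s))) (at s)"
        unfolding E_def
        by (rule dz laguerre_has_real_derivative derivative_eq_intros refl)+ (simp add: algebra_simps power2_eq_square)
      also have "laguerre m (a + 1) s ^ 2 + 2 * laguerre m (a + 1) s * (s * ?z')
          - 2 * laguerre m (a + 1) s * (n * laguerre (Suc m) a s) = (2 * s - 2 * a - 1) * laguerre m (a + 1) s ^ 2"
        unfolding ode[symmetric] by (simp add: algebra_simps power2_eq_square)
      finally show ?thesis .
    qed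
    have Ele: "E t \<le> exp K * E s" if s: "s \<in> {t..t+1}" for s
    proof -
      have "E t * exp (K * t) \<le> E s * exp (K * s)"
      proof (rule DERIV_nonneg_imp_nondecreasing[of t s "\<lambda>s. E s * exp (K * s)"])
        fix r assume r: "t \<le> r" "r \<le> s"
        have "((\<lambda>s. E s * exp (K * s)) has_real_derivative
           ((2 * r - 2 * a - 1) * laguerre m (a + 1) r ^ 2 + K * E r) * exp (K * r)) (at r)"
          by (rule derivative_eq_intros dE refl | simp add: algebra_simps)+
        moreover have "0 \<le> ((2 * r - 2 * a - 1) * laguerre m (a + 1) r ^ 2 + K * E r) * exp (K * r)"
        proof -
          have "K * r \<ge> K * t" using r t by (intro mult_left_mono) (auto simp: K_def)
          then have "K * r \<ge> \<bar>2 * a + 1\<bar>" using t by (simp add: K_def)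
          then have "2 * r - 2 * a - 1 + K * r \<ge> 0" using r t by linarith
          then have "0 \<le> (2 * r - 2 * a - 1 + K * r) * laguerre m (a + 1) r ^ 2 + K * (n * laguerre (Suc m) a r ^ 2)"
            using n K0 by (simp add: mult_nonneg_nonneg)
          also have "\<dots> = (2 * r - 2 * a - 1) * laguerre m (a + 1) r ^ 2 + K * E r"
            by (simp add: E_def algebra_simps)
          finally show ?thesis by simp
        qed
        ultimately show "\<exists>y. ((\<lambda>s. E s * exp (K * s)) has_real_derivative y) (at r) \<and> 0 \<le> y" by blast
      qed (use s in simp)
      also have "\<dots> \<le> E s * exp (K * (t + 1))"
        using s t n K0 by (intro mult_left_mono) (auto simp: E_def intro!: mult_left_mono)
      finally have "E t * exp (K * t) \<le> exp K * E s * exp (K * t)"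
        by (simp add: algebra_simps exp_add)
      then show ?thesis by simp
    qed
    \<comment> \<open>The energy with the weight inserted. Both parts have integral O(n^(a + 1/2)):
      the first by the square bound for parameter a + 1, the second by n times the one for
      a.\<close>
    define W where "W = (\<lambda>s. s powr (a + 1) * exp (- (4/3) * s) * laguerre m (a + 1) s ^ 2
        + n * (s powr a * exp (- (4/3) * s) * laguerre (Suc m) a s ^ 2))"
    have EW: "E s \<le> c0 * W s" if s: "s \<in> {t..t+1}" for s
    proof -
      have "E s * 1 \<le> E s * (c0 * (s powr a * exp (- (4/3) * s)))"
        using wt[OF s] s t n by (intro mult_left_mono) (auto simp: E_def)
      also have "\<dots> = c0 * W s"
        using s t unfolding E_def W_def by (simp add: powr_add algebra_simps)
      finally show ?thesis by simp
    qed
    have Wint: "W integrable_on {0<..}" unfolding W_def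
      by (intro integrable_add integrable_on_mult_right integrable_laguerre_square a a1)
    have "E t = integral {t..t+1} (\<lambda>_. E t)" by simp
    also have "\<dots> \<le> integral {t..t+1} (\<lambda>s. exp K * c0 * W s)"
    proof (rule integral_le)
      show "(\<lambda>s. exp K * c0 * W s) integrable_on {t..t+1}"
        by (intro integrable_on_mult_right integrable_on_halfline_Icc[OF Wint t])
      fix s assume s: "s \<in> {t..t+1}"
      have "exp K * E s \<le> exp K * (c0 * W s)" using EW[OF s] by (intro mult_left_mono) auto
      then show "E t \<le> exp K * c0 * W s" unfolding mult.assoc using Ele[OF s] by linarith
    qed (intro integrable_continuous_real continuous_intros)
    also have "\<dots> = exp K * c0 * integral {t..t+1} W" by simp
    also have "integral {t..t+1} W \<le> integral {0<..} W"
      by (rule integral_subset_le[OF _ integrable_on_halfline_Icc[OF Wint t] Wint])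
         (use t n in \<open>auto simp: W_def\<close>)
    also have "integral {0<..} W = integral {0<..} (\<lambda>s. s powr (a + 1) * exp (- (4/3) * s) * laguerre m (a + 1) s ^ 2)
       + n * integral {0<..} (\<lambda>s. s powr a * exp (- (4/3) * s) * laguerre (Suc m) a s ^ 2)"
      unfolding W_def
      by (subst integral_add)
         (intro integrable_on_mult_right integrable_laguerre_square a a1 | simp)+
    also have "\<dots> \<le> C2 * (real m + 1) powr (a + 1 - 1/2) + n * (C1 * (real (Suc m) + 1) powr (a - 1/2))"
      using n by (intro add_mono mult_left_mono C1 C2) auto
    also have "\<dots> \<le> C2 * (2 powr \<bar>a + 1/2\<bar> * (n + 1) powr (a + 1/2)) + C1 * (n + 1) powr (a + 1/2)"
    proof (intro add_mono mult_left_mono)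
      show "(real m + 1) powr (a + 1 - 1/2) \<le> 2 powr \<bar>a + 1/2\<bar> * (n + 1) powr (a + 1/2)"
        using powr_shift_le[of "Suc m" "a + 1/2"] by (simp add: n_def add_ac)
      have "n * (n + 1) powr (a - 1/2) \<le> (n + 1) * (n + 1) powr (a - 1/2)" by (intro mult_right_mono) auto
      also have "\<dots> = (n + 1) powr (a + 1/2)" using n powr_add[of "n + 1" 1 "a - 1/2"] by (simp add: add.commute)
      finally have "C1 * (n * (n + 1) powr (a - 1/2)) \<le> C1 * (n + 1) powr (a + 1/2)" using C1 by simp
      then show "n * (C1 * (real (Suc m) + 1) powr (a - 1/2)) \<le> C1 * (n + 1) powr (a + 1/2)"
        by (simp add: n_def algebra_simps)
    qed (use C2 in auto)
    finally have "E t \<le> exp K * c0 * (C2 * (2 powr \<bar>a + 1/2\<bar> * (n + 1) powr (a + 1/2)) + C1 * (n + 1) powr (a + 1/2))"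
      using c0 by (simp add: mult_left_mono)
    also have "\<dots> \<le> D / 2 * (n + 1) powr (a + 1/2)"
      by (simp add: D_def algebra_simps)
    finally have Et: "E t \<le> D / 2 * (n + 1) powr (a + 1/2)" .
    \<comment> \<open>The energy at t is O(n^(a + 1/2)) and dominates n y^2; dividing by (n + 1)/2
      <= n gives the exponent a - 1/2.\<close>
    have "(n + 1) / 2 * laguerre (Suc m) a t ^ 2 \<le> n * laguerre (Suc m) a t ^ 2"
      using n by (intro mult_right_mono) auto
    also have "\<dots> \<le> E t" using t by (simp add: E_def)
    also note Et
    also have "(n + 1) powr (a + 1/2) = (n + 1) * (n + 1) powr (a - 1/2)"
      using n powr_add[of "n + 1" 1 "a - 1/2"] by (simp add: add.commute)
    also have "D / 2 * ((n + 1) * (n + 1) powr (a - 1/2)) = (n + 1) / 2 * (D * (n + 1) powr (a - 1/2))" by simp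
    finally show ?thesis using n by (simp add: n_def)
  qed
  show ?thesis
  proof (rule that)
    show "sqrt D + 1 > 0" using D by (simp add: add_pos_pos)
    fix n
    show "\<bar>laguerre n a t\<bar> \<le> (sqrt D + 1) * (real n + 1) powr (a/2 - 1/4)"
    proof (cases n)
      case 0
      then show ?thesis using D by simp
    next
      case (Suc m)
      have "\<bar>laguerre n a t\<bar> = sqrt (laguerre n a t ^ 2)" by simp
      also have "\<dots> \<le> sqrt (D * (real n + 1) powr (a - 1/2))"
        using main[of m] Suc by (intro real_sqrt_le_mono) simp
      also have "\<dots> = sqrt D * (real n + 1) powr (a/2 - 1/4)"
        using powr_half_sqrt_powr[of "real n + 1" "a - 1/2"] by (simp add: real_sqrt_mult field_simps)
      also have "\<dots> \<le> (sqrt D + 1) * (real n + 1) powr (a/2 - 1/4)" by (intro mult_right_mono) auto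
      finally show ?thesis .
    qed
  qed
qed

text \<open>\<open>laguerre_fn\<close> without its normalization: the Christoffel--Darboux error
  keeps the factor 1 / \<open>lag_norm\<close> apart, so that orders can be counted factor by
  factor.\<close>

definition lag_w :: "nat \<Rightarrow> real \<Rightarrow> real \<Rightarrow> real" where
  "lag_w n a s = s powr a * exp (- s) * laguerre n a s"

lemma lag_w_eq: "a > -1 \<Longrightarrow> lag_w n a s = lag_norm n a * laguerre_fn n a s"
  using lag_norm_pos[of a n] by (simp add: lag_w_def laguerre_fn_eq)

lemma lag_w_poly: "lag_w n a s = s powr a * exp (- 1 * s) * poly (lag_poly n a) s"
  by (simp add: lag_w_def poly_lag_poly)

lemma continuous_lag_w [continuous_intros]: "continuous_on {0<..} (lag_w n a)"
  unfolding lag_w_poly[abs_def] by (intro continuous_intros)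

lemma lag_w_tendsto_0: "a > 0 \<Longrightarrow> (lag_w n a \<longlongrightarrow> 0) (at_right 0)"
  unfolding lag_w_poly[abs_def] by (intro powr_exp_poly_tendsto_0) auto

lemma lag_w_tendsto_top: "(lag_w n a \<longlongrightarrow> 0) at_top"
  unfolding lag_w_poly[abs_def] by (intro powr_exp_poly_tendsto_top) auto

lemma lag_w_has_real_derivative:
  assumes "s > 0" "a > -1"
  shows "(lag_w n (a + 1) has_real_derivative real (Suc n) * lag_w (Suc n) a s) (at s)"
proof -
  have "lag_norm n (a + 1) * laguerre_fn (Suc n) a s = real (Suc n) * lag_w (Suc n) a s"
  proof -
    have "lag_norm n (a + 1) = real (Suc n) * lag_norm (Suc n) a"
      by (simp add: lag_norm_def add_ac)
    then show ?thesis using assms by (simp add: lag_w_eq)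
  qed
  moreover have "(laguerre_fn n (a + 1) has_real_derivative laguerre_fn (Suc n) a s) (at s)"
    using laguerre_fn_has_real_derivative[OF assms(1), of n "a + 1"] by simp
  from DERIV_cmult[OF this, of "lag_norm n (a + 1)"]
  have "((\<lambda>s. lag_norm n (a + 1) * laguerre_fn n (a + 1) s) has_real_derivative lag_norm n (a + 1) * laguerre_fn (Suc n) a s) (at s)" .
  moreover have "(\<lambda>s. lag_norm n (a + 1) * laguerre_fn n (a + 1) s) = lag_w n (a + 1)"
    using assms by (auto simp: lag_w_eq)
  ultimately show ?thesis by simp
qed

text \<open>Cauchy--Schwarz after splitting e^(-s) into e^(-2s/3) and e^(-s/3), whose squares are
  the weights e^(-4s/3) and e^(-2s/3). The constant is uniform in \<open>h\<close> and enters
  multiplied by \<open>B\<close>; the Riemann--Lebesgue argument uses this for arbitrarily small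
  \<open>B\<close>.\<close>

lemma laguerre_weighted_bound:
  assumes a: "a > -1"
  obtains C where "C > 0"
    "\<And>n (h :: real \<Rightarrow> 'a::banach) \<eta> B. continuous_on {0<..} h \<Longrightarrow> (\<And>s. s > 0 \<Longrightarrow> norm (h s) \<le> \<eta> s) \<Longrightarrow>
       (\<lambda>s. s powr a * exp (- (2/3) * s) * \<eta> s ^ 2) integrable_on {0<..} \<Longrightarrow>
       integral {0<..} (\<lambda>s. s powr a * exp (- (2/3) * s) * \<eta> s ^ 2) \<le> B ^ 2 \<Longrightarrow> B > 0 \<Longrightarrow>
       (\<lambda>s. lag_w n a s *\<^sub>R h s) integrable_on {0<..} \<and>
       norm (integral {0<..} (\<lambda>s. lag_w n a s *\<^sub>R h s)) \<le> C * B * (real n + 1) powr (a/2 - 1/4)"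
proof -
  obtain C where C: "C > 0" "\<And>n. integral {0<..} (\<lambda>s. s powr a * exp (- (4/3) * s) * laguerre n a s ^ 2) \<le> C * (real n + 1) powr (a - 1/2)"
    by (rule laguerre_square_bound[OF a]) blast
  show ?thesis
  proof (rule that[of "(C + 1) / 2"])
    show "(C + 1) / 2 > 0" using C by simp
    fix n and h :: "real \<Rightarrow> 'a" and \<eta> :: "real \<Rightarrow> real" and B :: real
    assume h: "continuous_on {0<..} h" and le: "\<And>s. s > 0 \<Longrightarrow> norm (h s) \<le> \<eta> s"
      and int: "(\<lambda>s. s powr a * exp (- (2/3) * s) * \<eta> s ^ 2) integrable_on {0<..}"
      and B: "integral {0<..} (\<lambda>s. s powr a * exp (- (2/3) * s) * \<eta> s ^ 2) \<le> B ^ 2" "B > 0"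
    define r where "r = (real n + 1) powr (a/2 - 1/4)"
    have r: "r > 0" by (simp add: r_def)
    have r2: "(real n + 1) powr (a - 1/2) = r ^ 2"
      by (simp add: r_def power2_eq_square powr_add[symmetric])
    \<comment> \<open>The arithmetic-geometric mean inequality stands in for Cauchy--Schwarz: the
      weights B/(2r) and r/(2B) balance two integrals of sizes C r^2 and B^2, so each contributes a
      multiple of B r. The same majorant proves integrability.\<close>
    define g where "g = (\<lambda>s. B / (2 * r) * (s powr a * exp (- (4/3) * s) * laguerre n a s ^ 2) + r / (2 * B) * (s powr a * exp (- (2/3) * s) * \<eta> s ^ 2))"
    have gint: "g integrable_on {0<..}" unfolding g_def
      by (intro integrable_add integrable_on_mult_right integrable_laguerre_square a int)
    have cont: "continuous_on {0<..} (\<lambda>s. lag_w n a s *\<^sub>R h s)" by (intro continuous_intros h)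
    have bound: "norm (lag_w n a s *\<^sub>R h s) \<le> g s" if s: "s > 0" for s
    proof -
      define u where "u = exp (- (2/3) * s) * \<bar>laguerre n a s\<bar>"
      define v where "v = exp (- (1/3) * s) * \<eta> s"
      have e: "exp (- s) = exp (- (2/3) * s) * exp (- (1/3) * s)" "exp (- (4/3) * s) = exp (- (2/3) * s) * exp (- (2/3) * s)"
         "exp (- (2/3) * s) = exp (- (1/3) * s) * exp (- (1/3) * s)"
        unfolding exp_add[symmetric] by simp_all
      have "norm (lag_w n a s *\<^sub>R h s) \<le> s powr a * exp (- s) * \<bar>laguerre n a s\<bar> * \<eta> s"
        using le[OF s] by (simp add: lag_w_def abs_mult mult_left_mono)
      also have "\<dots> = s powr a * (u * v)" unfolding u_def v_def e(1) by (simp only: mult_ac)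
      also have "u * v \<le> B / (2 * r) * u ^ 2 + r / (2 * B) * v ^ 2"
      proof -
        have "0 \<le> (B * u - r * v) ^ 2 / (2 * r * B)" using r B by simp
        also have "\<dots> = B / (2 * r) * u ^ 2 + r / (2 * B) * v ^ 2 - u * v"
          using r B(2) by (simp add: field_simps power2_eq_square)
        finally show ?thesis by simp
      qed
      finally have "norm (lag_w n a s *\<^sub>R h s) \<le> s powr a * (B / (2 * r) * u ^ 2 + r / (2 * B) * v ^ 2)"
        by (simp add: mult_left_mono)
      also have "\<dots> = g s"
      proof -
        have "u ^ 2 = exp (- (4/3) * s) * laguerre n a s ^ 2" unfolding u_def e(2) by (simp add: power2_eq_square)
        moreover have "v ^ 2 = exp (- (2/3) * s) * \<eta> s ^ 2" unfolding v_def e(3) by (simp add: power2_eq_square)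
        ultimately show ?thesis unfolding g_def by (simp only: distrib_left mult_ac)
      qed
      finally show ?thesis .
    qed
    have "(\<lambda>s. lag_w n a s *\<^sub>R h s) integrable_on {0<..}"
      by (rule dominated_integrable_halfline[OF cont gint bound])
    moreover have "norm (integral {0<..} (\<lambda>s. lag_w n a s *\<^sub>R h s)) \<le> integral {0<..} g"
      by (rule dominated_integral_bound_halfline[OF cont gint bound])
    moreover have "integral {0<..} g = B / (2 * r) * integral {0<..} (\<lambda>s. s powr a * exp (- (4/3) * s) * laguerre n a s ^ 2)
        + r / (2 * B) * integral {0<..} (\<lambda>s. s powr a * exp (- (2/3) * s) * \<eta> s ^ 2)"
      unfolding g_def
      by (subst integral_add) (intro integrable_on_mult_right integrable_laguerre_square a int | simp)+
    moreover have "\<dots> \<le> B / (2 * r) * (C * r ^ 2) + r / (2 * B) * B ^ 2"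
      using r B C(2)[of n] unfolding r2 by (intro add_mono mult_left_mono) auto
    moreover have "B / (2 * r) * (C * r ^ 2) + r / (2 * B) * B ^ 2 = (C + 1) / 2 * B * r"
      using r B(2) by (simp add: field_simps power2_eq_square)
    ultimately show "(\<lambda>s. lag_w n a s *\<^sub>R h s) integrable_on {0<..} \<and>
       norm (integral {0<..} (\<lambda>s. lag_w n a s *\<^sub>R h s)) \<le> (C + 1) / 2 * B * (real n + 1) powr (a/2 - 1/4)"
      unfolding r_def by linarith
  qed
qed

section \<open>Convergence of Laguerre expansions\<close>

lemma real_le_powr_bigo:
  fixes f :: "nat \<Rightarrow> real"
  assumes "\<And>n. \<bar>f n\<bar> \<le> C * (real n + c) powr e" "c \<ge> 0"
  shows "f \<in> O(\<lambda>n. real n powr e)"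
proof -
  have "f \<in> O(\<lambda>n. (real n + c) powr e)"
    using assms by (intro bigoI[of _ C] always_eventually allI) auto
  also have "(\<lambda>n. (real n + c) powr e) \<in> O(\<lambda>n. real n powr e)" by real_asymp
  finally show ?thesis .
qed

text \<open>The boundary terms vanish because \<open>p\<close> is bounded: at 0 since b + 1 > 0, at
  infinity by exponential decay. The identity trades a factor n + 1 for a derivative on
  \<open>p\<close> and one unit of parameter.\<close>

lemma has_integral_lag_w_by_parts:
  fixes p p' :: "real \<Rightarrow> 'a::banach"
  assumes b: "b > -1" and dp: "\<And>s. s > 0 \<Longrightarrow> (p has_vector_derivative p' s) (at s)"
    and bnd: "\<And>s. s > 0 \<Longrightarrow> norm (p s) \<le> K"
  shows "((\<lambda>s. lag_w n (b + 1) s *\<^sub>R p' s + (real (Suc n) * lag_w (Suc n) b s) *\<^sub>R p s) has_integral 0) {0<..}"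
proof -
  have lim: "((\<lambda>s. lag_w n (b + 1) s *\<^sub>R p s) \<longlongrightarrow> 0) F" if "(lag_w n (b + 1) \<longlongrightarrow> 0) F" "\<forall>\<^sub>F s in F. s > 0" for F
  proof -
    have "((\<lambda>s. \<bar>lag_w n (b + 1) s\<bar> * K) \<longlongrightarrow> 0) F"
      by (rule tendsto_mult_left_zero) (use tendsto_rabs_zero[OF that(1)] in simp)
    then show ?thesis
    proof (rule Lim_null_comparison[rotated])
      show "\<forall>\<^sub>F s in F. norm (lag_w n (b + 1) s *\<^sub>R p s) \<le> \<bar>lag_w n (b + 1) s\<bar> * K"
        using that(2) by eventually_elim (auto intro!: mult_left_mono bnd)
    qed
  qed
  have "((\<lambda>s. lag_w n (b + 1) s *\<^sub>R p' s + (real (Suc n) * lag_w (Suc n) b s) *\<^sub>R p s) has_integral (0 - 0)) {0<..}"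
  proof (rule FTC_halfline[where F = "\<lambda>s. lag_w n (b + 1) s *\<^sub>R p s"])
    fix s :: real assume s: "s > 0"
    show "((\<lambda>s. lag_w n (b + 1) s *\<^sub>R p s) has_vector_derivative lag_w n (b + 1) s *\<^sub>R p' s + (real (Suc n) * lag_w (Suc n) b s) *\<^sub>R p s) (at s)"
      by (intro has_vector_derivative_scaleR lag_w_has_real_derivative s b dp)
  qed (use b in \<open>auto intro!: lim lag_w_tendsto_0 lag_w_tendsto_top eventually_at_right_less eventually_gt_at_top\<close>)
  then show ?thesis by simp
qed

lemma integrable_weight_linear_square:
  fixes b K :: real
  assumes "b > -1"
  shows "(\<lambda>s. s powr b * exp (- (2/3) * s) * (K * (1 + s)) ^ 2) integrable_on {0<..}"
proof -
  have "(\<lambda>s. s powr b * exp (- (2/3) * s) * poly ([:K, K:] ^ 2) s) integrable_on {0<..}"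
    by (rule integrable_powr_exp_poly) (use assms in auto)
  then show ?thesis by (simp add: poly_power algebra_simps)
qed

text \<open>Linear growth of \<open>h\<close> is allowed because the error of the expansion contains
  the factor a - s.\<close>

lemma lag_w_integral_bigo:
  fixes h :: "real \<Rightarrow> 'a::banach"
  assumes b: "b > -1" and h: "continuous_on {0<..} h" and le: "\<And>s. s > 0 \<Longrightarrow> norm (h s) \<le> K * (1 + s)"
  shows "(\<lambda>s. lag_w n b s *\<^sub>R h s) integrable_on {0<..}"
    and "(\<lambda>n. norm (integral {0<..} (\<lambda>s. lag_w n b s *\<^sub>R h s))) \<in> O(\<lambda>n. real n powr (b/2 - 1/4))"
proof -
  obtain C where C: "C > 0"
    "\<And>n (h :: real \<Rightarrow> 'a) \<eta> B. continuous_on {0<..} h \<Longrightarrow> (\<And>s. s > 0 \<Longrightarrow> norm (h s) \<le> \<eta> s) \<Longrightarrow>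
       (\<lambda>s. s powr b * exp (- (2/3) * s) * \<eta> s ^ 2) integrable_on {0<..} \<Longrightarrow>
       integral {0<..} (\<lambda>s. s powr b * exp (- (2/3) * s) * \<eta> s ^ 2) \<le> B ^ 2 \<Longrightarrow> B > 0 \<Longrightarrow>
       (\<lambda>s. lag_w n b s *\<^sub>R h s) integrable_on {0<..} \<and>
       norm (integral {0<..} (\<lambda>s. lag_w n b s *\<^sub>R h s)) \<le> C * B * (real n + 1) powr (b/2 - 1/4)"
    by (rule laguerre_weighted_bound[OF b]) blast
  define Q where "Q = integral {0<..} (\<lambda>s. s powr b * exp (- (2/3) * s) * (K * (1 + s)) ^ 2)"
  have "Q \<le> (\<bar>Q\<bar> + 1) * 1" by simp
  also have "\<dots> \<le> (\<bar>Q\<bar> + 1) * (\<bar>Q\<bar> + 1)" by (intro mult_left_mono) auto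
  finally have Q: "Q \<le> (\<bar>Q\<bar> + 1) ^ 2" by (simp add: power2_eq_square)
  have "(\<lambda>s. lag_w n b s *\<^sub>R h s) integrable_on {0<..} \<and>
       norm (integral {0<..} (\<lambda>s. lag_w n b s *\<^sub>R h s)) \<le> C * (\<bar>Q\<bar> + 1) * (real n + 1) powr (b/2 - 1/4)" for n
    by (rule C(2)[OF h le integrable_weight_linear_square[OF b]]) (use Q in \<open>auto simp: Q_def\<close>)
  then show "(\<lambda>s. lag_w n b s *\<^sub>R h s) integrable_on {0<..}"
    and "(\<lambda>n. norm (integral {0<..} (\<lambda>s. lag_w n b s *\<^sub>R h s))) \<in> O(\<lambda>n. real n powr (b/2 - 1/4))"
    by (auto intro!: real_le_powr_bigo[of _ "C * (\<bar>Q\<bar> + 1)" 1])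
qed

text \<open>A Riemann--Lebesgue lemma: for the approximants, one integration by parts gains a factor \<open>n^(-1/2)\<close>.\<close>
lemma lag_w_integral_smallo:
  fixes q :: "real \<Rightarrow> 'a::banach"
  assumes b: "b > -1" and q: "continuous_on {0<..} q" and qK: "\<And>s. s > 0 \<Longrightarrow> norm (q s) \<le> K"
    and approx: "\<And>e. e > 0 \<Longrightarrow> \<exists>p p' \<eta> L. (\<forall>s>0. (p has_vector_derivative p' s) (at s)) \<and> continuous_on {0<..} p' \<and>
        (\<forall>s>0. norm (p s) \<le> L) \<and> (\<forall>s>0. norm (p' s) \<le> L) \<and> (\<forall>s>0. norm (q s - p s) \<le> \<eta> s) \<and>
        (\<lambda>s. s powr b * exp (- (2/3) * s) * \<eta> s ^ 2) integrable_on {0<..} \<and>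
        integral {0<..} (\<lambda>s. s powr b * exp (- (2/3) * s) * \<eta> s ^ 2) \<le> e ^ 2"
  shows "(\<lambda>n. norm (integral {0<..} (\<lambda>s. lag_w n b s *\<^sub>R q s))) \<in> o(\<lambda>n. real n powr (b/2 - 1/4))"
proof -
  obtain C where C: "C > 0"
    "\<And>n (h :: real \<Rightarrow> 'a) \<eta> B. continuous_on {0<..} h \<Longrightarrow> (\<And>s. s > 0 \<Longrightarrow> norm (h s) \<le> \<eta> s) \<Longrightarrow>
       (\<lambda>s. s powr b * exp (- (2/3) * s) * \<eta> s ^ 2) integrable_on {0<..} \<Longrightarrow>
       integral {0<..} (\<lambda>s. s powr b * exp (- (2/3) * s) * \<eta> s ^ 2) \<le> B ^ 2 \<Longrightarrow> B > 0 \<Longrightarrow>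
       (\<lambda>s. lag_w n b s *\<^sub>R h s) integrable_on {0<..} \<and>
       norm (integral {0<..} (\<lambda>s. lag_w n b s *\<^sub>R h s)) \<le> C * B * (real n + 1) powr (b/2 - 1/4)"
    by (rule laguerre_weighted_bound[OF b]) blast
  show ?thesis
  proof (rule landau_o.smallI)
    fix c :: real assume c: "c > 0"
    \<comment> \<open>The approximation error contributes C e (n + 1)^(b/2 - 1/4), eventually at
      most c/2 times n^(b/2 - 1/4), since passing from n + 1 to n costs at most a factor 2. The
      approximant itself contributes a further c/4.\<close>
    define e where "e = c / (4 * C)"
    have e: "e > 0" using c C by (simp add: e_def)
    from approx[OF e] obtain p p' \<eta> L where dp: "\<And>s. s > 0 \<Longrightarrow> (p has_vector_derivative p' s) (at s)"
      and p': "continuous_on {0<..} p'" and L: "\<And>s. s > 0 \<Longrightarrow> norm (p s) \<le> L" "\<And>s. s > 0 \<Longrightarrow> norm (p' s) \<le> L"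
      and \<eta>: "\<And>s. s > 0 \<Longrightarrow> norm (q s - p s) \<le> \<eta> s"
        "(\<lambda>s. s powr b * exp (- (2/3) * s) * \<eta> s ^ 2) integrable_on {0<..}"
        "integral {0<..} (\<lambda>s. s powr b * exp (- (2/3) * s) * \<eta> s ^ 2) \<le> e ^ 2"
      by blast
    have L0: "L \<ge> 0" using order_trans[OF norm_ge_zero L(1)[of 1]] by simp
    have K0: "K \<ge> 0" using order_trans[OF norm_ge_zero qK[of 1]] by simp
    have p: "continuous_on {0<..} p"
      using dp by (auto intro!: continuous_at_imp_continuous_on has_vector_derivative_continuous)
    have qp: "continuous_on {0<..} (\<lambda>s. q s - p s)" by (intro continuous_intros q p)
    have b1: "b + 1 > -1" using b by simp
    have L': "norm (p s) \<le> L * (1 + s)" "norm (p' s) \<le> L * (1 + s)" if "s > 0" for s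
      using L[OF that] mult_left_mono[of 1 "1 + s" L] L0 that by auto
    have K': "norm (q s) \<le> K * (1 + s)" if "s > 0" for s
      using qK[OF that] mult_left_mono[of 1 "1 + s" K] K0 that by auto
    have intp: "(\<lambda>s. lag_w n b s *\<^sub>R p s) integrable_on {0<..}" for n
      by (rule lag_w_integral_bigo(1)[OF b p L'(1)])
    have intq: "(\<lambda>s. lag_w n b s *\<^sub>R q s) integrable_on {0<..}" for n
      by (rule lag_w_integral_bigo(1)[OF b q K'])
    have intp': "(\<lambda>s. lag_w n (b + 1) s *\<^sub>R p' s) integrable_on {0<..}" for n
      by (rule lag_w_integral_bigo(1)[OF b1 p' L'(2)])
    have parts: "real (Suc n) *\<^sub>R integral {0<..} (\<lambda>s. lag_w (Suc n) b s *\<^sub>R p s) = - integral {0<..} (\<lambda>s. lag_w n (b + 1) s *\<^sub>R p' s)" for n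
    proof -
      have "integral {0<..} (\<lambda>s. lag_w n (b + 1) s *\<^sub>R p' s + (real (Suc n) * lag_w (Suc n) b s) *\<^sub>R p s) = 0"
        by (rule integral_unique[OF has_integral_lag_w_by_parts[OF b dp L(1)]])
      moreover have "integral {0<..} (\<lambda>s. lag_w n (b + 1) s *\<^sub>R p' s + (real (Suc n) * lag_w (Suc n) b s) *\<^sub>R p s)
        = integral {0<..} (\<lambda>s. lag_w n (b + 1) s *\<^sub>R p' s) + integral {0<..} (\<lambda>s. real (Suc n) *\<^sub>R (lag_w (Suc n) b s *\<^sub>R p s))"
        unfolding scaleR_scaleR[symmetric] by (intro integral_add intp' integrable_cmul intp)
      moreover have "integral {0<..} (\<lambda>s. real (Suc n) *\<^sub>R (lag_w (Suc n) b s *\<^sub>R p s)) = real (Suc n) *\<^sub>R integral {0<..} (\<lambda>s. lag_w (Suc n) b s *\<^sub>R p s)"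
        by (rule integral_cmul)
      ultimately show ?thesis by (simp add: eq_neg_iff_add_eq_0 add.commute)
    qed
    have "(\<lambda>n. norm (integral {0<..} (\<lambda>s. lag_w n (b + 1) s *\<^sub>R p' s)) / real (Suc n)) \<in> O(\<lambda>n. real n powr ((b + 1)/2 - 1/4) / real (Suc n))"
      by (intro landau_o.big.divide_right lag_w_integral_bigo(2)[OF b1 p' L'(2)]) (auto intro!: always_eventually)
    also have "(\<lambda>n. real n powr ((b + 1)/2 - 1/4) / real (Suc n)) \<in> o(\<lambda>n. real (Suc n) powr (b/2 - 1/4))"
    proof -
      have "(\<lambda>n. real n powr (b/2 - 1/4) * (real n powr (1/2) / real (Suc n))) \<in> o(\<lambda>n. real (Suc n) powr (b/2 - 1/4) * 1)"
      proof (rule landau_o.big_small_mult)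
        show "(\<lambda>n. real n powr (b/2 - 1/4)) \<in> O(\<lambda>n. real (Suc n) powr (b/2 - 1/4))" by real_asymp
        show "(\<lambda>n. real n powr (1/2) / real (Suc n)) \<in> o(\<lambda>n. 1)" by real_asymp
      qed
      moreover have "real n powr (b/2 - 1/4) * (real n powr (1/2) / real (Suc n)) = real n powr ((b + 1)/2 - 1/4) / real (Suc n)" for n
        by (simp add: powr_add[symmetric] add_divide_distrib)
      ultimately show ?thesis by simp
    qed
    also have "(\<lambda>n. norm (integral {0<..} (\<lambda>s. lag_w n (b + 1) s *\<^sub>R p' s)) / real (Suc n))
        = (\<lambda>n. norm (integral {0<..} (\<lambda>s. lag_w (Suc n) b s *\<^sub>R p s)))"
    proof
      fix n
      have "norm (real (Suc n) *\<^sub>R integral {0<..} (\<lambda>s. lag_w (Suc n) b s *\<^sub>R p s)) = norm (integral {0<..} (\<lambda>s. lag_w n (b + 1) s *\<^sub>R p' s))"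
        unfolding parts by simp
      then show "norm (integral {0<..} (\<lambda>s. lag_w n (b + 1) s *\<^sub>R p' s)) / real (Suc n) = norm (integral {0<..} (\<lambda>s. lag_w (Suc n) b s *\<^sub>R p s))"
        by (simp add: field_simps del: of_nat_Suc)
    qed
    finally have "\<forall>\<^sub>F n in sequentially. norm (norm (integral {0<..} (\<lambda>s. lag_w (Suc n) b s *\<^sub>R p s))) \<le> c/4 * norm (real (Suc n) powr (b/2 - 1/4))"
      using c by (intro landau_o.smallD) auto
    then have ev1: "\<forall>\<^sub>F n in sequentially. norm (integral {0<..} (\<lambda>s. lag_w n b s *\<^sub>R p s)) \<le> c/4 * real n powr (b/2 - 1/4)"
      by (subst eventually_sequentially_Suc[symmetric]) simp
    have ev2: "\<forall>\<^sub>F n in sequentially. (real n + 1) powr (b/2 - 1/4) \<le> 2 * real n powr (b/2 - 1/4)"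
      by real_asymp
    show "\<forall>\<^sub>F n in sequentially. norm (norm (integral {0<..} (\<lambda>s. lag_w n b s *\<^sub>R q s))) \<le> c * norm (real n powr (b/2 - 1/4))"
      using ev1 ev2
    proof eventually_elim
      case (elim n)
      have D: "(\<lambda>s. lag_w n b s *\<^sub>R (q s - p s)) integrable_on {0<..} \<and>
         norm (integral {0<..} (\<lambda>s. lag_w n b s *\<^sub>R (q s - p s))) \<le> C * e * (real n + 1) powr (b/2 - 1/4)"
        by (rule C(2)[OF qp \<eta> e])
      have "integral {0<..} (\<lambda>s. lag_w n b s *\<^sub>R q s) = integral {0<..} (\<lambda>s. lag_w n b s *\<^sub>R p s) + integral {0<..} (\<lambda>s. lag_w n b s *\<^sub>R (q s - p s))"
        using D intp by (subst integral_add[symmetric]) (auto simp: scaleR_diff_right)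
      then have "norm (integral {0<..} (\<lambda>s. lag_w n b s *\<^sub>R q s)) \<le> c/4 * real n powr (b/2 - 1/4) + C * e * (real n + 1) powr (b/2 - 1/4)"
        using D elim(1) norm_triangle_ineq[of "integral {0<..} (\<lambda>s. lag_w n b s *\<^sub>R p s)" "integral {0<..} (\<lambda>s. lag_w n b s *\<^sub>R (q s - p s))"]
        by simp
      also have "C * e = c / 4" using C by (simp add: e_def)
      also have "c/4 * real n powr (b/2 - 1/4) + c/4 * (real n + 1) powr (b/2 - 1/4) \<le> c/4 * real n powr (b/2 - 1/4) + c/4 * (2 * real n powr (b/2 - 1/4))"
        using c elim(2) by (intro add_left_mono mult_left_mono) auto
      also have "\<dots> \<le> c * real n powr (b/2 - 1/4)" using c by (simp add: field_simps)
      finally show ?case by simp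
    qed
  qed
qed

text \<open>The fraction d^2/((t-s)^2 + d^2) is the relative error made when 1/(t - s) is replaced
  by (t - s)/((t-s)^2 + d^2). It is at most 1 and tends to 0 for s different from t, so dominated
  convergence applies.\<close>

lemma cauchy_kernel_weight_small:
  fixes b K t e :: real
  assumes b: "b > -1" and e: "e > 0"
  shows "\<exists>d>0. (\<lambda>s. s powr b * exp (- (2/3) * s) * (K * (d ^ 2 / ((t - s) ^ 2 + d ^ 2))) ^ 2) integrable_on {0<..} \<and>
     integral {0<..} (\<lambda>s. s powr b * exp (- (2/3) * s) * (K * (d ^ 2 / ((t - s) ^ 2 + d ^ 2))) ^ 2) \<le> e ^ 2"
proof -
  define d where "d = (\<lambda>k::nat. 1 / (real k + 1))"
  have d: "d k > 0" for k by (simp add: d_def)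
  define g where "g = (\<lambda>k s. s powr b * exp (- (2/3) * s) * (K * ((d k) ^ 2 / ((t - s) ^ 2 + (d k) ^ 2))) ^ 2)"
  define h where "h = (\<lambda>s. s powr b * exp (- (2/3) * s) * poly [:K ^ 2:] s)"
  have hint: "h integrable_on {0<..}" unfolding h_def by (rule integrable_powr_exp_poly) (use b in auto)
  have pos: "(t - s) ^ 2 + (d k) ^ 2 > 0" for s k using d[of k] by (intro add_nonneg_pos) auto
  have cont: "continuous_on {0<..} (g k)" for k
    unfolding g_def using pos d[of k] by (intro continuous_intros) (auto simp: less_imp_neq[THEN not_sym])
  have le: "norm (g k s) \<le> h s" if "s > 0" for k s
  proof -
    have "0 \<le> (d k) ^ 2 / ((t - s) ^ 2 + (d k) ^ 2)" "(d k) ^ 2 / ((t - s) ^ 2 + (d k) ^ 2) \<le> 1"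
      using pos[of s k] by (auto simp: divide_simps)
    then have "((d k) ^ 2 / ((t - s) ^ 2 + (d k) ^ 2)) ^ 2 \<le> 1" by (intro power_le_one)
    then have "K ^ 2 * ((d k) ^ 2 / ((t - s) ^ 2 + (d k) ^ 2)) ^ 2 \<le> K ^ 2 * 1" by (intro mult_left_mono) auto
    then have "(K * ((d k) ^ 2 / ((t - s) ^ 2 + (d k) ^ 2))) ^ 2 \<le> K ^ 2" unfolding power_mult_distrib by simp
    then have "s powr b * exp (- (2/3) * s) * (K * ((d k) ^ 2 / ((t - s) ^ 2 + (d k) ^ 2))) ^ 2 \<le> s powr b * exp (- (2/3) * s) * K ^ 2"
      by (intro mult_left_mono) auto
    then show ?thesis unfolding g_def h_def by (simp add: abs_mult)
  qed
  have gint: "g k integrable_on {0<..}" for k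
    by (rule dominated_integrable_halfline[OF cont hint le])
  define g0 where "g0 = (\<lambda>s. if s = t then s powr b * exp (- (2/3) * s) * K ^ 2 else 0)"
  have "(\<lambda>k. integral {0<..} (g k)) \<longlonglongrightarrow> integral {0<..} g0"
  proof (rule dominated_convergence(2)[OF gint hint])
    show "norm (g k s) \<le> h s" if "s \<in> {0<..}" for k s using le that by simp
    fix s :: real assume "s \<in> {0<..}"
    show "(\<lambda>k. g k s) \<longlonglongrightarrow> g0 s"
    proof (cases "s = t")
      case True
      have "g k s = g0 s" for k using True d[of k] by (simp add: g_def g0_def)
      then show ?thesis by simp
    next
      case False
      then have nz: "(t - s) ^ 2 \<noteq> 0" by simp
      have d0: "d \<longlonglongrightarrow> 0" unfolding d_def by real_asymp
      have "(\<lambda>k. (d k) ^ 2 / ((t - s) ^ 2 + (d k) ^ 2)) \<longlonglongrightarrow> 0 ^ 2 / ((t - s) ^ 2 + 0 ^ 2)"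
        using nz by (intro tendsto_intros d0) auto
      then have "(\<lambda>k. g k s) \<longlonglongrightarrow> s powr b * exp (- (2/3) * s) * (K * (0 ^ 2 / ((t - s) ^ 2 + 0 ^ 2))) ^ 2"
        unfolding g_def by (intro tendsto_mult tendsto_power tendsto_const)
      then show ?thesis using False by (simp add: g0_def)
    qed
  qed
  moreover have "integral {0<..} g0 = 0"
  proof (rule integral_unique)
    show "(g0 has_integral 0) {0<..}"
      by (rule has_integral_spike[of "{t}" _ _ "\<lambda>_. 0"]) (auto simp: g0_def)
  qed
  ultimately have "(\<lambda>k. integral {0<..} (g k)) \<longlonglongrightarrow> 0" by simp
  then have "\<forall>\<^sub>F k in sequentially. integral {0<..} (g k) < e ^ 2" using e by (intro order_tendstoD) auto
  then obtain k where "integral {0<..} (g k) < e ^ 2" by (auto simp: eventually_sequentially)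
  then show ?thesis using gint[of k] d[of k] unfolding g_def by (intro exI[of _ "d k"]) auto
qed

lemma laguerre_bigo:
  assumes "a > -1" "t > 0"
  shows "(\<lambda>n. \<bar>laguerre (n + k) a t\<bar>) \<in> O(\<lambda>n. real n powr (a/2 - 1/4))"
proof -
  obtain C where C: "C > 0" "\<And>n. \<bar>laguerre n a t\<bar> \<le> C * (real n + 1) powr (a/2 - 1/4)"
    by (rule laguerre_pointwise_bound[OF assms]) blast
  have "\<bar>\<bar>laguerre (n + k) a t\<bar>\<bar> \<le> C * (real n + (real k + 1)) powr (a/2 - 1/4)" for n
    using C(2)[of "n + k"] by (simp add: add_ac)
  then show ?thesis by (rule real_le_powr_bigo) auto
qed

lemma inverse_lag_norm_bigo:
  assumes "a > -1"
  shows "(\<lambda>n. 1 / lag_norm (n + k) a) \<in> O(\<lambda>n. real n powr (- a))"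
proof -
  obtain c C where c: "c > 0" "C > 0" "\<And>n. lag_norm n a \<le> C * (real n + 1) powr a"
    "\<And>n. (real n + 1) powr a \<le> c * lag_norm n a"
    by (rule lag_norm_bounds[OF assms]) blast
  have "\<bar>1 / lag_norm (n + k) a\<bar> \<le> c * (real n + (real k + 1)) powr (- a)" for n
    using c(4)[of "n + k"] lag_norm_pos[OF assms, of "n + k"]
    by (simp add: powr_minus divide_simps add_ac)
  then show ?thesis by (rule real_le_powr_bigo) auto
qed

lemma laguerre_expansion:
  fixes f f' :: "real \<Rightarrow> 'a::banach"
  assumes a: "a > -1" and t: "t > 0"
    and df: "\<And>s. s > 0 \<Longrightarrow> (f has_vector_derivative f' s) (at s)" and contf': "continuous_on {0<..} f'"
    and fK: "\<And>s. s > 0 \<Longrightarrow> norm (f s) \<le> K" and f'K: "\<And>s. s > 0 \<Longrightarrow> norm (f' s) \<le> K"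
  shows "(\<lambda>n. laguerre n a t *\<^sub>R integral {0<..} (\<lambda>s. laguerre_fn n a s *\<^sub>R f s)) sums f t"
proof -
  have a1: "a + 1 > -1" using a by simp
  have K0: "K \<ge> 0" using order_trans[OF norm_ge_zero fK[of 1]] by simp
  have contf: "continuous_on {0<..} f"
    using df by (auto intro!: continuous_at_imp_continuous_on has_vector_derivative_continuous)
  have lip: "norm (f s - f t) \<le> K * \<bar>t - s\<bar>" if "s > 0" for s
  proof -
    have "norm (f s - f t) \<le> K * norm (s - t)"
    proof (rule differentiable_bound[of "{0<..}" f "\<lambda>x h. h *\<^sub>R f' x"])
      fix x :: real assume "x \<in> {0<..}"
      then show "(f has_derivative (\<lambda>h. h *\<^sub>R f' x)) (at x within {0<..})"
        using df[of x] by (auto simp: has_vector_derivative_def intro: has_derivative_at_withinI)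
      show "onorm (\<lambda>h. h *\<^sub>R f' x) \<le> K"
      proof (rule onorm_le)
        fix h :: real
        have "\<bar>h\<bar> * norm (f' x) \<le> \<bar>h\<bar> * K" using f'K[of x] \<open>x \<in> {0<..}\<close> by (intro mult_left_mono) auto
        then show "norm (h *\<^sub>R f' x) \<le> K * norm h" by (simp add: mult.commute)
      qed
    qed (use that t in auto)
    then show ?thesis by (simp add: abs_minus_commute)
  qed
  \<comment> \<open>The denominator t - s matches the factor in the Christoffel--Darboux formula,
    which explains the sign; the value at t makes \<open>q\<close> continuous.\<close>
  define q where "q = (\<lambda>s. if s = t then - f' t else (1 / (t - s)) *\<^sub>R (f s - f t))"
  have q_eq: "(t - s) *\<^sub>R q s = f s - f t" for s by (simp add: q_def)
  have qK: "norm (q s) \<le> K" if "s > 0" for s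
    using f'K[OF t] lip[OF that] by (cases "s = t") (auto simp: q_def pos_divide_le_eq)
  have contq: "continuous_on {0<..} q"
  proof (rule continuous_at_imp_continuous_on, rule ballI)
    fix s :: real assume s: "s \<in> {0<..}"
    show "isCont q s"
    proof (cases "s = t")
      case False
      have "isCont (\<lambda>s. (1 / (t - s)) *\<^sub>R (f s - f t)) s"
        using False s df[of s] by (intro continuous_intros) (auto intro: has_vector_derivative_continuous)
      moreover have "\<forall>\<^sub>F x in nhds s. q x = (1 / (t - x)) *\<^sub>R (f x - f t)"
        using t1_space_nhds[OF False] by eventually_elim (simp add: q_def)
      ultimately show ?thesis by (simp add: isCont_cong)
    next
      case True
      have "(f has_derivative (\<lambda>h. h *\<^sub>R f' t)) (at t)" using df[OF t] by (simp add: has_vector_derivative_def)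
      then have "((\<lambda>y. norm (f y - f t - (y - t) *\<^sub>R f' t) / norm (y - t)) \<longlongrightarrow> 0) (at t)"
        by (simp add: has_derivative_iff_norm)
      then have "((\<lambda>y. norm (q y - q t)) \<longlongrightarrow> 0) (at t)"
      proof (rule Lim_transform_eventually)
        show "\<forall>\<^sub>F y in at t. norm (f y - f t - (y - t) *\<^sub>R f' t) / norm (y - t) = norm (q y - q t)"
          unfolding eventually_at_filter
        proof (intro always_eventually allI impI)
          fix y assume y: "y \<noteq> t"
          have "f y - f t - (y - t) *\<^sub>R f' t = (t - y) *\<^sub>R (q y - q t)"
            unfolding q_eq[of y, symmetric] scaleR_diff_right by (simp add: q_def scaleR_diff_left)
          then show "norm (f y - f t - (y - t) *\<^sub>R f' t) / norm (y - t) = norm (q y - q t)"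
            using y by (simp add: abs_minus_commute)
        qed
      qed
      then have "(q \<longlongrightarrow> q t) (at t)"
        by (rule LIM_zero_cancel[OF tendsto_norm_zero_cancel])
      then show ?thesis using True by (simp add: isCont_def)
    qed
  qed
  have qK1: "norm (q s) \<le> K * (1 + s)" if "s > 0" for s
    using qK[OF that] mult_left_mono[of 1 "1 + s" K] K0 that by auto
  have rl: "(\<lambda>n. norm (integral {0<..} (\<lambda>s. lag_w n b s *\<^sub>R q s))) \<in> o(\<lambda>n. real n powr (b/2 - 1/4))" if b: "b > -1" for b
  proof (rule lag_w_integral_smallo[OF b contq qK])
    fix e :: real assume "e > 0"
    from cauchy_kernel_weight_small[OF b this, of K t] obtain d where d: "d > 0"
      and int: "(\<lambda>s. s powr b * exp (- (2/3) * s) * (K * (d ^ 2 / ((t - s) ^ 2 + d ^ 2))) ^ 2) integrable_on {0<..}"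
       "integral {0<..} (\<lambda>s. s powr b * exp (- (2/3) * s) * (K * (d ^ 2 / ((t - s) ^ 2 + d ^ 2))) ^ 2) \<le> e ^ 2"
      by blast
    define D where "D = (\<lambda>s. (t - s) ^ 2 + d ^ 2)"
    have D: "D s > 0" for s using d unfolding D_def by (intro add_nonneg_pos) auto
    \<comment> \<open>The regularized quotient: 1/(t - s) is replaced by (t - s)/D(s). Its
      derivative is continuous and bounded, and q - p is q times d^2/D(s).\<close>
    define p where "p = (\<lambda>s. ((t - s) / D s) *\<^sub>R (f s - f t))"
    define p' where "p' = (\<lambda>s. ((t - s) / D s) *\<^sub>R f' s + (((t - s) ^ 2 - d ^ 2) / D s ^ 2) *\<^sub>R (f s - f t))"
    have dp: "(p has_vector_derivative p' s) (at s)" if s: "s > 0" for s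
    proof -
      have "((\<lambda>s. (t - s) / D s) has_real_derivative ((- 1) * D s - (t - s) * (- 2 * (t - s))) / (D s * D s)) (at s)"
      proof (rule DERIV_divide)
        show "((\<lambda>s. t - s) has_real_derivative - 1) (at s)" by (auto intro!: derivative_eq_intros)
        show "(D has_real_derivative - 2 * (t - s)) (at s)" unfolding D_def by (auto intro!: derivative_eq_intros)
        show "D s \<noteq> 0" using D[of s] by simp
      qed
      moreover have "(- 1) * D s - (t - s) * (- 2 * (t - s)) = (t - s) ^ 2 - d ^ 2"
        by (simp add: D_def power2_eq_square algebra_simps)
      ultimately have "((\<lambda>s. (t - s) / D s) has_real_derivative ((t - s) ^ 2 - d ^ 2) / D s ^ 2) (at s)"
        by (simp add: power2_eq_square)
      moreover have "((\<lambda>s. f s - f t) has_vector_derivative f' s) (at s)"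
        using has_vector_derivative_diff[OF df[OF s] has_vector_derivative_const[of "f t"]] by simp
      ultimately show ?thesis unfolding p_def p'_def by (intro has_vector_derivative_scaleR)
    qed
    have contD: "continuous_on {0<..} D" unfolding D_def by (intro continuous_intros)
    have Dnz: "D s \<noteq> 0" for s using D[of s] by simp
    have contp': "continuous_on {0<..} p'" unfolding p'_def
      by (intro continuous_intros contD contf contf') (auto simp: Dnz)
    have frac: "\<bar>t - s\<bar> / D s \<le> 1 / d" for s
    proof -
      have "0 \<le> (\<bar>t - s\<bar> - d) ^ 2" by simp
      also have "\<dots> = D s - 2 * d * \<bar>t - s\<bar>" by (simp add: D_def power2_diff algebra_simps)
      finally have "2 * (d * \<bar>t - s\<bar>) \<le> D s" by simp
      moreover have "d * \<bar>t - s\<bar> \<ge> 0" using d by simp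
      ultimately have "d * \<bar>t - s\<bar> \<le> D s" by linarith
      then show ?thesis using d D[of s] by (simp add: field_simps)
    qed
    define L where "L = K + 2 * K / d"
    have pL: "norm (p s) \<le> L" if s: "s > 0" for s
    proof -
      have "norm (p s) = \<bar>t - s\<bar> / D s * norm (f s - f t)" using D[of s] by (simp add: p_def)
      also have "\<dots> \<le> \<bar>t - s\<bar> / D s * (K * \<bar>t - s\<bar>)" using D[of s] lip[OF s] by (intro mult_left_mono) auto
      also have "\<dots> = K * ((t - s) ^ 2 / D s)" by (simp add: power2_eq_square)
      also have "\<dots> \<le> K * 1" using K0 D[of s] by (intro mult_left_mono) (auto simp: D_def divide_simps)
      also have "\<dots> \<le> L" using K0 d by (simp add: L_def)
      finally show ?thesis .
    qed
    have p'L: "norm (p' s) \<le> L" if s: "s > 0" for s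
    proof -
      have 1: "norm (((t - s) / D s) *\<^sub>R f' s) \<le> K / d"
      proof -
        have "norm (((t - s) / D s) *\<^sub>R f' s) = \<bar>t - s\<bar> / D s * norm (f' s)" using D[of s] by simp
        also have "\<dots> \<le> 1 / d * K" using frac[of s] f'K[OF s] d by (intro mult_mono) auto
        finally show ?thesis by simp
      qed
      have 2: "norm ((((t - s) ^ 2 - d ^ 2) / D s ^ 2) *\<^sub>R (f s - f t)) \<le> K / d"
      proof -
        have "\<bar>(t - s) ^ 2 - d ^ 2\<bar> \<le> D s" unfolding D_def abs_le_iff by simp
        then have "\<bar>(t - s) ^ 2 - d ^ 2\<bar> / D s ^ 2 \<le> D s / D s ^ 2" by (intro divide_right_mono) auto
        then have le: "\<bar>((t - s) ^ 2 - d ^ 2) / D s ^ 2\<bar> \<le> 1 / D s" using D[of s] by (simp add: power2_eq_square)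
        have "norm ((((t - s) ^ 2 - d ^ 2) / D s ^ 2) *\<^sub>R (f s - f t)) = \<bar>((t - s) ^ 2 - d ^ 2) / D s ^ 2\<bar> * norm (f s - f t)" by simp
        also have "\<dots> \<le> 1 / D s * (K * \<bar>t - s\<bar>)" using lip[OF s] le D[of s] by (intro mult_mono) auto
        also have "\<dots> = K * (\<bar>t - s\<bar> / D s)" by simp
        also have "\<dots> \<le> K * (1 / d)" using K0 frac[of s] by (intro mult_left_mono) auto
        finally show ?thesis by simp
      qed
      have "norm (p' s) \<le> K / d + K / d" unfolding p'_def by (rule norm_triangle_mono[OF 1 2])
      also have "\<dots> \<le> L" using K0 by (simp add: L_def)
      finally show ?thesis .
    qed
    have diff: "norm (q s - p s) \<le> K * (d ^ 2 / ((t - s) ^ 2 + d ^ 2))" if s: "s > 0" for s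
    proof -
      have "q s - p s = (1 - (t - s) / D s * (t - s)) *\<^sub>R q s"
        unfolding p_def q_eq[of s, symmetric] scaleR_scaleR scaleR_left_diff_distrib[of 1] by simp
      also have "1 - (t - s) / D s * (t - s) = d ^ 2 / D s"
        using D[of s] by (simp add: field_simps) (simp add: D_def power2_eq_square algebra_simps)
      finally have "norm (q s - p s) = d ^ 2 / D s * norm (q s)" using D[of s] by simp
      also have "\<dots> \<le> d ^ 2 / D s * K" using D[of s] qK[OF s] by (intro mult_left_mono) auto
      finally show ?thesis by (simp add: D_def mult.commute)
    qed
    show "\<exists>p p' \<eta> L. (\<forall>s>0. (p has_vector_derivative p' s) (at s)) \<and> continuous_on {0<..} p' \<and>
        (\<forall>s>0. norm (p s) \<le> L) \<and> (\<forall>s>0. norm (p' s) \<le> L) \<and> (\<forall>s>0. norm (q s - p s) \<le> \<eta> s) \<and>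
        (\<lambda>s. s powr b * exp (- (2/3) * s) * \<eta> s ^ 2) integrable_on {0<..} \<and>
        integral {0<..} (\<lambda>s. s powr b * exp (- (2/3) * s) * \<eta> s ^ 2) \<le> e ^ 2"
      by (intro exI[of _ p] exI[of _ p'] exI[of _ L] exI[of _ "\<lambda>s. K * (d ^ 2 / ((t - s) ^ 2 + d ^ 2))"] conjI allI impI
          dp contp' pL p'L diff int)
  qed
  define S where "S = (\<lambda>N. \<Sum>n\<le>N. laguerre n a t *\<^sub>R integral {0<..} (\<lambda>s. laguerre_fn n a s *\<^sub>R f s))"
  \<comment> \<open>\<open>laguerre_raise_Suc\<close>, applied in the variable s, produces
    \<open>I1\<close> and \<open>I2\<close>; applied at t, it produces the coefficient
    \<open>R\<close> of \<open>I3\<close>.\<close>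
  define I1 where "I1 = (\<lambda>m. integral {0<..} (\<lambda>s. lag_w m (a + 1) s *\<^sub>R q s))"
  define I2 where "I2 = (\<lambda>m. integral {0<..} (\<lambda>s. lag_w m a s *\<^sub>R ((a - s) *\<^sub>R q s)))"
  define I3 where "I3 = (\<lambda>m. integral {0<..} (\<lambda>s. lag_w m a s *\<^sub>R q s))"
  define R where "R = (\<lambda>m. - t * laguerre m (a + 1) t + (a - t) * laguerre (Suc m) a t)"
  have contaq: "continuous_on {0<..} (\<lambda>s. (a - s) *\<^sub>R q s)" by (intro continuous_intros contq)
  have aqK: "norm ((a - s) *\<^sub>R q s) \<le> ((\<bar>a\<bar> + 1) * K) * (1 + s)" if s: "s > 0" for s
  proof -
    have "\<bar>a - s\<bar> \<le> \<bar>a\<bar> + s" using s by linarith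
    also have "\<dots> \<le> (\<bar>a\<bar> + 1) * (1 + s)" using s by (simp add: algebra_simps)
    finally have "\<bar>a - s\<bar> * norm (q s) \<le> (\<bar>a\<bar> + 1) * (1 + s) * K" using qK[OF s] s by (intro mult_mono) auto
    then show ?thesis by (simp add: mult_ac)
  qed
  have fint: "(\<lambda>s. laguerre_fn n a s *\<^sub>R f s) integrable_on {0<..}" for n
  proof (rule dominated_integrable_halfline)
    show "continuous_on {0<..} (\<lambda>s. laguerre_fn n a s *\<^sub>R f s)" by (intro continuous_intros contf)
    show "(\<lambda>s. \<bar>laguerre_fn n a s\<bar> * K) integrable_on {0<..}"
      by (intro integrable_on_mult_left integrable_abs_laguerre_fn a)
  qed (auto intro!: mult_left_mono fK)
  have error: "S (Suc m) - f t = (1 / lag_norm (Suc m) a) *\<^sub>R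
      ((- laguerre (Suc m) a t) *\<^sub>R I1 m + laguerre (Suc m) a t *\<^sub>R I2 (Suc m) - R m *\<^sub>R I3 (Suc m))" for m
  proof -
    \<comment> \<open>\<open>laguerre_fn n a\<close> has integral 1 for n = 0 and 0 otherwise, so
      replacing f by f - f t changes only the term n = 0, and the partial sum becomes the
      error.\<close>
    have has1: "((\<lambda>s. laguerre_fn n a s *\<^sub>R (f s - f t)) has_integral
       (integral {0<..} (\<lambda>s. laguerre_fn n a s *\<^sub>R f s) - (if n = 0 then 1 else 0) *\<^sub>R f t)) {0<..}" for n
    proof -
      have "((\<lambda>s. laguerre_fn n a s * laguerre 0 a s) has_integral (if n = 0 then 1 else 0)) {0<..}"
        by (rule laguerre_orthogonal[OF a])
      then have "((\<lambda>s. laguerre_fn n a s *\<^sub>R f t) has_integral (if n = 0 then 1 else 0) *\<^sub>R f t) {0<..}"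
        by (intro has_integral_scaleR_left) simp
      from has_integral_diff[OF integrable_integral[OF fint] this] show ?thesis
        by (simp only: scaleR_diff_right)
    qed
    have "((\<lambda>s. \<Sum>n\<le>Suc m. laguerre n a t *\<^sub>R (laguerre_fn n a s *\<^sub>R (f s - f t))) has_integral
       (\<Sum>n\<le>Suc m. laguerre n a t *\<^sub>R (integral {0<..} (\<lambda>s. laguerre_fn n a s *\<^sub>R f s) - (if n = 0 then 1 else 0) *\<^sub>R f t))) {0<..}"
      by (intro has_integral_sum has_integral_cmul has1) auto
    moreover have "(\<Sum>n\<le>Suc m. laguerre n a t *\<^sub>R (integral {0<..} (\<lambda>s. laguerre_fn n a s *\<^sub>R f s) - (if n = 0 then 1 else 0) *\<^sub>R f t))
        = S (Suc m) - f t"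
    proof -
      have "(\<Sum>n\<le>Suc m. laguerre n a t *\<^sub>R ((if n = 0 then 1 else 0) *\<^sub>R f t)) = (\<Sum>n\<le>Suc m. if n = 0 then f t else 0)"
        by (intro sum.cong) auto
      also have "\<dots> = f t" by simp
      finally show ?thesis unfolding S_def scaleR_diff_right sum_subtractf by simp
    qed
    ultimately have h1: "((\<lambda>s. \<Sum>n\<le>Suc m. laguerre n a t *\<^sub>R (laguerre_fn n a s *\<^sub>R (f s - f t))) has_integral (S (Suc m) - f t)) {0<..}"
      by (simp only:)
    have "((\<lambda>s. (1 / lag_norm (Suc m) a) *\<^sub>R ((- laguerre (Suc m) a t) *\<^sub>R (lag_w m (a + 1) s *\<^sub>R q s)
         + laguerre (Suc m) a t *\<^sub>R (lag_w (Suc m) a s *\<^sub>R ((a - s) *\<^sub>R q s)) - R m *\<^sub>R (lag_w (Suc m) a s *\<^sub>R q s))) has_integral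
       (1 / lag_norm (Suc m) a) *\<^sub>R ((- laguerre (Suc m) a t) *\<^sub>R I1 m + laguerre (Suc m) a t *\<^sub>R I2 (Suc m) - R m *\<^sub>R I3 (Suc m))) {0<..}"
      unfolding I1_def I2_def I3_def
      by (intro has_integral_cmul has_integral_add has_integral_diff integrable_integral
          lag_w_integral_bigo(1)[OF a1 contq qK1] lag_w_integral_bigo(1)[OF a contq qK1] lag_w_integral_bigo(1)[OF a contaq aqK])
    moreover have "(1 / lag_norm (Suc m) a) *\<^sub>R ((- laguerre (Suc m) a t) *\<^sub>R (lag_w m (a + 1) s *\<^sub>R q s)
         + laguerre (Suc m) a t *\<^sub>R (lag_w (Suc m) a s *\<^sub>R ((a - s) *\<^sub>R q s)) - R m *\<^sub>R (lag_w (Suc m) a s *\<^sub>R q s))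
       = (\<Sum>n\<le>Suc m. laguerre n a t *\<^sub>R (laguerre_fn n a s *\<^sub>R (f s - f t)))" if s: "s \<in> {0<..}" for s
    proof -
      let ?N = "Suc m"
      have R: "real (Suc ?N) * laguerre (Suc ?N) (a - 1) t = R m" unfolding R_def by (rule laguerre_raise_Suc)
      have "(t - s) * (\<Sum>n\<le>?N. fact n / Gamma (real n + a + 1) * laguerre n a t * laguerre n a s)
        = 1 / lag_norm ?N a * (laguerre ?N a t * (real (Suc ?N) * laguerre (Suc ?N) (a - 1) s) - (real (Suc ?N) * laguerre (Suc ?N) (a - 1) t) * laguerre ?N a s)"
        unfolding christoffel_darboux[OF a] lag_norm_def by (simp add: field_simps)
      also have "\<dots> = 1 / lag_norm ?N a * (laguerre ?N a t * (- s * laguerre m (a + 1) s + (a - s) * laguerre ?N a s) - R m * laguerre ?N a s)"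
        unfolding R unfolding laguerre_raise_Suc ..
      finally have cd: "(t - s) * (\<Sum>n\<le>?N. fact n / Gamma (real n + a + 1) * laguerre n a t * laguerre n a s)
         = 1 / lag_norm ?N a * (laguerre ?N a t * (- s * laguerre m (a + 1) s + (a - s) * laguerre ?N a s) - R m * laguerre ?N a s)" .
      have "(\<Sum>n\<le>?N. laguerre n a t * laguerre_fn n a s) * (t - s)
         = s powr a * exp (- s) * ((t - s) * (\<Sum>n\<le>?N. fact n / Gamma (real n + a + 1) * laguerre n a t * laguerre n a s))"
        unfolding sum_distrib_left sum_distrib_right by (intro sum.cong) (auto simp: laguerre_fn_def)
      also have "\<dots> = 1 / lag_norm ?N a * (- laguerre ?N a t * lag_w m (a + 1) s
         + laguerre ?N a t * (lag_w ?N a s * (a - s)) - R m * lag_w ?N a s)"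
        unfolding cd lag_w_def using s by (simp add: powr_add algebra_simps)
      finally have key: "(\<Sum>n\<le>?N. laguerre n a t * laguerre_fn n a s) * (t - s) = 1 / lag_norm ?N a * (- laguerre ?N a t * lag_w m (a + 1) s
         + laguerre ?N a t * (lag_w ?N a s * (a - s)) - R m * lag_w ?N a s)" .
      have "(\<Sum>n\<le>?N. laguerre n a t *\<^sub>R (laguerre_fn n a s *\<^sub>R (f s - f t))) = ((\<Sum>n\<le>?N. laguerre n a t * laguerre_fn n a s) * (t - s)) *\<^sub>R q s"
        unfolding q_eq[symmetric] scaleR_scaleR sum_distrib_right scaleR_sum_left mult.assoc ..
      then show ?thesis unfolding key
        by (simp only: scaleR_scaleR[symmetric] scaleR_left_distrib scaleR_left_diff_distrib)
    qed
    ultimately have "((\<lambda>s. \<Sum>n\<le>Suc m. laguerre n a t *\<^sub>R (laguerre_fn n a s *\<^sub>R (f s - f t))) has_integral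
       (1 / lag_norm (Suc m) a) *\<^sub>R ((- laguerre (Suc m) a t) *\<^sub>R I1 m + laguerre (Suc m) a t *\<^sub>R I2 (Suc m) - R m *\<^sub>R I3 (Suc m))) {0<..}"
      by (rule has_integral_eq[rotated])
    with h1 show ?thesis by (rule has_integral_unique)
  qed
  \<comment> \<open>Orders of magnitude: \<open>w\<close> for the inverse norm, \<open>u\<close> for
    parameter a, \<open>v\<close> for a + 1. The product w u v is bounded and w u u is n^(-1/2). So
    the terms with \<open>I1\<close> and \<open>I3\<close> need the Riemann--Lebesgue improvement,
    whereas a big-O bound suffices for \<open>I2\<close>.\<close>
  define w where "w = (\<lambda>m::nat. real m powr (- a))"
  define u where "u = (\<lambda>m::nat. real m powr (a/2 - 1/4))"
  define v where "v = (\<lambda>m::nat. real m powr ((a + 1)/2 - 1/4))"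
  have shift: "(\<lambda>m. real (Suc m) powr (a/2 - 1/4)) \<in> O(u)" unfolding u_def by real_asymp
  have uv: "u \<in> O(v)"
  proof (rule bigoI[of _ 1], rule eventually_sequentiallyI[of 1])
    fix m :: nat assume "m \<ge> 1"
    then show "norm (u m) \<le> 1 * norm (v m)" by (simp add: u_def v_def powr_mono add_divide_distrib)
  qed
  have wO: "(\<lambda>m. 1 / lag_norm (Suc m) a) \<in> O(w)" using inverse_lag_norm_bigo[OF a, of 1] by (simp add: w_def)
  have LO: "(\<lambda>m. \<bar>laguerre (Suc m) a t\<bar>) \<in> O(u)" using laguerre_bigo[OF a t, of 1] by (simp add: u_def)
  have LO1: "(\<lambda>m. \<bar>laguerre m (a + 1) t\<bar>) \<in> O(v)" using laguerre_bigo[OF a1 t, of 0] by (simp add: v_def)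
  have RO: "(\<lambda>m. \<bar>R m\<bar>) \<in> O(v)"
  proof -
    have "(\<lambda>m. laguerre m (a + 1) t) \<in> O(v)" "(\<lambda>m. laguerre (Suc m) a t) \<in> O(v)"
      using LO1 landau_o.big_trans[OF LO uv] by simp_all
    then show ?thesis unfolding R_def by (simp add: sum_in_bigo)
  qed
  have I1o: "(\<lambda>m. norm (I1 m)) \<in> o(v)" unfolding I1_def v_def by (rule rl[OF a1])
  have I2O: "(\<lambda>m. norm (I2 (Suc m))) \<in> O(u)"
  proof -
    have "(\<lambda>m. norm (I2 m)) \<in> O(\<lambda>n. real n powr (a/2 - 1/4))"
      unfolding I2_def by (rule lag_w_integral_bigo(2)[OF a contaq aqK])
    from landau_o.big.compose[OF this filterlim_Suc] show ?thesis by (rule landau_o.big_trans[OF _ shift])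
  qed
  have I3o: "(\<lambda>m. norm (I3 (Suc m))) \<in> o(u)"
    using landau_o.small_big_trans[OF landau_o.small.compose[OF rl[OF a] filterlim_Suc] shift] unfolding I3_def .
  have prod1: "(\<lambda>m. w m * (u m * v m)) \<in> O(\<lambda>_. 1)"
    by (rule bigoI[of _ 1], rule always_eventually) (auto simp: w_def u_def v_def powr_add[symmetric] add_divide_distrib)
  have prod2: "(\<lambda>m. w m * (u m * u m)) \<in> o(\<lambda>_. 1)"
  proof -
    have "w m * (u m * u m) = real m powr (- 1/2)" for m by (simp add: w_def u_def powr_add[symmetric])
    moreover have "(\<lambda>m. real m powr (- 1/2)) \<in> o(\<lambda>_. 1)" by real_asymp
    ultimately show ?thesis by simp
  qed
  have e1: "(\<lambda>m. 1 / lag_norm (Suc m) a * (\<bar>laguerre (Suc m) a t\<bar> * norm (I1 m))) \<in> o(\<lambda>_. 1)"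
    by (rule landau_o.small_big_trans[OF _ prod1]) (intro landau_o.big_small_mult wO LO I1o)
  have e2: "(\<lambda>m. 1 / lag_norm (Suc m) a * (\<bar>laguerre (Suc m) a t\<bar> * norm (I2 (Suc m)))) \<in> o(\<lambda>_. 1)"
    by (rule landau_o.big_small_trans[OF _ prod2]) (intro landau_o.big.mult wO LO I2O)
  have e3: "(\<lambda>m. 1 / lag_norm (Suc m) a * (norm (I3 (Suc m)) * \<bar>R m\<bar>)) \<in> o(\<lambda>_. 1)"
    by (rule landau_o.small_big_trans[OF _ prod1]) (intro landau_o.big_small_mult[OF wO] landau_o.small_big_mult RO I3o)
  have "(\<lambda>m. 1 / lag_norm (Suc m) a * (\<bar>laguerre (Suc m) a t\<bar> * norm (I1 m)) + 1 / lag_norm (Suc m) a * (\<bar>laguerre (Suc m) a t\<bar> * norm (I2 (Suc m)))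
      + 1 / lag_norm (Suc m) a * (norm (I3 (Suc m)) * \<bar>R m\<bar>)) \<in> o(\<lambda>_. 1)"
    by (intro sum_in_smallo e1 e2 e3)
  from smalloD_tendsto[OF this] have lim: "(\<lambda>m. 1 / lag_norm (Suc m) a * (\<bar>laguerre (Suc m) a t\<bar> * norm (I1 m)) + 1 / lag_norm (Suc m) a * (\<bar>laguerre (Suc m) a t\<bar> * norm (I2 (Suc m)))
      + 1 / lag_norm (Suc m) a * (norm (I3 (Suc m)) * \<bar>R m\<bar>)) \<longlonglongrightarrow> 0" by simp
  have "(\<lambda>m. S (Suc m) - f t) \<longlonglongrightarrow> 0"
  proof (rule Lim_null_comparison[OF always_eventually lim], rule allI)
    fix m
    let ?c = "1 / lag_norm (Suc m) a"
    have c: "?c \<ge> 0" using lag_norm_pos[OF a, of "Suc m"] by simp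
    have "norm (S (Suc m) - f t) = ?c * norm ((- laguerre (Suc m) a t) *\<^sub>R I1 m + laguerre (Suc m) a t *\<^sub>R I2 (Suc m) - R m *\<^sub>R I3 (Suc m))"
      unfolding error using c by simp
    also have "\<dots> \<le> ?c * (norm ((- laguerre (Suc m) a t) *\<^sub>R I1 m) + norm (laguerre (Suc m) a t *\<^sub>R I2 (Suc m)) + norm (R m *\<^sub>R I3 (Suc m)))"
      using c by (intro mult_left_mono norm_triangle_le_diff add_right_mono norm_triangle_ineq) auto
    finally show "norm (S (Suc m) - f t) \<le> ?c * (\<bar>laguerre (Suc m) a t\<bar> * norm (I1 m)) + ?c * (\<bar>laguerre (Suc m) a t\<bar> * norm (I2 (Suc m))) + ?c * (norm (I3 (Suc m)) * \<bar>R m\<bar>)"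
      by (simp add: distrib_left mult_ac)
  qed
  then have "(\<lambda>m. S (Suc m)) \<longlonglongrightarrow> f t" by (simp add: LIM_zero_iff)
  then have "S \<longlonglongrightarrow> f t" by (simp add: filterlim_sequentially_Suc)
  then show ?thesis unfolding S_def sums_def_le .
qed

section \<open>Laplace transforms\<close>

text \<open>The scalar model of part (i): integration by parts multiplies the transform by s while
  the index rises and the parameter falls. The base case is a Gamma integral.\<close>

lemma has_integral_laguerre_fn_exp:
  assumes "a > -1" and s: "s > 0"
  shows "((\<lambda>t. laguerre_fn n a t * exp (- s * t)) has_integral phi_fn n a s) {0<..}"
  using assms(1)
proof (induction n arbitrary: a)
  case (0 a)
  have G: "Gamma (a + 1) > 0" using 0 by (intro Gamma_real_pos) auto
  have "((\<lambda>t. 1 / Gamma (a + 1) * (t powr a * exp (- (1 + s) * t))) has_integral 1 / Gamma (a + 1) * (Gamma (a + 1) / (1 + s) powr (a + 1))) {0<..}"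
    by (intro has_integral_mult_right has_integral_powr_exp) (use 0 s in auto)
  moreover have "1 / Gamma (a + 1) * (Gamma (a + 1) / (1 + s) powr (a + 1)) = phi_fn 0 a s"
    using G by (simp add: phi_fn_def add.commute)
  moreover have "1 / Gamma (a + 1) * (t powr a * exp (- (1 + s) * t)) = laguerre_fn 0 a t * exp (- s * t)" for t
    by (simp add: laguerre_fn_def exp_add[symmetric] algebra_simps)
  ultimately show ?case by simp
next
  case (Suc n a)
  have lim: "((\<lambda>t. laguerre_fn n (a + 1) t * exp (- s * t)) \<longlongrightarrow> 0) (at_right 0)"
    "((\<lambda>t. laguerre_fn n (a + 1) t * exp (- s * t)) \<longlongrightarrow> 0) at_top"
  proof -
    have "((\<lambda>t. exp (- s * t)) \<longlongrightarrow> 1) (at_right 0)" by real_asymp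
    from tendsto_mult[OF laguerre_fn_mult_poly_tendsto_0[of "a + 1" n 1] this] Suc.prems
    show "((\<lambda>t. laguerre_fn n (a + 1) t * exp (- s * t)) \<longlongrightarrow> 0) (at_right 0)" by simp
    have "((\<lambda>t. exp (- s * t)) \<longlongrightarrow> 0) at_top" using s by real_asymp
    from tendsto_mult[OF laguerre_fn_mult_poly_tendsto_top[of n "a + 1" 1] this]
    show "((\<lambda>t. laguerre_fn n (a + 1) t * exp (- s * t)) \<longlongrightarrow> 0) at_top" by simp
  qed
  have "((\<lambda>t. laguerre_fn (Suc n) a t * exp (- s * t) - s * (laguerre_fn n (a + 1) t * exp (- s * t))) has_integral (0 - 0)) {0<..}"
  proof (rule FTC_halfline[OF _ lim])
    fix t :: real assume "t > 0"
    from laguerre_fn_has_real_derivative[OF this, of n "a + 1"]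
    have "(laguerre_fn n (a + 1) has_real_derivative laguerre_fn (Suc n) a t) (at t)" by simp
    moreover have "((\<lambda>t. exp (- s * t)) has_real_derivative - s * exp (- s * t)) (at t)"
      by (auto intro!: derivative_eq_intros)
    ultimately have "((\<lambda>t. laguerre_fn n (a + 1) t * exp (- s * t)) has_real_derivative
        laguerre_fn (Suc n) a t * exp (- s * t) + - s * exp (- s * t) * laguerre_fn n (a + 1) t) (at t)"
      by (rule DERIV_mult)
    then show "((\<lambda>t. laguerre_fn n (a + 1) t * exp (- s * t)) has_vector_derivative
        laguerre_fn (Suc n) a t * exp (- s * t) - s * (laguerre_fn n (a + 1) t * exp (- s * t))) (at t)"
      by (simp add: has_real_derivative_iff_has_vector_derivative[symmetric] mult_ac)
  qed
  from has_integral_add[OF this has_integral_mult_right[OF Suc.IH[of "a + 1"], of s]] Suc.prems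
  have "((\<lambda>t. laguerre_fn (Suc n) a t * exp (- s * t)) has_integral s * phi_fn n (a + 1) s) {0<..}" by simp
  moreover have "s * phi_fn n (a + 1) s = phi_fn (Suc n) a s"
    by (simp add: phi_fn_def add_ac)
  ultimately show ?case by simp
qed

section \<open>The functions phi_n: algebra, Beta integrals and decay\<close>

lemma phi_fn_diff:
  assumes "s > 0"
  shows "phi_fn n a s - phi_fn (Suc n) a s = phi_fn n (a + 1) s"
proof -
  have "(s + 1) powr (real n + (a + 1) + 1) = (s + 1) * (s + 1) powr (real n + a + 1)"
    using assms powr_add[of "s + 1" 1 "real n + a + 1"] by (simp add: add_ac)
  moreover have "real (Suc n) + a + 1 = real n + (a + 1) + 1" by simp
  moreover obtain E where "(s + 1) powr (real n + a + 1) = E" "E > 0" using assms by simp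
  ultimately show ?thesis using assms unfolding phi_fn_def
    by (simp only:) (simp add: divide_simps, simp add: algebra_simps)
qed

lemma phi_fn_nonneg: "s > 0 \<Longrightarrow> phi_fn n a s \<ge> 0"
  by (simp add: phi_fn_def)

lemma continuous_phi_fn [continuous_intros]: "continuous_on {0<..} (phi_fn n a)"
  unfolding phi_fn_def[abs_def] by (intro continuous_intros) auto

text \<open>In this form a Laguerre series with coefficients \<open>phi_fn\<close> is a power series
  in s/(s + 1).\<close>

lemma phi_fn_eq: "s > 0 \<Longrightarrow> phi_fn n a s = (s / (s + 1)) ^ n * (s + 1) powr (- a - 1)"
proof -
  assume s: "s > 0"
  have "(s + 1) powr (real n + a + 1) = (s + 1) ^ n * (s + 1) powr (a + 1)"
    using s by (simp add: powr_add powr_realpow add.assoc)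
  moreover have "(s + 1) powr (- a - 1) = 1 / (s + 1) powr (a + 1)"
    using s powr_minus[of "s + 1" "a + 1"] by (simp add: divide_inverse)
  ultimately show ?thesis by (simp add: phi_fn_def power_divide)
qed

lemma has_integral_phi_fn:
  assumes a: "a > 0"
  shows "(phi_fn n a has_integral fact n / pochhammer a (Suc n)) {0<..}"
proof (induction n)
  case 0
  have "((\<lambda>t. (t + 1) powr (- a - 1)) has_integral (0 - (- (1 / a)))) {0<..}"
  proof (rule FTC_halfline[where F = "\<lambda>t. - ((t + 1) powr (- a) / a)"])
    fix t :: real assume t: "t > 0"
    have "((\<lambda>t. - ((t + 1) powr (- a) / a)) has_real_derivative (t + 1) powr (- a - 1)) (at t)"
      using t a by (auto intro!: derivative_eq_intros simp: field_simps)
    then show "((\<lambda>t. - ((t + 1) powr (- a) / a)) has_vector_derivative (t + 1) powr (- a - 1)) (at t)"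
      by (simp add: has_real_derivative_iff_has_vector_derivative)
  next
    show "((\<lambda>t. - ((t + 1) powr (- a) / a)) \<longlongrightarrow> - (1 / a)) (at_right 0)"
    proof -
      have "((\<lambda>t. - ((t + 1) powr (- a) / a)) \<longlongrightarrow> - ((0 + 1) powr (- a) / a)) (at_right 0)"
        using a by (intro tendsto_intros) auto
      then show ?thesis by simp
    qed
    show "((\<lambda>t. - ((t + 1) powr (- a) / a)) \<longlongrightarrow> 0) at_top" using a by real_asymp
  qed
  then have "((\<lambda>t. (t + 1) powr (- a - 1)) has_integral (fact 0 / pochhammer a (Suc 0))) {0<..}" by simp
  then show ?case by (rule has_integral_eq[rotated]) (simp add: phi_fn_eq)
next
  case (Suc n)
  \<comment> \<open>A primitive of (n+1) phi_n - (n+1+a) phi_(n+1) that vanishes at both ends; it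
    gives the recurrence of the Beta integral B(n+1, a).\<close>
  define F where "F = (\<lambda>t::real. t ^ Suc n * (t + 1) powr (- (real (Suc n) + a)))"
  have Fle: "\<bar>F t\<bar> \<le> (t + 1) powr (- a)" "\<bar>F t\<bar> \<le> t" if t: "t > 0" for t
  proof -
    have F: "F t = (t / (t + 1)) ^ Suc n * (t + 1) powr (- a)"
      using t powr_realpow[of "t + 1" "Suc n"] unfolding F_def
      by (simp add: powr_diff powr_minus power_divide powr_add field_simps del: power_Suc of_nat_Suc)
    have "(t / (t + 1)) ^ Suc n \<le> 1" using t by (intro power_le_one) auto
    from mult_right_mono[OF this, of "(t + 1) powr (- a)"] show "\<bar>F t\<bar> \<le> (t + 1) powr (- a)"
      using t unfolding F by (simp add: abs_mult del: power_Suc)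
    have "(t / (t + 1)) ^ Suc n \<le> (t / (t + 1)) ^ 1" using t by (intro power_decreasing) auto
    also have "\<dots> \<le> t" using t by (simp add: field_simps)
    finally have 1: "(t / (t + 1)) ^ Suc n \<le> t" .
    have "(t + 1) powr (- a) \<le> (t + 1) powr 0" using t a by (intro powr_mono) auto
    then have "(t + 1) powr (- a) \<le> 1" using t by simp
    from mult_mono[OF 1 this] show "\<bar>F t\<bar> \<le> t" using t unfolding F by (simp add: abs_mult del: power_Suc)
  qed
  have "((\<lambda>t. real (Suc n) * phi_fn n a t - (real (Suc n) + a) * phi_fn (Suc n) a t) has_integral (0 - 0)) {0<..}"
  proof (rule FTC_halfline[where F = F])
    fix t :: real assume t: "t > 0"
    have "((\<lambda>t. t ^ Suc n * (t + 1) powr (- (real (Suc n) + a))) has_real_derivative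
        (real (Suc n) * t ^ n) * (t + 1) powr (- (real (Suc n) + a)) + (- (real (Suc n) + a) * (t + 1) powr (- (real (Suc n) + a) - 1)) * t ^ Suc n) (at t)"
      (is "(_ has_real_derivative ?d) _")
    proof (rule DERIV_mult)
      show "((\<lambda>t. t ^ Suc n) has_real_derivative real (Suc n) * t ^ n) (at t)"
        using DERIV_pow[of "Suc n" t] by simp
      show "((\<lambda>t. (t + 1) powr (- (real (Suc n) + a))) has_real_derivative - (real (Suc n) + a) * (t + 1) powr (- (real (Suc n) + a) - 1)) (at t)"
        using t by (auto intro!: derivative_eq_intros simp: field_simps)
    qed
    moreover have "?d = real (Suc n) * phi_fn n a t - (real (Suc n) + a) * phi_fn (Suc n) a t"
    proof -
      have "(t + 1) powr (- (real (Suc n) + a)) = 1 / (t + 1) powr (real n + a + 1)"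
        using powr_minus[of "t + 1" "real (Suc n) + a"] by (simp add: divide_inverse add_ac)
      moreover have "(t + 1) powr (- (real (Suc n) + a) - 1) = 1 / (t + 1) powr (real (Suc n) + a + 1)"
      proof -
        have "- (real (Suc n) + a) - 1 = - (real (Suc n) + a + 1)" by simp
        then show ?thesis by (simp only: powr_minus divide_inverse mult_1)
      qed
      ultimately show ?thesis unfolding phi_fn_def
        by (simp only:) (simp add: algebra_simps add_divide_distrib diff_divide_distrib)
    qed
    ultimately show "(F has_vector_derivative real (Suc n) * phi_fn n a t - (real (Suc n) + a) * phi_fn (Suc n) a t) (at t)"
      unfolding F_def by (simp only: has_real_derivative_iff_has_vector_derivative)
  next
    show "(F \<longlongrightarrow> 0) (at_right 0)"
    proof (rule Lim_null_comparison)
      show "\<forall>\<^sub>F t in at_right 0. norm (F t) \<le> t"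
        using eventually_at_right_less[of "0::real"] by eventually_elim (simp add: Fle)
    qed (rule tendsto_ident_at)
    show "(F \<longlongrightarrow> 0) at_top"
    proof (rule Lim_null_comparison)
      show "\<forall>\<^sub>F t in at_top. norm (F t) \<le> (t + 1) powr (- a)"
        using eventually_gt_at_top[of "0::real"] by eventually_elim (simp add: Fle)
      show "((\<lambda>t. (t + 1) powr (- a)) \<longlongrightarrow> 0) at_top" using a by real_asymp
    qed
  qed
  from has_integral_diff[OF has_integral_mult_right[OF Suc.IH, of "real (Suc n)"] this]
  have "((\<lambda>t. (real (Suc n) + a) * phi_fn (Suc n) a t) has_integral real (Suc n) * (fact n / pochhammer a (Suc n))) {0<..}"
    by simp
  from has_integral_mult_right[OF this, of "1 / (real (Suc n) + a)"]
  have "(phi_fn (Suc n) a has_integral 1 / (real (Suc n) + a) * (real (Suc n) * (fact n / pochhammer a (Suc n)))) {0<..}"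
    using a by simp
  moreover have "1 / (real (Suc n) + a) * (real (Suc n) * (fact n / pochhammer a (Suc n))) = fact (Suc n) / pochhammer a (Suc (Suc n))"
    using a by (subst pochhammer_Suc[of a "Suc n"]) (simp add: field_simps del: of_nat_Suc)
  ultimately show ?case by simp
qed

text \<open>The Beta integral equals Gamma(a) divided by \<open>lag_norm n a\<close>.\<close>

lemma phi_fn_integral_bigo:
  assumes a: "a > 0"
  shows "(\<lambda>n. integral {0<..} (phi_fn n a)) \<in> O(\<lambda>n. real n powr (- a))"
proof -
  have "integral {0<..} (phi_fn n a) = Gamma a * (1 / lag_norm (n + 0) a)" for n
  proof -
    have "pochhammer a (Suc n) = Gamma (a + real (Suc n)) / Gamma a"
      using a by (intro pochhammer_Gamma) (auto simp: nonpos_Ints_def)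
    then show ?thesis using integral_unique[OF has_integral_phi_fn[OF a, of n]]
      by (simp add: lag_norm_def add_ac)
  qed
  moreover have "(\<lambda>n. Gamma a * (1 / lag_norm (n + 0) a)) \<in> O(\<lambda>n. 1 * real n powr (- a))"
    using a by (intro landau_o.big.mult inverse_lag_norm_bigo) auto
  ultimately show ?thesis by simp
qed

section \<open>Laguerre series of exponentials and of Laplace transforms\<close>

lemma laguerre_generating:
  assumes "a > -1" "s > 0" "lam > 0"
  shows "(\<lambda>n. laguerre n a lam * phi_fn n a s) sums exp (- s * lam)"
proof -
  have "(\<lambda>n. laguerre n a lam *\<^sub>R integral {0<..} (\<lambda>t. laguerre_fn n a t *\<^sub>R exp (- s * t))) sums exp (- s * lam)"
  \<comment> \<open>A single constant must bound the exponential, which is at most 1, and its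
    derivative, which is at most s.\<close>
  proof (rule laguerre_expansion[where K = "1 + s" and f' = "\<lambda>t. - s * exp (- s * t)"])
    fix t :: real assume t: "t > 0"
    have "((\<lambda>t. exp (- s * t)) has_real_derivative - s * exp (- s * t)) (at t)"
      by (auto intro!: derivative_eq_intros)
    then show "((\<lambda>t. exp (- s * t)) has_vector_derivative - s * exp (- s * t)) (at t)"
      by (simp add: has_real_derivative_iff_has_vector_derivative)
    have e: "exp (- s * t) \<le> 1" using t assms by simp
    then show "norm (exp (- s * t)) \<le> 1 + s" unfolding real_norm_def abs_exp_cancel using assms by linarith
    have "norm (- s * exp (- s * t)) = s * exp (- s * t)" using assms by (simp add: abs_mult)
    also have "\<dots> \<le> s * 1" using e assms by (intro mult_left_mono) auto
    also have "\<dots> \<le> 1 + s" by simp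
    finally show "norm (- s * exp (- s * t)) \<le> 1 + s" .
  qed (use assms in \<open>auto intro!: continuous_intros\<close>)
  then show ?thesis using has_integral_laguerre_fn_exp[OF assms(1,2), THEN integral_unique] by simp
qed

lemma integrable_phi_fn_scaleR:
  fixes g :: "real \<Rightarrow> 'a::banach"
  assumes a: "a > 0" and g: "continuous_on {0<..} g" and gK: "\<And>s. s > 0 \<Longrightarrow> norm (g s) \<le> K"
  shows "(\<lambda>s. phi_fn n a s *\<^sub>R g s) integrable_on {0<..}"
    and "norm (integral {0<..} (\<lambda>s. phi_fn n a s *\<^sub>R g s)) \<le> K * integral {0<..} (phi_fn n a)"
proof -
  have cont: "continuous_on {0<..} (\<lambda>s. phi_fn n a s *\<^sub>R g s)" by (intro continuous_intros g)
  have int: "(\<lambda>s. K * phi_fn n a s) integrable_on {0<..}"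
    by (intro integrable_on_mult_right has_integral_integrable[OF has_integral_phi_fn[OF a]])
  have le: "norm (phi_fn n a s *\<^sub>R g s) \<le> K * phi_fn n a s" if "s > 0" for s
    using mult_left_mono[OF gK[OF that] phi_fn_nonneg[OF that]] phi_fn_nonneg[OF that] by (simp add: mult.commute)
  show "(\<lambda>s. phi_fn n a s *\<^sub>R g s) integrable_on {0<..}"
    by (rule dominated_integrable_halfline[OF cont int le])
  show "norm (integral {0<..} (\<lambda>s. phi_fn n a s *\<^sub>R g s)) \<le> K * integral {0<..} (phi_fn n a)"
    using dominated_integral_bound_halfline[OF cont int le] by simp
qed

text \<open>Convergence at 2s is convergence of the power series at 2s/(2s + 1), which lies beyond
  s/(s + 1); hence convergence at s is absolute.\<close>

lemma summable_laguerre_phi_fn: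
  assumes "a > -1" "s > 0" "lam > 0"
  shows "summable (\<lambda>n. \<bar>laguerre n a lam\<bar> * phi_fn n a s)"
proof -
  define r where "r = (s + 1) powr (- a - 1)"
  have r: "r > 0" using assms by (simp add: r_def)
  define r' where "r' = (2 * s + 1) powr (- a - 1)"
  have r': "r' > 0" using assms by (simp add: r'_def)
  have "summable (\<lambda>n. laguerre n a lam * phi_fn n a (2 * s))"
    using laguerre_generating[of a "2 * s" lam] assms by (auto simp: sums_iff)
  then have "summable (\<lambda>n. r' * (laguerre n a lam * (2 * s / (2 * s + 1)) ^ n))"
    using assms by (simp add: phi_fn_eq r'_def mult_ac)
  then have "summable (\<lambda>n. laguerre n a lam * (2 * s / (2 * s + 1)) ^ n)"
    using r' by (subst (asm) summable_cmult_iff) auto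
  then have "summable (\<lambda>n. norm (laguerre n a lam * (s / (s + 1)) ^ n))"
    by (rule powser_insidea) (use assms in \<open>simp add: divide_simps\<close>)
  then have "summable (\<lambda>n. r * norm (laguerre n a lam * (s / (s + 1)) ^ n))" by (rule summable_mult)
  moreover have "r * norm (laguerre n a lam * (s / (s + 1)) ^ n) = \<bar>laguerre n a lam\<bar> * phi_fn n a s" for n
    using assms by (simp add: phi_fn_eq r_def abs_mult power_abs)
  ultimately show ?thesis by (simp only:)
qed

lemma summable_powr_bigo:
  fixes f :: "nat \<Rightarrow> real"
  assumes "f \<in> O(\<lambda>n. real n powr e)" "e < -1"
  shows "summable f"
  using assms by (intro summable_comparison_test_bigo[OF _ assms(1)]) (simp add: summable_real_powr_iff)

text \<open>For a > 3/2 the terms are O(n^(-a/2 - 1/4)), hence absolutely summable. Dominated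
  convergence is applied to the scalar error \<open>Q\<close> alone; the vector-valued error is at
  most K times the integral of \<open>Q\<close>.\<close>

lemma laplace_laguerre_series_abs:
  fixes g :: "real \<Rightarrow> 'a::banach"
  assumes a: "a > 3/2" and lam: "lam > 0" and g: "continuous_on {0<..} g" and gK: "\<And>s. s > 0 \<Longrightarrow> norm (g s) \<le> K"
  shows "(\<lambda>n. laguerre n a lam *\<^sub>R integral {0<..} (\<lambda>s. phi_fn n a s *\<^sub>R g s)) sums
           integral {0<..} (\<lambda>s. exp (- lam * s) *\<^sub>R g s)"
proof -
  have a0: "a > 0" and a1: "a > -1" using a by auto
  have K0: "K \<ge> 0" using order_trans[OF norm_ge_zero gK[of 1]] by simp
  define H where "H = (\<lambda>s. \<Sum>n. \<bar>laguerre n a lam\<bar> * phi_fn n a s)"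
  define P where "P = (\<lambda>N s. \<Sum>n<N. \<bar>laguerre n a lam\<bar> * phi_fn n a s)"
  have phiint: "phi_fn n a integrable_on {0<..}" for n by (rule has_integral_integrable[OF has_integral_phi_fn[OF a0]])
  have Pint: "P N integrable_on {0<..}" for N unfolding P_def
    by (intro integrable_sum integrable_on_mult_right phiint) auto
  have sumI: "summable (\<lambda>n. \<bar>laguerre n a lam\<bar> * integral {0<..} (phi_fn n a))"
  proof (rule summable_powr_bigo)
    have "(\<lambda>n. \<bar>laguerre (n + 0) a lam\<bar> * integral {0<..} (phi_fn n a)) \<in> O(\<lambda>n. real n powr (a/2 - 1/4) * real n powr (- a))"
      by (intro landau_o.big.mult laguerre_bigo a1 lam phi_fn_integral_bigo a0)
    then show "(\<lambda>n. \<bar>laguerre n a lam\<bar> * integral {0<..} (phi_fn n a)) \<in> O(\<lambda>n. real n powr (- a/2 - 1/4))"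
      by (simp add: powr_add[symmetric])
  qed (use a in simp)
  have PI: "integral {0<..} (P N) = (\<Sum>n<N. \<bar>laguerre n a lam\<bar> * integral {0<..} (phi_fn n a))" for N
    unfolding P_def by (subst integral_sum) (auto intro!: integrable_on_mult_right phiint)
  have Pnn: "0 \<le> \<bar>laguerre n a lam\<bar> * phi_fn n a s" if "s > 0" for n s using phi_fn_nonneg[OF that] by simp
  have Plim: "(\<lambda>N. P N s) \<longlonglongrightarrow> H s" if "s > 0" for s
    unfolding P_def H_def using summable_laguerre_phi_fn[OF a1 that lam] by (rule summable_LIMSEQ)
  have Hint: "H integrable_on {0<..}"
  proof (rule conjunct1[OF monotone_convergence_increasing[of P]])
    show "bounded (range (\<lambda>N. integral {0<..} (P N)))"
      unfolding PI using summable_LIMSEQ[OF sumI] by (intro convergent_imp_bounded) 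
  qed (use Pint Pnn Plim in \<open>auto simp: P_def phi_fn_nonneg\<close>)
  \<comment> \<open>The pointwise error of the generating series. Partial sums and limit are each
    bounded by \<open>H\<close>, so 2 H is a majorant.\<close>
  define Q where "Q = (\<lambda>N s. \<bar>(\<Sum>n<N. laguerre n a lam * phi_fn n a s) - exp (- lam * s)\<bar>)"
  have PH: "P N s \<le> H s" if "s > 0" for N s
    unfolding P_def H_def using summable_laguerre_phi_fn[OF a1 that lam] Pnn[OF that] by (intro sum_le_suminf) auto
  have QH: "Q N s \<le> 2 * H s" if s: "s > 0" for N s
  proof -
    have 1: "\<bar>\<Sum>n<N. laguerre n a lam * phi_fn n a s\<bar> \<le> H s"
    proof -
      have "\<bar>\<Sum>n<N. laguerre n a lam * phi_fn n a s\<bar> \<le> P N s" unfolding P_def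
        using phi_fn_nonneg[OF s] by (intro order_trans[OF sum_abs] sum_mono) (simp add: abs_mult)
      also have "\<dots> \<le> H s" by (rule PH[OF s])
      finally show ?thesis .
    qed
    have "exp (- lam * s) = (\<Sum>n. laguerre n a lam * phi_fn n a s)"
      using laguerre_generating[OF a1 s lam] by (simp add: sums_iff mult.commute)
    also have "\<bar>\<dots>\<bar> \<le> (\<Sum>n. \<bar>laguerre n a lam * phi_fn n a s\<bar>)"
      using summable_laguerre_phi_fn[OF a1 s lam] phi_fn_nonneg[OF s] by (intro summable_rabs) (simp add: abs_mult)
    also have "\<dots> = H s" unfolding H_def using phi_fn_nonneg[OF s] by (simp add: abs_mult)
    finally have 2: "exp (- lam * s) \<le> H s" by simp
    have 3: "exp (- lam * s) \<ge> 0" by simp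
    show ?thesis unfolding Q_def using 1 2 3 by linarith
  qed
  have H2: "(\<lambda>s. 2 * H s) integrable_on {0<..}" by (intro integrable_on_mult_right Hint)
  have Qcont: "continuous_on {0<..} (Q N)" for N unfolding Q_def by (intro continuous_intros)
  have Qint: "Q N integrable_on {0<..}" for N
    by (rule dominated_integrable_halfline[OF Qcont H2]) (use QH in \<open>auto simp: Q_def\<close>)
  have Qlim: "(\<lambda>N. integral {0<..} (Q N)) \<longlonglongrightarrow> integral {0<..} (\<lambda>_::real. 0)"
  proof (rule dominated_convergence(2)[OF Qint H2])
    show "norm (Q N s) \<le> 2 * H s" if "s \<in> {0<..}" for N s using QH[of s N] that by (simp add: Q_def)
    fix s :: real assume "s \<in> {0<..}"
    then have "(\<lambda>N. (\<Sum>n<N. laguerre n a lam * phi_fn n a s) - exp (- lam * s)) \<longlonglongrightarrow> 0"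
      using laguerre_generating[OF a1 _ lam, of s] unfolding sums_def by (intro LIM_zero) (simp add: mult.commute)
    then show "(\<lambda>N. Q N s) \<longlonglongrightarrow> 0" unfolding Q_def by (rule tendsto_rabs_zero)
  qed
  have eint: "(\<lambda>s. exp (- lam * s) *\<^sub>R g s) integrable_on {0<..}"
  proof (rule dominated_integrable_halfline)
    show "(\<lambda>s. s powr 0 * exp (- lam * s) * K) integrable_on {0<..}"
      by (intro integrable_on_mult_left integrable_powr_exp lam) simp
  qed (use gK in \<open>auto intro!: continuous_intros g mult_left_mono\<close>)
  have "(\<lambda>N. (\<Sum>n<N. laguerre n a lam *\<^sub>R integral {0<..} (\<lambda>s. phi_fn n a s *\<^sub>R g s)) - integral {0<..} (\<lambda>s. exp (- lam * s) *\<^sub>R g s)) \<longlonglongrightarrow> 0"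
  proof (rule Lim_null_comparison)
    show "(\<lambda>N. K * integral {0<..} (Q N)) \<longlonglongrightarrow> 0" using tendsto_mult_left[OF Qlim, of K] by simp
    show "\<forall>\<^sub>F N in sequentially. norm ((\<Sum>n<N. laguerre n a lam *\<^sub>R integral {0<..} (\<lambda>s. phi_fn n a s *\<^sub>R g s)) - integral {0<..} (\<lambda>s. exp (- lam * s) *\<^sub>R g s)) \<le> K * integral {0<..} (Q N)"
    proof (intro always_eventually allI)
      fix N
      have "((\<lambda>s. (\<Sum>n<N. laguerre n a lam *\<^sub>R (phi_fn n a s *\<^sub>R g s)) - exp (- lam * s) *\<^sub>R g s) has_integral
          (\<Sum>n<N. laguerre n a lam *\<^sub>R integral {0<..} (\<lambda>s. phi_fn n a s *\<^sub>R g s)) - integral {0<..} (\<lambda>s. exp (- lam * s) *\<^sub>R g s)) {0<..}"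
        by (intro has_integral_diff has_integral_sum has_integral_cmul integrable_integral eint integrable_phi_fn_scaleR(1)[OF a0 g gK]) auto
      moreover have "(\<Sum>n<N. laguerre n a lam *\<^sub>R (phi_fn n a s *\<^sub>R g s)) - exp (- lam * s) *\<^sub>R g s
         = ((\<Sum>n<N. laguerre n a lam * phi_fn n a s) - exp (- lam * s)) *\<^sub>R g s" for s
        by (simp add: scaleR_left_diff_distrib scaleR_sum_left)
      ultimately have hi: "((\<lambda>s. ((\<Sum>n<N. laguerre n a lam * phi_fn n a s) - exp (- lam * s)) *\<^sub>R g s) has_integral
          (\<Sum>n<N. laguerre n a lam *\<^sub>R integral {0<..} (\<lambda>s. phi_fn n a s *\<^sub>R g s)) - integral {0<..} (\<lambda>s. exp (- lam * s) *\<^sub>R g s)) {0<..}"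
        by simp
      have "norm (integral {0<..} (\<lambda>s. ((\<Sum>n<N. laguerre n a lam * phi_fn n a s) - exp (- lam * s)) *\<^sub>R g s)) \<le> integral {0<..} (\<lambda>s. K * Q N s)"
      proof (rule integral_norm_bound_integral)
        show "(\<lambda>s. ((\<Sum>n<N. laguerre n a lam * phi_fn n a s) - exp (- lam * s)) *\<^sub>R g s) integrable_on {0<..}"
          using hi by (rule has_integral_integrable)
        show "(\<lambda>s. K * Q N s) integrable_on {0<..}" by (intro integrable_on_mult_right Qint)
        fix s :: real assume "s \<in> {0<..}"
        then have "Q N s * norm (g s) \<le> Q N s * K" using gK by (intro mult_left_mono) (auto simp: Q_def)
        then show "norm (((\<Sum>n<N. laguerre n a lam * phi_fn n a s) - exp (- lam * s)) *\<^sub>R g s) \<le> K * Q N s"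
          by (simp add: Q_def mult.commute)
      qed
      then show "norm ((\<Sum>n<N. laguerre n a lam *\<^sub>R integral {0<..} (\<lambda>s. phi_fn n a s *\<^sub>R g s)) - integral {0<..} (\<lambda>s. exp (- lam * s) *\<^sub>R g s)) \<le> K * integral {0<..} (Q N)"
        using integral_unique[OF hi] by simp
    qed
  qed
  then show ?thesis unfolding sums_def by (rule LIM_zero_cancel)
qed

text \<open>Summation by parts raises the parameter by one, which gains the half power of decay
  needed for absolute convergence.\<close>
lemma laplace_laguerre_series:
  fixes g :: "real \<Rightarrow> 'a::banach"
  assumes a: "a > 1/2" and lam: "lam > 0" and g: "continuous_on {0<..} g" and gK: "\<And>s. s > 0 \<Longrightarrow> norm (g s) \<le> K"
  shows "(\<lambda>n. laguerre n a lam *\<^sub>R integral {0<..} (\<lambda>s. phi_fn n a s *\<^sub>R g s)) sums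
           integral {0<..} (\<lambda>s. exp (- lam * s) *\<^sub>R g s)"
proof -
  have a0: "a > 0" and a1: "a + 1 > 0" "a + 1 > -1" using a by auto
  have K0: "K \<ge> 0" using order_trans[OF norm_ge_zero gK[of 1]] by simp
  define c where "c = (\<lambda>n a. integral {0<..} (\<lambda>s. phi_fn n a s *\<^sub>R g s))"
  have cdiff: "c n a - c (Suc n) a = c n (a + 1)" for n
  proof -
    have "c n a - c (Suc n) a = integral {0<..} (\<lambda>s. phi_fn n a s *\<^sub>R g s - phi_fn (Suc n) a s *\<^sub>R g s)"
      unfolding c_def by (intro integral_diff[symmetric] integrable_phi_fn_scaleR(1)[OF a0 g gK])
    also have "\<dots> = c n (a + 1)" unfolding c_def
      by (intro integral_cong) (simp add: scaleR_left_diff_distrib[symmetric] phi_fn_diff)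
    finally show ?thesis .
  qed
  \<comment> \<open>Abel summation: \<open>laguerre_Suc_diff\<close> writes each polynomial as a
    difference for parameter a + 1, and by \<open>cdiff\<close> the differences of the coefficients
    belong to a + 1 as well.\<close>
  have parts: "(\<Sum>n\<le>N. laguerre n a lam *\<^sub>R c n a) = laguerre N (a + 1) lam *\<^sub>R c N a + (\<Sum>n<N. laguerre n (a + 1) lam *\<^sub>R c n (a + 1))" for N
  proof (induction N)
    case (Suc N)
    have "(\<Sum>n\<le>Suc N. laguerre n a lam *\<^sub>R c n a) = laguerre N (a + 1) lam *\<^sub>R c N a + (\<Sum>n<N. laguerre n (a + 1) lam *\<^sub>R c n (a + 1))
        + (laguerre (Suc N) (a + 1) lam - laguerre N (a + 1) lam) *\<^sub>R c (Suc N) a"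
      by (simp add: Suc.IH laguerre_Suc_diff[symmetric])
    also have "\<dots> = laguerre (Suc N) (a + 1) lam *\<^sub>R c (Suc N) a + (\<Sum>n<N. laguerre n (a + 1) lam *\<^sub>R c n (a + 1))
        + laguerre N (a + 1) lam *\<^sub>R (c N a - c (Suc N) a)"
      by (simp add: algebra_simps)
    finally show ?case unfolding cdiff by simp
  qed simp
  \<comment> \<open>The boundary term is O(n^(-(a/2 - 1/4))) and vanishes in the limit because a >
    1/2; the remaining series has parameter above 3/2.\<close>
  have "(\<lambda>N. laguerre N (a + 1) lam *\<^sub>R c N a) \<longlonglongrightarrow> 0"
  proof (rule Lim_null_comparison)
    show "\<forall>\<^sub>F N in sequentially. norm (laguerre N (a + 1) lam *\<^sub>R c N a) \<le> \<bar>laguerre (N + 0) (a + 1) lam\<bar> * (K * integral {0<..} (phi_fn N a))"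
      unfolding c_def by (intro always_eventually allI) (simp add: mult_left_mono integrable_phi_fn_scaleR(2)[OF a0 g gK])
    have "(\<lambda>N. \<bar>laguerre (N + 0) (a + 1) lam\<bar> * (K * integral {0<..} (phi_fn N a))) \<in> O(\<lambda>n. real n powr ((a + 1)/2 - 1/4) * (1 * real n powr (- a)))"
      by (intro landau_o.big.mult laguerre_bigo a1 lam phi_fn_integral_bigo a0) simp
    also have "(\<lambda>n. real n powr ((a + 1)/2 - 1/4) * (1 * real n powr (- a))) = (\<lambda>n. real n powr (- (a/2 - 1/4)))"
    proof -
      have "(a + 1)/2 - 1/4 + - a = - (a/2 - 1/4)" by (simp add: field_simps)
      then show ?thesis unfolding mult_1 powr_add[symmetric] by (simp only:)
    qed
    also have "(\<lambda>n. real n powr (- (a/2 - 1/4))) \<in> o(\<lambda>_. 1)"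
    proof -
      define e where "e = a/2 - 1/4"
      have "e > 0" using a by (simp add: e_def)
      then have "(\<lambda>n. real n powr (- e)) \<in> o(\<lambda>_. 1)" by real_asymp
      then show ?thesis by (simp add: e_def)
    qed
    finally show "(\<lambda>N. \<bar>laguerre (N + 0) (a + 1) lam\<bar> * (K * integral {0<..} (phi_fn N a))) \<longlonglongrightarrow> 0"
      by (auto dest: smalloD_tendsto)
  qed
  moreover have "(\<lambda>N. \<Sum>n<N. laguerre n (a + 1) lam *\<^sub>R c n (a + 1)) \<longlonglongrightarrow> integral {0<..} (\<lambda>s. exp (- lam * s) *\<^sub>R g s)"
    using laplace_laguerre_series_abs[OF _ lam g gK, of "a + 1"] a unfolding sums_def c_def by simp
  ultimately have "(\<lambda>N. \<Sum>n\<le>N. laguerre n a lam *\<^sub>R c n a) \<longlonglongrightarrow> 0 + integral {0<..} (\<lambda>s. exp (- lam * s) *\<^sub>R g s)"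
    unfolding parts by (rule tendsto_add)
  then show ?thesis unfolding sums_def_le c_def by simp
qed

section \<open>Fubini's theorem on the quadrant\<close>

abbreviation window :: "nat \<Rightarrow> real set" where
  "window m \<equiv> {1 / real (Suc m)..real (Suc m)}"

lemma window_pos: "s \<in> window m \<Longrightarrow> s > 0"
  by (rule less_le_trans[of _ "1 / real (Suc m)"]) auto

lemma window_subset: "{0<..} \<inter> window m = window m" "window m \<inter> {0<..} = window m"
  using window_pos by auto

lemma eventually_window: "s > 0 \<Longrightarrow> \<forall>\<^sub>F m in sequentially. s \<in> window m"
proof -
  assume s: "s > 0"
  have "(\<lambda>m. 1 / real (Suc m)) \<longlonglongrightarrow> 0" by real_asymp
  then have "\<forall>\<^sub>F m in sequentially. 1 / real (Suc m) < s" using s by (rule order_tendstoD)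
  moreover have "filterlim (\<lambda>m. real (Suc m)) at_top sequentially" by real_asymp
  then have "\<forall>\<^sub>F m in sequentially. s \<le> real (Suc m)" by (simp add: filterlim_at_top)
  ultimately show ?thesis by eventually_elim auto
qed

lemma window_integral_tendsto:
  fixes h :: "real \<Rightarrow> real"
  assumes h: "h integrable_on {0<..}" and nn: "\<And>s. s > 0 \<Longrightarrow> h s \<ge> 0"
  shows "(\<lambda>m. integral (window m) h) \<longlonglongrightarrow> integral {0<..} h"
proof -
  have int: "(\<lambda>s. if s \<in> window m then h s else 0) integrable_on {0<..}" for m
    unfolding integrable_restrict_Int window_subset by (rule integrable_on_halfline_Icc[OF h]) simp
  have "(\<lambda>m. integral {0<..} (\<lambda>s. if s \<in> window m then h s else 0)) \<longlonglongrightarrow> integral {0<..} h"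
  proof (rule dominated_convergence(2)[OF int h])
    show "norm (if s \<in> window m then h s else 0) \<le> h s" if "s \<in> {0<..}" for s m using nn[of s] that by auto
    show "(\<lambda>m. if s \<in> window m then h s else 0) \<longlonglongrightarrow> h s" if "s \<in> {0<..}" for s
    proof (rule tendsto_eventually)
      show "\<forall>\<^sub>F m in sequentially. (if s \<in> window m then h s else 0) = h s"
        by (rule eventually_mono[OF eventually_window]) (use that in auto)
    qed
  qed
  then show ?thesis unfolding integral_restrict_Int window_subset .
qed

text \<open>An iterated integral over the quadrant as a limit over compact squares. Used for both
  orders of integration, it carries the exchange of integrals from squares, where continuity
  suffices, over to the quadrant.\<close>

lemma quadrant_window_integral:
  fixes G :: "real \<Rightarrow> real \<Rightarrow> 'a::banach" and D :: "real \<Rightarrow> real \<Rightarrow> real"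
  assumes contG: "continuous_on ({0<..} \<times> {0<..}) (\<lambda>(t, s). G t s)"
    and contD: "continuous_on ({0<..} \<times> {0<..}) (\<lambda>(t, s). D t s)"
    and le: "\<And>t s. t > 0 \<Longrightarrow> s > 0 \<Longrightarrow> norm (G t s) \<le> D t s"
    and D: "\<And>t. t > 0 \<Longrightarrow> (D t has_integral E t) {0<..}" and E: "E integrable_on {0<..}"
    and contB: "continuous_on {0<..} (\<lambda>t. integral {0<..} (G t))"
  shows "(\<lambda>t. integral {0<..} (G t)) integrable_on {0<..}"
    and "(\<lambda>m. integral (window m) (\<lambda>t. integral (window m) (G t))) \<longlonglongrightarrow> integral {0<..} (\<lambda>t. integral {0<..} (G t))"
proof -
  define B where "B = (\<lambda>t. integral {0<..} (G t))"
  have contGt: "continuous_on {0<..} (G t)" if "t > 0" for t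
  proof -
    have "continuous_on {0<..} (\<lambda>s. (t, s))" by (intro continuous_intros)
    from continuous_on_compose2[OF contG this] that show ?thesis by auto
  qed
  have D0: "D t s \<ge> 0" if "t > 0" "s > 0" for t s using order_trans[OF norm_ge_zero le[OF that]] .
  have Dint: "D t integrable_on {0<..}" if "t > 0" for t using D[OF that] by (rule has_integral_integrable)
  have Gint: "G t integrable_on {0<..}" if "t > 0" for t
    by (rule dominated_integrable_halfline[OF contGt[OF that] Dint[OF that] le[OF that]])
  have BE: "norm (B t) \<le> E t" if "t > 0" for t
    using dominated_integral_bound_halfline[OF contGt[OF that] Dint[OF that] le[OF that]] integral_unique[OF D[OF that]]
    by (simp add: B_def)
  show Bint: "(\<lambda>t. integral {0<..} (G t)) integrable_on {0<..}"
    by (rule dominated_integrable_halfline[OF contB E]) (use BE in \<open>simp add: B_def\<close>)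
  have prod: "window m \<times> window m \<subseteq> {0<..} \<times> {0<..}" for m using window_pos by blast
  have contWG: "continuous_on (window m) (\<lambda>t. integral (window m) (G t))" for m
    using integral_continuous_on_param[of "window m" "1 / real (Suc m)" "real (Suc m)" G] continuous_on_subset[OF contG prod]
    by simp
  have contWD: "continuous_on (window m) (\<lambda>t. integral (window m) (D t))" for m
    using integral_continuous_on_param[of "window m" "1 / real (Suc m)" "real (Suc m)" D] continuous_on_subset[OF contD prod]
    by simp
  define A where "A = (\<lambda>m t. if t \<in> window m then integral (window m) (G t) else 0)"
  \<comment> \<open>A majorant of \<open>norm (B t - A m t)\<close>: what the window omits of the
    integral of \<open>D t\<close>, or all of \<open>E t\<close> when t itself lies outside. It
    tends to 0 pointwise below the majorant \<open>E\<close>.\<close>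
  define e where "e = (\<lambda>m t. E t - (if t \<in> window m then integral (window m) (D t) else 0))"
  have Aint: "A m integrable_on {0<..}" for m
    unfolding A_def integrable_restrict_Int window_subset by (rule integrable_continuous_real[OF contWG])
  have eint: "e m integrable_on {0<..}" for m
    unfolding e_def
    by (intro integrable_diff E, unfold integrable_restrict_Int window_subset) (rule integrable_continuous_real[OF contWD])
  have WE: "integral (window m) (D t) \<le> E t" "integral (window m) (D t) \<ge> 0" if t: "t > 0" for m t
  proof -
    have W: "D t integrable_on window m" by (rule integrable_on_halfline_Icc[OF Dint[OF t]]) simp
    have "integral (window m) (D t) \<le> integral {0<..} (D t)"
      by (rule integral_subset_le[OF _ W Dint[OF t]]) (use D0[OF t] window_pos in auto)
    then show "integral (window m) (D t) \<le> E t" using integral_unique[OF D[OF t]] by simp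
    show "integral (window m) (D t) \<ge> 0" by (rule integral_nonneg[OF W]) (use D0[OF t] window_pos in auto)
  qed
  have diff: "norm (B t - A m t) \<le> e m t" if t: "t > 0" for m t
  proof (cases "t \<in> window m")
    case False
    then show ?thesis unfolding A_def e_def if_not_P[OF False] using BE[OF t] by simp
  next
    case True
    have rG: "(\<lambda>s. if s \<in> window m then G t s else 0) integrable_on {0<..}"
      unfolding integrable_restrict_Int window_subset
      using window_pos by (intro integrable_continuous_real continuous_on_subset[OF contGt[OF t]]) auto
    have rD: "(\<lambda>s. if s \<in> window m then D t s else 0) integrable_on {0<..}"
      unfolding integrable_restrict_Int window_subset by (rule integrable_on_halfline_Icc[OF Dint[OF t]]) simp
    have "B t - A m t = integral {0<..} (\<lambda>s. G t s - (if s \<in> window m then G t s else 0))"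
      unfolding integral_diff[OF Gint[OF t] rG] unfolding integral_restrict_Int window_subset A_def if_P[OF True] B_def ..
    also have "norm \<dots> \<le> integral {0<..} (\<lambda>s. D t s - (if s \<in> window m then D t s else 0))"
      by (rule integral_norm_bound_integral[OF integrable_diff[OF Gint[OF t] rG] integrable_diff[OF Dint[OF t] rD]])
         (use le[OF t] in auto)
    also have "\<dots> = e m t"
      unfolding integral_diff[OF Dint[OF t] rD] unfolding integral_restrict_Int window_subset e_def if_P[OF True]
      integral_unique[OF D[OF t]] ..
    finally show ?thesis .
  qed
  have "(\<lambda>m. integral {0<..} (e m)) \<longlonglongrightarrow> integral {0<..} (\<lambda>_::real. 0)"
  proof (rule dominated_convergence(2)[OF eint E])
    show "norm (e m t) \<le> E t" if "t \<in> {0<..}" for m t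
      using WE[of t m] that norm_ge_zero[of "B t"] BE[of t] by (auto simp: e_def)
    show "(\<lambda>m. e m t) \<longlonglongrightarrow> 0" if "t \<in> {0<..}" for t
    proof -
      have "(\<lambda>m. E t - integral (window m) (D t)) \<longlonglongrightarrow> E t - integral {0<..} (D t)"
        using that by (intro tendsto_diff tendsto_const window_integral_tendsto Dint) (auto intro: D0)
      then have "(\<lambda>m. E t - integral (window m) (D t)) \<longlonglongrightarrow> 0" using integral_unique[OF D[of t]] that by simp
      then show ?thesis
        by (rule Lim_transform_eventually, intro eventually_mono[OF eventually_window]) (use that in \<open>auto simp: e_def\<close>)
    qed
  qed
  then have elim: "(\<lambda>m. integral {0<..} (e m)) \<longlonglongrightarrow> 0" by simp
  have "(\<lambda>m. integral {0<..} B - integral {0<..} (A m)) \<longlonglongrightarrow> 0"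
  proof (rule Lim_null_comparison[OF always_eventually elim], rule allI)
    fix m
    have Bi: "B integrable_on {0<..}" using Bint by (simp add: B_def)
    have "norm (integral {0<..} (\<lambda>t. B t - A m t)) \<le> integral {0<..} (e m)"
      by (rule integral_norm_bound_integral[OF integrable_diff[OF Bi Aint] eint]) (use diff in auto)
    then show "norm (integral {0<..} B - integral {0<..} (A m)) \<le> integral {0<..} (e m)"
      by (simp add: integral_diff[OF Bi Aint])
  qed
  from tendsto_minus[OF this] have "(\<lambda>m. integral {0<..} (A m)) \<longlonglongrightarrow> integral {0<..} B"
    by (simp add: LIM_zero_iff)
  then show "(\<lambda>m. integral (window m) (\<lambda>t. integral (window m) (G t))) \<longlonglongrightarrow> integral {0<..} (\<lambda>t. integral {0<..} (G t))"
    unfolding A_def integral_restrict_Int window_subset B_def .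
qed

lemma has_integral_exp_halfline: "t > 0 \<Longrightarrow> ((\<lambda>s. exp (- t * s)) has_integral 1 / t) {0<..}" for t :: real
proof -
  assume t: "t > 0"
  have "((\<lambda>s. s powr 0 * exp (- t * s)) has_integral 1 / t) {0<..}"
    using has_integral_powr_exp[of 0 t] t by simp
  then show ?thesis by (rule has_integral_eq[rotated]) auto
qed

lemma integrable_exp_scaleR:
  fixes g :: "real \<Rightarrow> 'a::banach"
  assumes g: "continuous_on {0<..} g" and gK: "\<And>s. s > 0 \<Longrightarrow> norm (g s) \<le> K" and t: "t > 0"
  shows "(\<lambda>s. exp (- t * s) *\<^sub>R g s) integrable_on {0<..}"
proof (rule dominated_integrable_halfline)
  show "(\<lambda>s. exp (- t * s) * K) integrable_on {0<..}"
    by (intro integrable_on_mult_left has_integral_integrable[OF has_integral_exp_halfline[OF t]])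
qed (use gK in \<open>auto intro!: continuous_intros g mult_left_mono\<close>)

text \<open>Only the exponential depends on t, and it is monotone in t; so two values at t <= r
  differ by at most K (1/t - 1/r).\<close>

lemma continuous_on_laplace:
  fixes g :: "real \<Rightarrow> 'a::banach"
  assumes g: "continuous_on {0<..} g" and gK: "\<And>s. s > 0 \<Longrightarrow> norm (g s) \<le> K"
  shows "continuous_on {0<..} (\<lambda>t. integral {0<..} (\<lambda>s. exp (- t * s) *\<^sub>R g s))"
proof -
  define R where "R = (\<lambda>t. integral {0<..} (\<lambda>s. exp (- t * s) *\<^sub>R g s))"
  have le1: "norm (R t - R r) \<le> K * (1 / t - 1 / r)" if "0 < t" "t \<le> r" for t r
  proof -
    have r: "r > 0" using that by simp
    have hi: "((\<lambda>s. K * (exp (- t * s) - exp (- r * s))) has_integral K * (1 / t - 1 / r)) {0<..}"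
      using that r by (intro has_integral_mult_right has_integral_diff has_integral_exp_halfline) auto
    have "R t - R r = integral {0<..} (\<lambda>s. exp (- t * s) *\<^sub>R g s - exp (- r * s) *\<^sub>R g s)"
      unfolding R_def by (intro integral_diff[symmetric] integrable_exp_scaleR[OF g gK] that r)
    also have "norm \<dots> \<le> integral {0<..} (\<lambda>s. K * (exp (- t * s) - exp (- r * s)))"
    proof (rule integral_norm_bound_integral)
      show "(\<lambda>s. exp (- t * s) *\<^sub>R g s - exp (- r * s) *\<^sub>R g s) integrable_on {0<..}"
        by (intro integrable_diff integrable_exp_scaleR[OF g gK] that r)
      show "(\<lambda>s. K * (exp (- t * s) - exp (- r * s))) integrable_on {0<..}" using hi by (rule has_integral_integrable)
      fix s :: real assume s: "s \<in> {0<..}"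
      have "exp (- r * s) \<le> exp (- t * s)" using that s by (simp add: mult_right_mono)
      then have "norm (exp (- t * s) *\<^sub>R g s - exp (- r * s) *\<^sub>R g s) = (exp (- t * s) - exp (- r * s)) * norm (g s)"
        unfolding scaleR_left_diff_distrib[symmetric] norm_scaleR by simp
      also have "\<dots> \<le> (exp (- t * s) - exp (- r * s)) * K"
        using \<open>exp (- r * s) \<le> exp (- t * s)\<close> gK[of s] s by (intro mult_left_mono) auto
      finally show "norm (exp (- t * s) *\<^sub>R g s - exp (- r * s) *\<^sub>R g s) \<le> K * (exp (- t * s) - exp (- r * s))"
        by (simp only: mult.commute)
    qed
    also have "\<dots> = K * (1 / t - 1 / r)" by (rule integral_unique[OF hi])
    finally show ?thesis .
  qed
  have le: "norm (R r - R t) \<le> \<bar>K\<bar> * \<bar>1 / r - 1 / t\<bar>" if "0 < t" "0 < r" for t r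
  proof -
    have "norm (R r - R t) \<le> \<bar>K * (1 / r - 1 / t)\<bar>"
    proof (cases "t \<le> r")
      case True
      have "K * (1 / t - 1 / r) \<le> \<bar>K * (1 / r - 1 / t)\<bar>"
        using abs_ge_self[of "K * (1 / t - 1 / r)"] by (simp add: abs_mult abs_minus_commute)
      then show ?thesis using le1[OF that(1) True] by (simp add: norm_minus_commute)
    next
      case False
      then show ?thesis using le1[of r t] that by (intro order_trans[OF _ abs_ge_self]) simp
    qed
    then show ?thesis by (simp add: abs_mult)
  qed
  show ?thesis unfolding R_def[symmetric] continuous_on_def
  proof
    fix t :: real assume t: "t \<in> {0<..}"
    have "((\<lambda>r. R r - R t) \<longlongrightarrow> 0) (at t within {0<..})"
    proof (rule Lim_null_comparison)
      show "\<forall>\<^sub>F r in at t within {0<..}. norm (R r - R t) \<le> \<bar>K\<bar> * \<bar>1 / r - 1 / t\<bar>"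
        using t le by (auto simp: eventually_at_filter)
      have "((\<lambda>r. \<bar>K\<bar> * \<bar>1 / r - 1 / t\<bar>) \<longlongrightarrow> \<bar>K\<bar> * \<bar>1 / t - 1 / t\<bar>) (at t within {0<..})"
        using t by (intro tendsto_intros) auto
      then show "((\<lambda>r. \<bar>K\<bar> * \<bar>1 / r - 1 / t\<bar>) \<longlongrightarrow> 0) (at t within {0<..})" by simp
    qed
    then show "(R \<longlongrightarrow> R t) (at t within {0<..})" by (rule LIM_zero_cancel)
  qed
qed

text \<open>Integrating t^b e^(-t) e^(-ts) over t gives Gamma(b + 1)/(1 + s)^(b+1). Integrating the
  majorant over s leaves a multiple of t^(b-1) e^(-t), which is integrable at 0 since b > 0; here
  the condition a > 0 of (ii) enters.\<close>

lemma has_integral_powr_exp_laplace: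
  fixes g :: "real \<Rightarrow> 'a::banach"
  assumes b: "b > 0" and g: "continuous_on {0<..} g" and gK: "\<And>s. s > 0 \<Longrightarrow> norm (g s) \<le> K"
  shows "((\<lambda>t. (t powr b * exp (- t)) *\<^sub>R integral {0<..} (\<lambda>s. exp (- t * s) *\<^sub>R g s)) has_integral
      integral {0<..} (\<lambda>s. (Gamma (b + 1) * phi_fn 0 b s) *\<^sub>R g s)) {0<..}"
proof -
  define k where "k = (\<lambda>t s. t powr b * exp (- t) * exp (- t * s))"
  define G where "G = (\<lambda>t s. k t s *\<^sub>R g s)"
  define D where "D = (\<lambda>t s. k t s * K)"
  have k: "k t s = t powr b * exp (- (s + 1) * t)" for t s
    by (simp add: k_def exp_add[symmetric] algebra_simps)
  have contk: "continuous_on ({0<..} \<times> {0<..}) (\<lambda>(t, s). k t s)"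
    unfolding k_def case_prod_beta by (intro continuous_intros) auto
  have contg: "continuous_on ({0<..} \<times> {0<..}) (\<lambda>(t::real, s). g s)"
    unfolding case_prod_beta by (rule continuous_on_compose2[OF g]) (auto intro!: continuous_intros)
  have contG: "continuous_on ({0<..} \<times> {0<..}) (\<lambda>(t, s). G t s)"
    using continuous_on_scaleR[OF contk contg] by (simp add: G_def case_prod_beta)
  have contD: "continuous_on ({0<..} \<times> {0<..}) (\<lambda>(t, s). D t s)"
    using continuous_on_mult_right[OF contk, of K] by (simp add: D_def case_prod_beta)
  have swap: "continuous_on ({0<..} \<times> {0<..}) (\<lambda>(s, t). h t s)" if "continuous_on ({0<..} \<times> {0<..}) (\<lambda>(t, s). h t s)" for h :: "real \<Rightarrow> real \<Rightarrow> 'c::topological_space"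
  proof -
    have "continuous_on ({0<..} \<times> {0<..}) (\<lambda>p::real \<times> real. (snd p, fst p))" by (intro continuous_intros)
    moreover have "(\<lambda>p::real \<times> real. (snd p, fst p)) ` ({0<..} \<times> {0<..}) \<subseteq> {0<..} \<times> {0<..}" by auto
    ultimately have "continuous_on ({0<..} \<times> {0<..}) (\<lambda>p. case (snd p, fst p) of (t, s) \<Rightarrow> h t s)"
      by (rule continuous_on_compose2[OF that])
    then show ?thesis by (simp add: case_prod_beta)
  qed
  have k0: "k t s \<ge> 0" for t s by (simp add: k_def)
  have le: "norm (G t s) \<le> D t s" if "t > 0" "s > 0" for t s
    using mult_left_mono[OF gK[OF that(2)] k0, of t s] k0[of t s] by (simp add: G_def D_def)
  have inner1: "integral {0<..} (G t) = (t powr b * exp (- t)) *\<^sub>R integral {0<..} (\<lambda>s. exp (- t * s) *\<^sub>R g s)" for t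
  proof -
    have "G t = (\<lambda>s. (t powr b * exp (- t)) *\<^sub>R (exp (- t * s) *\<^sub>R g s))" by (simp add: G_def k_def)
    then show ?thesis by (simp only: integral_cmul)
  qed
  have D1: "(D t has_integral t powr (b - 1) * exp (- 1 * t) * K) {0<..}" if t: "t > 0" for t
  proof -
    have "(D t has_integral t powr b * exp (- t) * (1 / t) * K) {0<..}" unfolding D_def k_def
      by (intro has_integral_mult_left has_integral_mult_right has_integral_exp_halfline t)
    then show ?thesis using t by (simp add: powr_diff)
  qed
  have one: "(\<lambda>t. integral {0<..} (G t)) integrable_on {0<..}"
    "(\<lambda>m. integral (window m) (\<lambda>t. integral (window m) (G t))) \<longlonglongrightarrow> integral {0<..} (\<lambda>t. integral {0<..} (G t))"
  proof -
    have E: "(\<lambda>t. t powr (b - 1) * exp (- 1 * t) * K) integrable_on {0<..}"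
      using b by (intro integrable_on_mult_left integrable_powr_exp) auto
    have cB: "continuous_on {0<..} (\<lambda>t. integral {0<..} (G t))"
      unfolding inner1 by (intro continuous_intros continuous_on_laplace[OF g gK]) auto
    show "(\<lambda>t. integral {0<..} (G t)) integrable_on {0<..}"
      by (rule quadrant_window_integral(1)[OF contG contD le D1 E cB])
    show "(\<lambda>m. integral (window m) (\<lambda>t. integral (window m) (G t))) \<longlonglongrightarrow> integral {0<..} (\<lambda>t. integral {0<..} (G t))"
      by (rule quadrant_window_integral(2)[OF contG contD le D1 E cB])
  qed
  have k2: "((\<lambda>t. k t s) has_integral Gamma (b + 1) * phi_fn 0 b s) {0<..}" if "s > 0" for s
    using has_integral_powr_exp[of b "s + 1"] b that unfolding k by (simp add: phi_fn_def add.commute)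
  have inner2: "integral {0<..} (\<lambda>t. G t s) = (Gamma (b + 1) * phi_fn 0 b s) *\<^sub>R g s" if "s > 0" for s
    unfolding G_def using has_integral_scaleR_left[OF k2[OF that]] by (rule integral_unique)
  have two: "(\<lambda>m. integral (window m) (\<lambda>s. integral (window m) (\<lambda>t. G t s))) \<longlonglongrightarrow> integral {0<..} (\<lambda>s. integral {0<..} (\<lambda>t. G t s))"
  proof (rule quadrant_window_integral(2)[OF swap[OF contG] swap[OF contD]])
    show "((\<lambda>t. D t s) has_integral Gamma (b + 1) * phi_fn 0 b s * K) {0<..}" if "s > 0" for s
      unfolding D_def by (intro has_integral_mult_left k2 that)
    show "(\<lambda>s. Gamma (b + 1) * phi_fn 0 b s * K) integrable_on {0<..}"
      by (intro integrable_on_mult_left integrable_on_mult_right has_integral_integrable[OF has_integral_phi_fn[OF b]])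
    have "continuous_on {0<..} (\<lambda>s. (Gamma (b + 1) * phi_fn 0 b s) *\<^sub>R g s)" by (intro continuous_intros g)
    then show "continuous_on {0<..} (\<lambda>s. integral {0<..} (\<lambda>t. G t s))"
      by (rule continuous_on_eq) (simp add: inner2)
  qed (use le in auto)
  have "integral (window m) (\<lambda>t. integral (window m) (G t)) = integral (window m) (\<lambda>s. integral (window m) (\<lambda>t. G t s))" for m
  proof -
    have "cbox (1 / real (Suc m), 1 / real (Suc m)) (real (Suc m), real (Suc m)) = window m \<times> window m"
      by (simp add: cbox_Pair_eq)
    moreover have "window m \<times> window m \<subseteq> {0<..} \<times> {0<..}" using window_pos by blast
    ultimately have "continuous_on (cbox (1 / real (Suc m), 1 / real (Suc m)) (real (Suc m), real (Suc m))) (\<lambda>(t, s). G t s)"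
      using continuous_on_subset[OF contG] by simp
    from integral_swap_continuous[OF this] show ?thesis by simp
  qed
  with one(2) two have "integral {0<..} (\<lambda>t. integral {0<..} (G t)) = integral {0<..} (\<lambda>s. integral {0<..} (\<lambda>t. G t s))"
    by (simp only: LIMSEQ_unique)
  also have "\<dots> = integral {0<..} (\<lambda>s. (Gamma (b + 1) * phi_fn 0 b s) *\<^sub>R g s)"
    by (intro integral_cong) (simp add: inner2)
  finally show ?thesis using integrable_integral[OF one(1)] by (simp only: inner1)
qed

text \<open>By linearity, since the kernel is a combination of functions t^(a+i) e^(-t). That the
  same coefficients recombine to phi_n follows from computing the scalar Laplace transform of the
  kernel in two ways.\<close>

lemma has_integral_laguerre_fn_laplace:
  fixes g :: "real \<Rightarrow> 'a::banach"
  assumes a: "a > 0" and g: "continuous_on {0<..} g" and gK: "\<And>s. s > 0 \<Longrightarrow> norm (g s) \<le> K"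
  shows "((\<lambda>t. laguerre_fn n a t *\<^sub>R integral {0<..} (\<lambda>s. exp (- t * s) *\<^sub>R g s)) has_integral
      integral {0<..} (\<lambda>s. phi_fn n a s *\<^sub>R g s)) {0<..}"
proof -
  define d where "d = degree (lag_poly n a)"
  define c where "c = (\<lambda>i. fact n / Gamma (real n + a + 1) * coeff (lag_poly n a) i)"
  have ell: "laguerre_fn n a t = (\<Sum>i\<le>d. c i * (t powr (a + real i) * exp (- t)))" if "t > 0" for t
    unfolding laguerre_fn_poly powr_exp_poly[OF that] d_def c_def by (simp add: sum_distrib_left mult_ac)
  have pos: "a + real i > 0" for i using a by simp
  have phi: "phi_fn n a s = (\<Sum>i\<le>d. c i * (Gamma (a + real i + 1) * phi_fn 0 (a + real i) s))" if s: "s > 0" for s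
  proof -
    have "((\<lambda>t. \<Sum>i\<le>d. c i * (t powr (a + real i) * exp (- (s + 1) * t))) has_integral
       (\<Sum>i\<le>d. c i * (Gamma (a + real i + 1) / (s + 1) powr (a + real i + 1)))) {0<..}"
      by (intro has_integral_sum has_integral_mult_right has_integral_powr_exp) (use a s in auto)
    moreover have "((\<lambda>t. \<Sum>i\<le>d. c i * (t powr (a + real i) * exp (- (s + 1) * t))) has_integral phi_fn n a s) {0<..}"
    proof (rule has_integral_eq[rotated])
      show "((\<lambda>t. laguerre_fn n a t * exp (- s * t)) has_integral phi_fn n a s) {0<..}"
        using a s by (intro has_integral_laguerre_fn_exp) auto
      fix t :: real assume t: "t \<in> {0<..}"
      have "exp (- (s + 1) * t) = exp (- t) * exp (- s * t)" by (simp add: exp_add[symmetric] algebra_simps)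
      then show "laguerre_fn n a t * exp (- s * t) = (\<Sum>i\<le>d. c i * (t powr (a + real i) * exp (- (s + 1) * t)))"
        using t by (simp add: ell sum_distrib_left mult_ac)
    qed
    ultimately have "phi_fn n a s = (\<Sum>i\<le>d. c i * (Gamma (a + real i + 1) / (s + 1) powr (a + real i + 1)))"
      by (rule has_integral_unique[rotated])
    then show ?thesis by (simp add: phi_fn_def)
  qed
  have int: "(\<lambda>s. (Gamma (a + real i + 1) * phi_fn 0 (a + real i) s) *\<^sub>R g s) integrable_on {0<..}" for i
    unfolding scaleR_scaleR[symmetric] by (intro integrable_cmul integrable_phi_fn_scaleR(1)[OF pos g gK])
  have "((\<lambda>t. \<Sum>i\<le>d. c i *\<^sub>R ((t powr (a + real i) * exp (- t)) *\<^sub>R integral {0<..} (\<lambda>s. exp (- t * s) *\<^sub>R g s))) has_integral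
     (\<Sum>i\<le>d. c i *\<^sub>R integral {0<..} (\<lambda>s. (Gamma (a + real i + 1) * phi_fn 0 (a + real i) s) *\<^sub>R g s))) {0<..}"
    by (intro has_integral_sum has_integral_cmul has_integral_powr_exp_laplace[OF pos g gK]) auto
  then have "((\<lambda>t. laguerre_fn n a t *\<^sub>R integral {0<..} (\<lambda>s. exp (- t * s) *\<^sub>R g s)) has_integral
     (\<Sum>i\<le>d. c i *\<^sub>R integral {0<..} (\<lambda>s. (Gamma (a + real i + 1) * phi_fn 0 (a + real i) s) *\<^sub>R g s))) {0<..}"
    by (rule has_integral_eq[rotated]) (simp add: ell scaleR_sum_left)
  moreover have "((\<lambda>s. \<Sum>i\<le>d. c i *\<^sub>R ((Gamma (a + real i + 1) * phi_fn 0 (a + real i) s) *\<^sub>R g s)) has_integral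
     (\<Sum>i\<le>d. c i *\<^sub>R integral {0<..} (\<lambda>s. (Gamma (a + real i + 1) * phi_fn 0 (a + real i) s) *\<^sub>R g s))) {0<..}"
    by (intro has_integral_sum has_integral_cmul integrable_integral int) auto
  then have "((\<lambda>s. phi_fn n a s *\<^sub>R g s) has_integral
     (\<Sum>i\<le>d. c i *\<^sub>R integral {0<..} (\<lambda>s. (Gamma (a + real i + 1) * phi_fn 0 (a + real i) s) *\<^sub>R g s))) {0<..}"
    by (rule has_integral_eq[rotated]) (simp add: phi scaleR_sum_left)
  then have "integral {0<..} (\<lambda>s. phi_fn n a s *\<^sub>R g s) = (\<Sum>i\<le>d. c i *\<^sub>R integral {0<..} (\<lambda>s. (Gamma (a + real i + 1) * phi_fn 0 (a + real i) s) *\<^sub>R g s))"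
    by (rule integral_unique)
  ultimately show ?thesis by simp
qed

section \<open>Bounded semigroups\<close>

definition L1_continuous :: "(real \<Rightarrow> real) \<Rightarrow> bool" where
  "L1_continuous g \<longleftrightarrow> continuous_on {0<..} g \<and> (\<lambda>t. \<bar>g t\<bar>) integrable_on {0<..}"

lemma L1_continuous_laguerre_fn: "a > -1 \<Longrightarrow> L1_continuous (laguerre_fn n a)"
  by (simp add: L1_continuous_def continuous_laguerre_fn integrable_abs_laguerre_fn)

lemma L1_continuous_exp: "L1_continuous (\<lambda>t. exp (- t))" "L1_continuous (\<lambda>t. - exp (- t))"
  using has_integral_exp_halfline[of 1]
  by (auto simp: L1_continuous_def intro!: continuous_intros has_integral_integrable)

locale c0_semigroup =
  fixes T :: "real \<Rightarrow> ('a::banach \<Rightarrow>\<^sub>L 'a)" and M :: real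
  assumes bdd_c0: "bounded_c0_semigroup T M"
begin

lemma T_0: "T 0 = id_blinfun"
  and T_add: "s \<ge> 0 \<Longrightarrow> t \<ge> 0 \<Longrightarrow> T (s + t) = T s o\<^sub>L T t"
  and T_continuous: "continuous_on {0..} (\<lambda>t. T t x)"
  and T_norm: "t \<ge> 0 \<Longrightarrow> norm (T t) \<le> M"
  using bdd_c0 by (auto simp: bounded_c0_semigroup_def)

lemma M_nonneg: "M \<ge> 0"
  using order_trans[OF norm_ge_zero T_norm[of 0]] by simp

lemma T_add_apply: "s \<ge> 0 \<Longrightarrow> t \<ge> 0 \<Longrightarrow> T (s + t) x = T s (T t x)"
  by (simp add: T_add)

lemma T_commute: "s \<ge> 0 \<Longrightarrow> t \<ge> 0 \<Longrightarrow> T s (T t x) = T t (T s x)"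
  by (metis T_add_apply add.commute)

lemma T_apply_norm: "t \<ge> 0 \<Longrightarrow> norm (T t x) \<le> M * norm x"
  by (meson T_norm mult_right_mono norm_blinfun norm_ge_zero order_trans)

lemma T_continuous_pos: "continuous_on {0<..} (\<lambda>t. T t x)"
  by (rule continuous_on_subset[OF T_continuous]) auto

lemma T_continuous_Icc: "a \<ge> 0 \<Longrightarrow> continuous_on {a..b} (\<lambda>t. T t x)"
  by (rule continuous_on_subset[OF T_continuous]) auto

text \<open>The Hille--Phillips calculus: formally, \<open>Phi g\<close> is the Laplace transform of
  \<open>g\<close> evaluated at A.\<close>

definition Phi :: "(real \<Rightarrow> real) \<Rightarrow> 'a \<Rightarrow> 'a" where
  "Phi g x = integral {0<..} (\<lambda>t. g t *\<^sub>R T t x)"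

lemma Phi_integrable:
  assumes "L1_continuous g"
  shows "(\<lambda>t. g t *\<^sub>R T t x) integrable_on {0<..}"
    and "norm (Phi g x) \<le> M * integral {0<..} (\<lambda>t. \<bar>g t\<bar>) * norm x"
proof -
  have cont: "continuous_on {0<..} (\<lambda>t. g t *\<^sub>R T t x)"
    using assms by (intro continuous_intros T_continuous_pos) (simp add: L1_continuous_def)
  have int: "(\<lambda>t. \<bar>g t\<bar> * (M * norm x)) integrable_on {0<..}"
    using assms by (intro integrable_on_mult_left) (simp add: L1_continuous_def)
  have le: "norm (g t *\<^sub>R T t x) \<le> \<bar>g t\<bar> * (M * norm x)" if "t > 0" for t
    using T_apply_norm[of t x] that by (simp add: mult_left_mono)
  show "(\<lambda>t. g t *\<^sub>R T t x) integrable_on {0<..}"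
    by (rule dominated_integrable_halfline[OF cont int le])
  show "norm (Phi g x) \<le> M * integral {0<..} (\<lambda>t. \<bar>g t\<bar>) * norm x"
    using dominated_integral_bound_halfline[OF cont int le] by (simp add: Phi_def mult_ac)
qed

lemma bounded_linear_Phi:
  assumes "L1_continuous g"
  shows "bounded_linear (Phi g)"
proof (rule bounded_linear_intro)
  show "Phi g (x + y) = Phi g x + Phi g y" for x y
    unfolding Phi_def blinfun.add_right scaleR_add_right by (intro integral_add Phi_integrable(1)[OF assms])
  show "Phi g (r *\<^sub>R x) = r *\<^sub>R Phi g x" for r x
  proof -
    have "(\<lambda>t. g t *\<^sub>R T t (r *\<^sub>R x)) = (\<lambda>t. r *\<^sub>R (g t *\<^sub>R T t x))" by (simp add: blinfun.scaleR_right mult.commute)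
    then show ?thesis unfolding Phi_def by (simp only: integral_cmul)
  qed
  show "norm (Phi g x) \<le> norm x * (M * integral {0<..} (\<lambda>t. \<bar>g t\<bar>))" for x
    using Phi_integrable(2)[OF assms, of x] by (simp add: mult.commute)
qed

lemma T_Phi:
  assumes "L1_continuous g" "h \<ge> 0"
  shows "T h (Phi g x) = Phi g (T h x)"
proof -
  have "((\<lambda>t. T h (g t *\<^sub>R T t x)) has_integral T h (Phi g x)) {0<..}"
    using has_integral_linear[OF integrable_integral[OF Phi_integrable(1)[OF assms(1)]] blinfun.bounded_linear_right[of "T h"]]
    by (simp add: o_def Phi_def)
  moreover have "T h (g t *\<^sub>R T t x) = g t *\<^sub>R T t (T h x)" if "t \<in> {0<..}" for t
    using that assms by (simp add: blinfun.scaleR_right T_commute)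
  ultimately have "((\<lambda>t. g t *\<^sub>R T t (T h x)) has_integral T h (Phi g x)) {0<..}"
    by (rule has_integral_eq[rotated])
  then show ?thesis unfolding Phi_def[of g "T h x"] by (simp add: integral_unique)
qed

lemma Phi_cong: "(\<And>t. t > 0 \<Longrightarrow> g t = h t) \<Longrightarrow> Phi g x = Phi h x"
  unfolding Phi_def by (intro integral_cong) simp

lemma Phi_add: "L1_continuous g \<Longrightarrow> L1_continuous h \<Longrightarrow> Phi (\<lambda>t. g t + h t) x = Phi g x + Phi h x"
  unfolding Phi_def scaleR_add_left by (intro integral_add Phi_integrable(1))

text \<open>A smoothing device: \<open>T t (orbit_integral h x)\<close> is differentiable in t > 0
  for every x, and \<open>(1 / h) *\<^sub>R orbit_integral h x\<close> tends to x.\<close>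

definition orbit_integral :: "real \<Rightarrow> 'a \<Rightarrow> 'a" where
  "orbit_integral r x = integral {0..r} (\<lambda>s. T s x)"

lemma orbit_integral_derivative:
  assumes "r > 0"
  shows "((\<lambda>r. orbit_integral r x) has_vector_derivative T r x) (at r)"
proof -
  have "((\<lambda>u. integral {0..u} (\<lambda>s. T s x)) has_vector_derivative T r x) (at r within {0..r+1})"
    using assms by (intro integral_has_vector_derivative T_continuous_Icc) auto
  then show ?thesis using assms by (simp add: at_within_Icc_at orbit_integral_def)
qed

lemma orbit_integral_continuous: "continuous_on {0..r} (\<lambda>u. orbit_integral u x)"
  unfolding orbit_integral_def by (intro indefinite_integral_continuous_1 integrable_continuous_real T_continuous_Icc) auto

lemma bounded_linear_orbit_integral: "bounded_linear (orbit_integral r)"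
proof (rule bounded_linear_intro)
  have int: "(\<lambda>s. T s x) integrable_on {0..r}" for x
    by (intro integrable_continuous_real T_continuous_Icc) auto
  show "orbit_integral r (x + y) = orbit_integral r x + orbit_integral r y" for x y
    unfolding orbit_integral_def blinfun.add_right by (intro integral_add int)
  show "orbit_integral r (c *\<^sub>R x) = c *\<^sub>R orbit_integral r x" for c x
    unfolding orbit_integral_def blinfun.scaleR_right by (rule integral_cmul)
  show "norm (orbit_integral r x) \<le> norm x * (M * \<bar>r\<bar>)" for x
  proof (cases "r \<ge> 0")
    case True
    have "norm (orbit_integral r x) \<le> integral {0..r} (\<lambda>_. M * norm x)" unfolding orbit_integral_def
      by (rule integral_norm_bound_integral[OF int]) (auto simp: T_apply_norm intro!: integrable_continuous_real continuous_intros)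
    also have "\<dots> = norm x * (M * \<bar>r\<bar>)" using True by (simp add: mult_ac)
    finally show ?thesis .
  next
    case False
    then have "norm (orbit_integral r x) = 0" by (simp add: orbit_integral_def)
    also have "0 \<le> norm x * (M * \<bar>r\<bar>)" using M_nonneg by (intro mult_nonneg_nonneg) auto
    finally show ?thesis .
  qed
qed

text \<open>The semigroup law shifts the interval of integration from [0, h] to [t, t + h].\<close>

lemma T_orbit_integral:
  assumes "t \<ge> 0" "h \<ge> 0"
  shows "T t (orbit_integral h x) = orbit_integral (t + h) x - orbit_integral t x"
proof -
  have "((\<lambda>s. T s x) has_integral orbit_integral h x) {0..h}"
    unfolding orbit_integral_def by (intro integrable_integral integrable_continuous_real T_continuous_Icc) auto
  from has_integral_linear[OF this blinfun.bounded_linear_right[of "T t"]]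
  have "((\<lambda>s. T t (T s x)) has_integral T t (orbit_integral h x)) {0..h}" by (simp add: o_def)
  moreover have "((\<lambda>s. T t (T s x)) has_integral (orbit_integral (t + h) x - orbit_integral (t + 0) x)) {0..h}"
  proof (rule fundamental_theorem_of_calculus_interior[OF assms(2)])
    show "continuous_on {0..h} (\<lambda>s. orbit_integral (t + s) x)"
      by (rule continuous_on_compose2[OF orbit_integral_continuous[of "t + h"]]) (use assms in \<open>auto intro!: continuous_intros\<close>)
    fix s assume s: "s \<in> {0<..<h}"
    have "((\<lambda>r. orbit_integral r x) has_vector_derivative T (t + s) x) (at (t + s))"
      using s assms by (intro orbit_integral_derivative) auto
    moreover have "((\<lambda>s. t + s) has_vector_derivative 1) (at s)" by (auto intro!: derivative_eq_intros)
    ultimately have "((\<lambda>r. orbit_integral r x) \<circ> (\<lambda>s. t + s) has_vector_derivative 1 *\<^sub>R T (t + s) x) (at s)"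
      by (intro vector_diff_chain_at)
    then have "((\<lambda>s. orbit_integral (t + s) x) has_vector_derivative T (t + s) x) (at s)" by (simp add: o_def)
    then show "((\<lambda>s. orbit_integral (t + s) x) has_vector_derivative T t (T s x)) (at s)"
      using s assms by (simp add: T_add_apply)
  qed
  ultimately show ?thesis by (simp add: has_integral_unique)
qed

lemma orbit_integral_tendsto: "((\<lambda>h. (1 / h) *\<^sub>R orbit_integral h x) \<longlongrightarrow> x) (at_right 0)"
proof -
  have "((\<lambda>u. orbit_integral u x) has_vector_derivative T 0 x) (at 0 within {0..1})"
    unfolding orbit_integral_def by (intro integral_has_vector_derivative T_continuous_Icc) auto
  then have "((\<lambda>u. orbit_integral u x) has_derivative (\<lambda>h. h *\<^sub>R x)) (at 0 within {0..1})"
    by (simp add: has_vector_derivative_def T_0)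
  then have "((\<lambda>y. norm (orbit_integral y x - orbit_integral 0 x - (y - 0) *\<^sub>R x) / norm (y - 0)) \<longlongrightarrow> 0) (at 0 within {0..1})"
    unfolding has_derivative_iff_norm by blast
  then have "((\<lambda>y. norm (orbit_integral y x - y *\<^sub>R x) / \<bar>y\<bar>) \<longlongrightarrow> 0) (at_right 0)"
    by (simp add: at_within_Icc_at_right orbit_integral_def)
  then have "((\<lambda>h. norm ((1 / h) *\<^sub>R orbit_integral h x - x)) \<longlongrightarrow> 0) (at_right 0)"
  proof (rule Lim_transform_eventually)
    show "\<forall>\<^sub>F h in at_right 0. norm (orbit_integral h x - h *\<^sub>R x) / \<bar>h\<bar> = norm ((1 / h) *\<^sub>R orbit_integral h x - x)"
      using eventually_at_right_less[of "0::real"]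
    proof eventually_elim
      case (elim h)
      then have "(1 / h) *\<^sub>R orbit_integral h x - x = (1 / h) *\<^sub>R (orbit_integral h x - h *\<^sub>R x)" by (simp add: scaleR_diff_right)
      then show ?case using elim by simp
    qed
  qed
  then show ?thesis by (rule LIM_zero_cancel[OF tendsto_norm_zero_cancel])
qed

lemma genA_eqI:
  assumes "((\<lambda>h. (1 / h) *\<^sub>R (T h x - x)) \<longlongrightarrow> - y) (at_right 0)"
  shows "x \<in> gen_dom T" "genA T x = y"
  using assms tendsto_Lim[OF _ assms] by (auto simp: gen_dom_def genA_def)

lemma genA_tendsto:
  assumes "x \<in> gen_dom T"
  shows "((\<lambda>h. (1 / h) *\<^sub>R (T h x - x)) \<longlongrightarrow> - genA T x) (at_right 0)"
proof -
  obtain y where y: "((\<lambda>h. (1 / h) *\<^sub>R (T h x - x)) \<longlongrightarrow> y) (at_right 0)"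
    using assms by (auto simp: gen_dom_def)
  then have "genA T x = - y" using genA_eqI(2)[of x "- y"] by simp
  then show ?thesis using y by simp
qed

text \<open>Integration by parts against \<open>t \<mapsto> T t (orbit_integral h x)\<close>, whose derivative is \<open>T t (T h x - x)\<close>,
  needs no regularity of \<open>x\<close>.\<close>
lemma Phi_by_parts:
  assumes g: "L1_continuous g" and g': "L1_continuous g'" and dg: "\<And>t. t > 0 \<Longrightarrow> (g has_real_derivative g' t) (at t)"
    and lim0: "(g \<longlongrightarrow> g0) (at_right 0)" and limtop: "(g \<longlongrightarrow> 0) at_top" and h: "h > 0"
  shows "Phi g (T h x - x) = - (Phi g' (orbit_integral h x) + g0 *\<^sub>R orbit_integral h x)"
proof -
  define u where "u = (\<lambda>t. T t (orbit_integral h x))"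
  have u: "u t = orbit_integral (t + h) x - orbit_integral t x" if "t \<ge> 0" for t
    unfolding u_def using that h by (intro T_orbit_integral) auto
  have du: "(u has_vector_derivative T t (T h x - x)) (at t)" if t: "t > 0" for t
  proof -
    have "((\<lambda>r. orbit_integral r x) has_vector_derivative T (t + h) x) (at (t + h))"
      using t h by (intro orbit_integral_derivative) auto
    moreover have "((\<lambda>t. t + h) has_vector_derivative 1) (at t)" by (auto intro!: derivative_eq_intros)
    ultimately have "((\<lambda>r. orbit_integral r x) \<circ> (\<lambda>t. t + h) has_vector_derivative 1 *\<^sub>R T (t + h) x) (at t)"
      by (intro vector_diff_chain_at)
    then have "((\<lambda>t. orbit_integral (t + h) x) has_vector_derivative T (t + h) x) (at t)" by (simp add: o_def)
    from has_vector_derivative_diff[OF this orbit_integral_derivative[OF t]]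
    have "((\<lambda>t. orbit_integral (t + h) x - orbit_integral t x) has_vector_derivative T (t + h) x - T t x) (at t)" .
    then have "(u has_vector_derivative T (t + h) x - T t x) (at t)"
      by (rule has_vector_derivative_transform_within_open[of _ _ _ "{0<..}"]) (use t u in auto)
    then show ?thesis using t h by (simp add: T_add_apply blinfun.diff_right)
  qed
  have ubd: "norm (u t) \<le> M * norm (orbit_integral h x)" if "t \<ge> 0" for t
    unfolding u_def using that by (rule T_apply_norm)
  have "(u \<longlongrightarrow> u 0) (at 0 within {0..})" using T_continuous[of "orbit_integral h x"] by (simp add: u_def continuous_on_def)
  then have "(u \<longlongrightarrow> u 0) (at_right 0)" by (rule tendsto_within_subset) auto
  from tendsto_scaleR[OF lim0 this] have l0: "((\<lambda>t. g t *\<^sub>R u t) \<longlongrightarrow> g0 *\<^sub>R orbit_integral h x) (at_right 0)"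
    by (simp add: u_def T_0)
  have l1: "((\<lambda>t. g t *\<^sub>R u t) \<longlongrightarrow> 0) at_top"
  proof (rule Lim_null_comparison)
    show "\<forall>\<^sub>F t in at_top. norm (g t *\<^sub>R u t) \<le> \<bar>g t\<bar> * (M * norm (orbit_integral h x))"
      using eventually_ge_at_top[of "0::real"] by eventually_elim (auto intro!: mult_left_mono ubd)
    show "((\<lambda>t. \<bar>g t\<bar> * (M * norm (orbit_integral h x))) \<longlongrightarrow> 0) at_top"
      using tendsto_mult_left_zero[OF tendsto_rabs_zero[OF limtop]] .
  qed
  have "((\<lambda>t. g t *\<^sub>R T t (T h x - x) + g' t *\<^sub>R u t) has_integral (0 - g0 *\<^sub>R orbit_integral h x)) {0<..}"
    by (rule FTC_halfline[OF _ l0 l1]) (intro has_vector_derivative_scaleR dg du)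
  moreover have "((\<lambda>t. g t *\<^sub>R T t (T h x - x) + g' t *\<^sub>R u t) has_integral (Phi g (T h x - x) + Phi g' (orbit_integral h x))) {0<..}"
    unfolding Phi_def u_def by (intro has_integral_add integrable_integral Phi_integrable(1) g g')
  ultimately have "0 - g0 *\<^sub>R orbit_integral h x = Phi g (T h x - x) + Phi g' (orbit_integral h x)" by (rule has_integral_unique)
  then show ?thesis by (simp add: algebra_simps)
qed

text \<open>The Laplace rule "s times the transform of g is the transform of g' plus g(0+)", with s
  replaced by A. \<open>Phi_by_parts\<close> is divided by h and h tends to 0; the minus sign
  reflects that -A is the generator. Since \<open>T h\<close> commutes with \<open>Phi g\<close>,
  the same limit yields A (Phi g x) and, for x in the domain, Phi g (A x).\<close>

lemma Phi_gen:
  assumes g: "L1_continuous g" and g': "L1_continuous g'" and dg: "\<And>t. t > 0 \<Longrightarrow> (g has_real_derivative g' t) (at t)"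
    and lim0: "(g \<longlongrightarrow> g0) (at_right 0)" and limtop: "(g \<longlongrightarrow> 0) at_top"
  shows "Phi g x \<in> gen_dom T" "genA T (Phi g x) = Phi g' x + g0 *\<^sub>R x"
    and "x \<in> gen_dom T \<Longrightarrow> Phi g (genA T x) = Phi g' x + g0 *\<^sub>R x"
proof -
  interpret Pg: bounded_linear "Phi g" by (rule bounded_linear_Phi[OF g])
  interpret Pg': bounded_linear "Phi g'" by (rule bounded_linear_Phi[OF g'])
  have "((\<lambda>h. - (Phi g' ((1 / h) *\<^sub>R orbit_integral h x) + g0 *\<^sub>R ((1 / h) *\<^sub>R orbit_integral h x))) \<longlongrightarrow> - (Phi g' x + g0 *\<^sub>R x)) (at_right 0)"
    by (intro tendsto_minus tendsto_add tendsto_scaleR tendsto_const Pg'.tendsto orbit_integral_tendsto)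
  then have lim: "((\<lambda>h. Phi g ((1 / h) *\<^sub>R (T h x - x))) \<longlongrightarrow> - (Phi g' x + g0 *\<^sub>R x)) (at_right 0)"
  proof (rule Lim_transform_eventually)
    show "\<forall>\<^sub>F h in at_right 0. - (Phi g' ((1 / h) *\<^sub>R orbit_integral h x) + g0 *\<^sub>R ((1 / h) *\<^sub>R orbit_integral h x)) = Phi g ((1 / h) *\<^sub>R (T h x - x))"
      using eventually_at_right_less[of "0::real"]
    proof eventually_elim
      case (elim h)
      have e: "Phi g (T h x - x) = - (Phi g' (orbit_integral h x) + g0 *\<^sub>R orbit_integral h x)"
        by (rule Phi_by_parts[OF g g' dg lim0 limtop elim])
      show ?case unfolding Pg.scaleR Pg'.scaleR e by (simp add: scaleR_diff_right)
    qed
  qed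
  have "((\<lambda>h. (1 / h) *\<^sub>R (T h (Phi g x) - Phi g x)) \<longlongrightarrow> - (Phi g' x + g0 *\<^sub>R x)) (at_right 0)"
    using lim
  proof (rule Lim_transform_eventually)
    show "\<forall>\<^sub>F h in at_right 0. Phi g ((1 / h) *\<^sub>R (T h x - x)) = (1 / h) *\<^sub>R (T h (Phi g x) - Phi g x)"
      using eventually_at_right_less[of "0::real"]
      by eventually_elim (simp add: Pg.scaleR Pg.diff T_Phi[OF g])
  qed
  from genA_eqI[OF this] show "Phi g x \<in> gen_dom T" "genA T (Phi g x) = Phi g' x + g0 *\<^sub>R x" .
  assume "x \<in> gen_dom T"
  from Pg.tendsto[OF genA_tendsto[OF this]] lim
  have "Phi g (- genA T x) = - (Phi g' x + g0 *\<^sub>R x)"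
    by (intro tendsto_unique[of "at_right (0::real)"]) auto
  then show "Phi g (genA T x) = Phi g' x + g0 *\<^sub>R x" by (simp add: Pg.neg del: minus_add_distrib)
qed

text \<open>The boundary value at 0 vanishes because a + 1 > 0, so A trades one unit of parameter
  for one unit of index.\<close>

lemma Phi_laguerre_gen:
  assumes a: "a > -1"
  shows "Phi (laguerre_fn n (a + 1)) x \<in> gen_dom T"
    and "genA T (Phi (laguerre_fn n (a + 1)) x) = Phi (laguerre_fn (Suc n) a) x"
    and "x \<in> gen_dom T \<Longrightarrow> Phi (laguerre_fn n (a + 1)) (genA T x) = Phi (laguerre_fn (Suc n) a) x"
proof -
  have d: "(laguerre_fn n (a + 1) has_real_derivative laguerre_fn (Suc n) a t) (at t)" if "t > 0" for t
    using laguerre_fn_has_real_derivative[OF that, of n "a + 1"] by simp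
  have l0: "(laguerre_fn n (a + 1) \<longlongrightarrow> 0) (at_right 0)"
    using laguerre_fn_mult_poly_tendsto_0[of "a + 1" n 1] a by simp
  have l1: "(laguerre_fn n (a + 1) \<longlongrightarrow> 0) at_top"
    using laguerre_fn_mult_poly_tendsto_top[of n "a + 1" 1] by simp
  have n: "L1_continuous (laguerre_fn n (a + 1))" "L1_continuous (laguerre_fn (Suc n) a)" using a by (auto intro!: L1_continuous_laguerre_fn)
  show "Phi (laguerre_fn n (a + 1)) x \<in> gen_dom T"
    and "genA T (Phi (laguerre_fn n (a + 1)) x) = Phi (laguerre_fn (Suc n) a) x"
    and "x \<in> gen_dom T \<Longrightarrow> Phi (laguerre_fn n (a + 1)) (genA T x) = Phi (laguerre_fn (Suc n) a) x"
    using Phi_gen[OF n d l0 l1] by simp_all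
qed

lemma frac_res_eq_Phi: "frac_res T 1 (b + 1) x = Phi (laguerre_fn 0 b) x"
proof -
  have "(\<lambda>t. laguerre_fn 0 b t *\<^sub>R T t x) = (\<lambda>t. (1 / Gamma (b + 1)) *\<^sub>R ((t powr (b + 1 - 1) * exp (- 1 * t)) *\<^sub>R T t x))"
    by (simp add: laguerre_fn_def)
  then show ?thesis unfolding frac_res_def Phi_def by (simp only: integral_cmul)
qed

text \<open>After k steps the parameter is n - k + a, which stays above -1 as long as k <= n; this
  is what \<open>Phi_laguerre_gen\<close> requires at each step.\<close>

lemma genA_pow_Phi:
  assumes a: "a > -1" and "k \<le> n"
  shows "(genA T ^^ k) (Phi (laguerre_fn 0 (real n + a)) x) = Phi (laguerre_fn k (real n - real k + a)) x"
  using assms(2)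
proof (induction k)
  case (Suc k)
  have "real n - real (Suc k) + a > -1" using a Suc.prems by simp
  from Phi_laguerre_gen(2)[OF this, of k x] Suc show ?case by (simp add: algebra_simps)
qed simp

lemma frac_res_in_genA_pow_dom:
  assumes a: "a > -1"
  shows "frac_res T 1 (real n + a + 1) x \<in> genA_pow_dom T n"
    and "(genA T ^^ n) (frac_res T 1 (real n + a + 1) x) = Phi (laguerre_fn n a) x"
proof -
  have "(genA T ^^ k) (Phi (laguerre_fn 0 (real n + a)) x) \<in> gen_dom T" if "k < n" for k
  proof -
    have "real n - real k - 1 + a > -1" using a that by simp
    from Phi_laguerre_gen(1)[OF this, of k x] show ?thesis
      using genA_pow_Phi[OF a, of k n x] that by (simp add: algebra_simps)
  qed
  then show "frac_res T 1 (real n + a + 1) x \<in> genA_pow_dom T n"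
    by (simp add: genA_pow_dom_def frac_res_eq_Phi)
  show "(genA T ^^ n) (frac_res T 1 (real n + a + 1) x) = Phi (laguerre_fn n a) x"
    using genA_pow_Phi[OF a, of n n x] by (simp add: frac_res_eq_Phi)
qed

lemma Phi_has_integral: "L1_continuous g \<Longrightarrow> ((\<lambda>t. g t *\<^sub>R T t x) has_integral Phi g x) {0<..}"
  unfolding Phi_def by (intro integrable_integral Phi_integrable(1))

lemma frac_res_1: "t > 0 \<Longrightarrow> frac_res T t 1 x = integral {0<..} (\<lambda>s. exp (- t * s) *\<^sub>R T s x)"
  unfolding frac_res_def by (simp add: Gamma_1) (intro integral_cong, simp)

text \<open>The generator is a one-sided limit at 0. The two-sided derivative comes from the
  identity \<open>T r x = x - orbit_integral r (genA T x)\<close>, whose right-hand side is an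
  integral of a continuous function.\<close>

lemma T_derivative:
  assumes x: "x \<in> gen_dom T" and t: "t > 0"
  shows "((\<lambda>t. T t x) has_vector_derivative - T t (genA T x)) (at t)"
proof -
  have eq: "T r x = x - orbit_integral r (genA T x)" if r: "r > 0" for r
  proof -
    interpret P: bounded_linear "orbit_integral r" by (rule bounded_linear_orbit_integral)
    interpret Tr: bounded_linear "T r" by (rule blinfun.bounded_linear_right)
    have "((\<lambda>h. T r ((1 / h) *\<^sub>R orbit_integral h x) - (1 / h) *\<^sub>R orbit_integral h x) \<longlongrightarrow> T r x - x) (at_right 0)"
      by (intro tendsto_diff Tr.tendsto orbit_integral_tendsto)
    then have "((\<lambda>h. orbit_integral r ((1 / h) *\<^sub>R (T h x - x))) \<longlongrightarrow> T r x - x) (at_right 0)"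
    proof (rule Lim_transform_eventually)
      show "\<forall>\<^sub>F h in at_right 0. T r ((1 / h) *\<^sub>R orbit_integral h x) - (1 / h) *\<^sub>R orbit_integral h x = orbit_integral r ((1 / h) *\<^sub>R (T h x - x))"
        using eventually_at_right_less[of "0::real"]
      proof eventually_elim
        case (elim h)
        \<comment> \<open>Writing S_h for the orbit integral, (T_r - 1) S_h x and S_r (T_h - 1) x
          agree: both equal S_(r+h) x - S_h x - S_r x.\<close>
        have "orbit_integral r (T h x) = T h (orbit_integral r x)"
        proof -
          have "((\<lambda>s. T s x) has_integral orbit_integral r x) {0..r}"
            unfolding orbit_integral_def by (intro integrable_integral integrable_continuous_real T_continuous_Icc) auto
          from has_integral_linear[OF this blinfun.bounded_linear_right[of "T h"]]
          have "((\<lambda>s. T h (T s x)) has_integral T h (orbit_integral r x)) {0..r}" by (simp add: o_def)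
          then have "((\<lambda>s. T s (T h x)) has_integral T h (orbit_integral r x)) {0..r}"
            by (rule has_integral_eq[rotated]) (use elim in \<open>simp add: T_commute\<close>)
          then show ?thesis unfolding orbit_integral_def[of r "T h x"] by (rule integral_unique)
        qed
        also have "\<dots> = orbit_integral (h + r) x - orbit_integral h x" using elim r by (intro T_orbit_integral) auto
        finally have 1: "orbit_integral r (T h x - x) = orbit_integral (h + r) x - orbit_integral h x - orbit_integral r x" by (simp add: P.diff)
        have 2: "T r (orbit_integral h x) = orbit_integral (r + h) x - orbit_integral r x" using elim r by (intro T_orbit_integral) auto
        show ?case unfolding P.scaleR Tr.scaleR scaleR_diff_right[symmetric] 1 2 by (simp add: algebra_simps)
      qed
    qed
    with P.tendsto[OF genA_tendsto[OF x]] have "orbit_integral r (- genA T x) = T r x - x"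
      by (intro tendsto_unique[of "at_right (0::real)"]) auto
    then show ?thesis by (simp add: P.neg algebra_simps)
  qed
  have "((\<lambda>r. x - orbit_integral r (genA T x)) has_vector_derivative 0 - T t (genA T x)) (at t)"
    by (intro has_vector_derivative_diff has_vector_derivative_const orbit_integral_derivative t)
  then have "((\<lambda>t. T t x) has_vector_derivative 0 - T t (genA T x)) (at t)"
    by (rule has_vector_derivative_transform_within_open[of _ _ _ "{0<..}"]) (use t eq in auto)
  then show ?thesis by simp
qed

lemma Phi_laguerre_sums:
  assumes x: "x \<in> gen_dom T" and a: "a > -1" and t: "t > 0"
  shows "(\<lambda>n. laguerre n a t *\<^sub>R Phi (laguerre_fn n a) x) sums T t x"
  unfolding Phi_def
proof (rule laguerre_expansion[OF a t T_derivative[OF x], where K = "M * norm x + M * norm (genA T x)"])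
  show "continuous_on {0<..} (\<lambda>t. - T t (genA T x))" by (intro continuous_intros T_continuous_pos)
  fix s :: real assume s: "s > 0"
  have 1: "norm (T s x) \<le> M * norm x" "norm (T s (genA T x)) \<le> M * norm (genA T x)"
    using T_apply_norm[of s] s by auto
  have 2: "M * norm x \<ge> 0" "M * norm (genA T x) \<ge> 0" using M_nonneg by auto
  show "norm (T s x) \<le> M * norm x + M * norm (genA T x)" using 1 2 by linarith
  show "norm (- T s (genA T x)) \<le> M * norm x + M * norm (genA T x)" using 1 2 unfolding norm_minus_cancel by linarith
qed

text \<open>The case g(t) = e^(-t) of \<open>Phi_gen\<close>: g' = -g, and the boundary value is
  1.\<close>

lemma resolvent_gen:
  shows "frac_res T 1 1 x \<in> gen_dom T" and "genA T (frac_res T 1 1 x) = x - frac_res T 1 1 x"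
proof -
  have R: "frac_res T 1 1 x = Phi (\<lambda>t. exp (- t)) x" for x by (simp add: frac_res_1 Phi_def)
  have d: "((\<lambda>t. exp (- t)) has_real_derivative - exp (- t)) (at t)" for t :: real
    by (auto intro!: derivative_eq_intros)
  have l0: "((\<lambda>t::real. exp (- t)) \<longlongrightarrow> 1) (at_right 0)" by real_asymp
  have l1: "((\<lambda>t::real. exp (- t)) \<longlongrightarrow> 0) at_top" by real_asymp
  have neg: "Phi (\<lambda>t. - exp (- t)) x = - Phi (\<lambda>t. exp (- t)) x" by (simp add: Phi_def)
  show "frac_res T 1 1 x \<in> gen_dom T" unfolding R by (rule Phi_gen(1)[OF L1_continuous_exp d l0 l1])
  show "genA T (frac_res T 1 1 x) = x - frac_res T 1 1 x"
    unfolding R Phi_gen(2)[OF L1_continuous_exp d l0 l1] neg by simp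
qed

text \<open>The operator inside is A (A+1)^(-1). With y = (A+1)^(-1) x one has A y = x - y;
  inserting this into \<open>Phi_laguerre_gen\<close> and splitting the kernel shows that (A+1)^(-1)
  raises the parameter, and a second splitting raises the index.\<close>

lemma Phi_laguerre_resolvent:
  assumes a: "a > -1"
  shows "Phi (laguerre_fn n a) (x - frac_res T 1 1 x) = Phi (laguerre_fn (Suc n) a) x"
proof -
  define y where "y = frac_res T 1 1 x"
  have n: "L1_continuous (laguerre_fn n (a + 1))" "L1_continuous (laguerre_fn (Suc n) a)" "L1_continuous (laguerre_fn n a)"
    using a by (auto intro!: L1_continuous_laguerre_fn)
  interpret P: bounded_linear "Phi (laguerre_fn n a)" by (rule bounded_linear_Phi[OF n(3)])
  interpret P': bounded_linear "Phi (laguerre_fn n (a + 1))" by (rule bounded_linear_Phi[OF n(1)])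
  have split: "Phi (laguerre_fn n a) z = Phi (laguerre_fn n (a + 1)) z + Phi (laguerre_fn (Suc n) a) z" for z
  proof -
    have "Phi (laguerre_fn n a) z = Phi (\<lambda>t. laguerre_fn n (a + 1) t + laguerre_fn (Suc n) a t) z"
      by (rule Phi_cong) (rule laguerre_fn_split[OF a])
    then show ?thesis using Phi_add[OF n(1,2), of z] by simp
  qed
  have "Phi (laguerre_fn n (a + 1)) (x - y) = Phi (laguerre_fn (Suc n) a) y"
    using Phi_laguerre_gen(3)[OF a resolvent_gen(1), of n x] resolvent_gen(2)[of x] by (simp add: y_def)
  then have "Phi (laguerre_fn n (a + 1)) x = Phi (laguerre_fn n a) y"
    unfolding split[of y] P'.diff by (simp add: algebra_simps)
  then have "Phi (laguerre_fn n a) (x - y) = Phi (laguerre_fn n a) x - Phi (laguerre_fn n (a + 1)) x"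
    unfolding P.diff by simp
  then show ?thesis unfolding split[of x] by (simp add: y_def)
qed

text \<open>The index m is arbitrary because the induction removes the outermost factor and moves it
  into the kernel.\<close>

lemma Phi_laguerre_cogen_pow:
  assumes a: "a > -1"
  shows "Phi (laguerre_fn m a) (((\<lambda>y. (1/2) *\<^sub>R (cogen T y + y)) ^^ n) x) = Phi (laguerre_fn (m + n) a) x"
proof (induction n arbitrary: m)
  case (Suc n)
  have B: "(1/2) *\<^sub>R (cogen T y + y) = y - frac_res T 1 1 y" for y
  proof -
    have "cogen T y + y = 2 *\<^sub>R (y - frac_res T 1 1 y)"
      unfolding cogen_def resolvent_gen(2) by (simp add: scaleR_2 algebra_simps)
    then show ?thesis by simp
  qed
  show ?case unfolding funpow.simps o_def B Phi_laguerre_resolvent[OF a] Suc.IH[unfolded B] by simp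
qed simp

end

text \<open>\<open>genA\<close> and \<open>integral\<close> return a value even where the limit or
  the integral fails to exist. Hence (i) also asserts membership in the domain of A^n, and (ii) the
  integrability of the integrand on the right. In (iv) the fractional power is applied to each term
  of the series.\<close>

theorem theorem4p1:
  fixes T :: "real \<Rightarrow> ('a::banach \<Rightarrow>\<^sub>L 'a)" and M :: real
  assumes "bounded_c0_semigroup T M"
  shows
   "(\<forall>(n::nat) a x. a > -1 \<longrightarrow>
        frac_res T 1 (real n + a + 1) x \<in> genA_pow_dom T n \<and>
        ((\<lambda>t. laguerre_fn n a t *\<^sub>R blinfun_apply (T t) x) has_integral
            (genA T ^^ n) (frac_res T 1 (real n + a + 1) x)) {0<..})
  \<and> (\<forall>(n::nat) a x. a > 0 \<longrightarrow>
        (\<lambda>t. phi_fn n a t *\<^sub>R blinfun_apply (T t) x) integrable_on {0<..} \<and>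
        ((\<lambda>t. laguerre_fn n a t *\<^sub>R frac_res T t 1 x) has_integral
            integral {0<..} (\<lambda>t. phi_fn n a t *\<^sub>R blinfun_apply (T t) x)) {0<..})
  \<and> (\<forall>x a t. x \<in> gen_dom T \<longrightarrow> a > -1 \<longrightarrow> t > 0 \<longrightarrow>
        (\<lambda>n. laguerre n a t *\<^sub>R (genA T ^^ n) (frac_res T 1 (real n + a + 1) x))
          sums blinfun_apply (T t) x)
  \<and> (\<forall>x a t. x \<in> gen_dom T \<longrightarrow> a > -1 \<longrightarrow> t > 0 \<longrightarrow>
        (\<lambda>n. laguerre n a t *\<^sub>R
               frac_res T 1 (a + 1) (((\<lambda>y. (1/2) *\<^sub>R (cogen T y + y)) ^^ n) x))
          sums blinfun_apply (T t) x)
  \<and> (\<forall>x a lam. a > 1 \<longrightarrow> lam > 0 \<longrightarrow>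
        (\<lambda>n. laguerre n a lam *\<^sub>R integral {0<..} (\<lambda>t. phi_fn n a t *\<^sub>R blinfun_apply (T t) x))
          sums frac_res T lam 1 x)"
proof -
  interpret c0_semigroup T M by unfold_locales (rule assms)
  have bound: "norm (T s x) \<le> M * norm x" if "s > 0" for s x using T_apply_norm[of s x] that by simp
  show ?thesis
  proof (intro conjI allI impI)
    fix n :: nat and a :: real and x :: 'a
    assume a: "a > -1"
    show "frac_res T 1 (real n + a + 1) x \<in> genA_pow_dom T n"
      by (rule frac_res_in_genA_pow_dom(1)[OF a])
    show "((\<lambda>t. laguerre_fn n a t *\<^sub>R T t x) has_integral (genA T ^^ n) (frac_res T 1 (real n + a + 1) x)) {0<..}"
      unfolding frac_res_in_genA_pow_dom(2)[OF a] by (rule Phi_has_integral[OF L1_continuous_laguerre_fn[OF a]])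
  next
    fix n :: nat and a :: real and x :: 'a
    assume a: "a > 0"
    show "(\<lambda>t. phi_fn n a t *\<^sub>R T t x) integrable_on {0<..}"
      by (rule integrable_phi_fn_scaleR(1)[OF a T_continuous_pos bound])
    have "((\<lambda>t. laguerre_fn n a t *\<^sub>R integral {0<..} (\<lambda>s. exp (- t * s) *\<^sub>R T s x)) has_integral
        integral {0<..} (\<lambda>s. phi_fn n a s *\<^sub>R T s x)) {0<..}"
      by (rule has_integral_laguerre_fn_laplace[OF a T_continuous_pos bound])
    then show "((\<lambda>t. laguerre_fn n a t *\<^sub>R frac_res T t 1 x) has_integral integral {0<..} (\<lambda>t. phi_fn n a t *\<^sub>R T t x)) {0<..}"
      by (rule has_integral_eq[rotated]) (simp add: frac_res_1)
  next
    fix x :: 'a and a t :: real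
    assume x: "x \<in> gen_dom T" and a: "a > -1" and t: "t > 0"
    show "(\<lambda>n. laguerre n a t *\<^sub>R (genA T ^^ n) (frac_res T 1 (real n + a + 1) x)) sums T t x"
      unfolding frac_res_in_genA_pow_dom(2)[OF a] by (rule Phi_laguerre_sums[OF x a t])
    \<comment> \<open>The fractional power is the kernel of index 0, and the n factors (V + 1)/2
      raise its index to n, which leaves the series of (iii).\<close>
    show "(\<lambda>n. laguerre n a t *\<^sub>R frac_res T 1 (a + 1) (((\<lambda>y. (1/2) *\<^sub>R (cogen T y + y)) ^^ n) x)) sums T t x"
      unfolding frac_res_eq_Phi Phi_laguerre_cogen_pow[OF a] add_0 by (rule Phi_laguerre_sums[OF x a t])
  next
    fix x :: 'a and a lam :: real
    assume a: "a > 1" and lam: "lam > 0"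
    show "(\<lambda>n. laguerre n a lam *\<^sub>R integral {0<..} (\<lambda>t. phi_fn n a t *\<^sub>R T t x)) sums frac_res T lam 1 x"
      unfolding frac_res_1[OF lam] by (rule laplace_laguerre_series[OF _ lam T_continuous_pos bound]) (use a in simp)
  qed
qed

end
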